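(* Let $n\ge1$, $\varepsilon\neq0$, let $\Omega\subseteq\mathbb{R}^{2n}$ be a bounded domain, $H\in L^\infty_{loc}(\Omega)$, and $u\in BV_{loc}(\Omega)$. Then the following are equivalent: (a) for every open $\tilde\Omega\Subset\Omega$ and every $v\in BV_{loc}(\Omega)$ with $\{u\ne v\}\Subset\tilde\Omega$, $$P_\varepsilon(E_u,\tilde\Omega\times\mathbb{R})+\int_{\tilde\Omega}Hu\,dz\le P_\varepsilon(E_v,\tilde\Omega\times\mathbb{R})+\int_{\tilde\Omega}Hv\,dz;$$ (b) $E_u$ is an $H$-minimizer in $\Omega\times\mathbb{R}$, i.e. for every open $A\Subset\Omega\times\mathbb{R}$ and every measurable $F$ with $E_u\,\Delta\,F\Subset A$, $$P_\varepsilon(E_u,A)+\int_{E_u\cap A}H\,dx\le P_\varepsilon(F,A)+\int_{F\cap A}H\,dx,$$ where $H(z,t):=H(z)$.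
   Context: $\mathbb{H}^n=\mathbb{R}^{2n+1}$ with points $(z,t)=(x,y,t)$ and vector fields $X_i=\partial_{x_i}+y_i\partial_t$, $Y_i=\partial_{y_i}-x_i\partial_t$, $T=\partial_t$; $g_\varepsilon$ is the Riemannian metric making $X_1,\dots,X_n,Y_1,\dots,Y_n,\varepsilon T$ orthonormal, with norm $|\cdot|_\varepsilon$. $P_\varepsilon(E,A)=\sup\{\int_E\operatorname{div}U\,dx:U\in C^1_c(A;T\mathbb{H}^n),\ \sup|U|_\varepsilon\le1\}$ ($\operatorname{div}$ Euclidean). $E_u=\{(z,t)\in\Omega\times\mathbb{R}:t<u(z)\}$. For $u\in W^{1,1}$, $P_\varepsilon(E_u,\tilde\Omega\times\mathbb{R})=\int_{\tilde\Omega}\sqrt{\varepsilon^2+|Du+X|^2}\,dz$ with $X(x,y)=(-y,x)$; in the paper condition (a) is written with this integral, understood for BV functions as $P_\varepsilon(E_u,\tilde\Omega\times\mathbb{R})$. *)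

theory Defs
  imports "HOL-Analysis.Analysis"
begin

text \<open>Points of the Heisenberg group H^n = R^(2n+1) are ((x,y),t) with x,y in R^n.
  Points of R^(2n) are z = (x,y).\<close>

type_synonym 'n plane = "(real^'n) \<times> (real^'n)"
type_synonym 'n heis = "'n plane \<times> real"

definition cc :: "'a::topological_space set \<Rightarrow> 'a set \<Rightarrow> bool" where
  "cc S T \<longleftrightarrow> compact (closure S) \<and> closure S \<subseteq> T"

definition ediv :: "('a::euclidean_space \<Rightarrow> 'a) \<Rightarrow> 'a \<Rightarrow> real" where
  "ediv U p = (\<Sum>b\<in>Basis. frechet_derivative U (at p) b \<bullet> b)"

definition C1c :: "'a::euclidean_space set \<Rightarrow> ('a \<Rightarrow> 'b::euclidean_space) \<Rightarrow> bool" where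
  "C1c A U \<longleftrightarrow> (\<forall>p. U differentiable (at p))
     \<and> (\<forall>b\<in>Basis. continuous_on UNIV (\<lambda>p. frechet_derivative U (at p) b))
     \<and> cc {p. U p \<noteq> 0} A"

text \<open>The norm |w|_eps of a tangent vector w (Euclidean coordinates) at the point p,
  for the metric making X_i, Y_i, eps T orthonormal, where
  X_i = d_{x_i} + y_i d_t, Y_i = d_{y_i} - x_i d_t, T = d_t.\<close>
definition heis_norm :: "real \<Rightarrow> 'n::finite heis \<Rightarrow> 'n heis \<Rightarrow> real" where
  "heis_norm eps p w =
    (let x = fst (fst p); y = snd (fst p);
         wx = fst (fst w); wy = snd (fst w); wt = snd w;
         c = wt - (\<Sum>i\<in>UNIV. wx$i * y$i - wy$i * x$i)
     in sqrt ((norm wx)\<^sup>2 + (norm wy)\<^sup>2 + (c / eps)\<^sup>2))"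

definition Peps :: "real \<Rightarrow> 'n::finite heis set \<Rightarrow> 'n heis set \<Rightarrow> ereal" where
  "Peps eps E A = (SUP U\<in>{U. C1c A U \<and> (\<forall>p. heis_norm eps p (U p) \<le> 1)}.
                     ereal (LINT p:E|lebesgue. ediv U p))"

definition subgraph :: "'n::finite plane set \<Rightarrow> ('n plane \<Rightarrow> real) \<Rightarrow> 'n heis set" where
  "subgraph \<Omega> u = {(z,t). z \<in> \<Omega> \<and> t < u z}"

definition total_variation :: "('a::euclidean_space \<Rightarrow> real) \<Rightarrow> 'a set \<Rightarrow> ereal" where
  "total_variation u V = (SUP \<phi>\<in>{\<phi>. C1c V \<phi> \<and> (\<forall>z. norm (\<phi> z) \<le> 1)}.
                     ereal (LINT z:V|lebesgue. u z * ediv \<phi> z))"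

definition L1_loc :: "'a::euclidean_space set \<Rightarrow> ('a \<Rightarrow> real) \<Rightarrow> bool" where
  "L1_loc \<Omega> u \<longleftrightarrow> (\<forall>K. compact K \<and> K \<subseteq> \<Omega> \<longrightarrow> set_integrable lebesgue K u)"

definition BV_loc :: "'a::euclidean_space set \<Rightarrow> ('a \<Rightarrow> real) \<Rightarrow> bool" where
  "BV_loc \<Omega> u \<longleftrightarrow> L1_loc \<Omega> u \<and>
     (\<forall>V. open V \<and> cc V \<Omega> \<longrightarrow> total_variation u V < \<infinity>)"

definition Linf_loc :: "'a::euclidean_space set \<Rightarrow> ('a \<Rightarrow> real) \<Rightarrow> bool" where
  "Linf_loc \<Omega> H \<longleftrightarrow> set_borel_measurable lebesgue \<Omega> H \<and>
     (\<forall>K. compact K \<and> K \<subseteq> \<Omega> \<longrightarrow> (\<exists>C. AE z in lebesgue. z \<in> K \<longrightarrow> \<bar>H z\<bar> \<le> C))"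

end

theory Submission
  imports Defs
begin

text \<open>
  Since the norm \<open>heis_norm\<close> does not depend on the height \<open>t\<close>, the perimeter of a subgraph over
  \<open>V\<close> is a supremum over fields that depend on the base point only:
  \<open>P(E\<^sub>v, V \<times> \<real>) = sup \<integral>\<^sub>V v div \<phi> + \<psi>\<close>, the supremum being over \<open>C\<^sup>1\<^sub>c\<close> fields \<open>(\<phi>, \<psi>)\<close> on \<open>V\<close> of
  norm at most 1 (\<open>graph_area\<close>). For smooth \<open>v\<close> the bound from above is the divergence theorem,
  with \<open>(\<phi>, \<psi>)(z) = U(z, v z)\<close>; the general case follows by mollification.

  From graphs to sets: given a competitor \<open>F\<close> of \<open>E\<^sub>u\<close>, replace each vertical slice of \<open>F\<close> by a
  half-line of the same length relative to \<open>E\<^sub>u\<close>. Testing with fields that do not depend on \<open>t\<close>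
  shows that the resulting subgraph has no more perimeter than \<open>F\<close>, while the volume term is
  unchanged. From sets to graphs: compare \<open>E\<^sub>u\<close> with the set that equals \<open>E\<^sub>v\<close> for \<open>\<bar>t\<bar> < s\<close> and
  \<open>E\<^sub>u\<close> elsewhere, and let \<open>s\<close> tend to infinity; the perimeter created at height \<open>\<plusminus>s\<close> is controlled by
  the measure of the set where \<open>\<bar>u\<bar>\<close> or \<open>\<bar>v\<bar>\<close> is large.
\<close>

section \<open>Continuously differentiable maps\<close>

text \<open>Two gaps separate the two conditions. The cylinders over base sets in the first are not
  compactly contained in \<open>\<Omega> \<times> UNIV\<close>, as the second demands, so
  inequalities must be localized from a cylinder to a bounded set and back. And \<open>Peps\<close>
  is a supremum over test fields, so every such step is an operation on fields: cutting, gluing,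
  averaging, adding fields with disjoint supports.

  For the perimeter formula, \<open>U (z, v z)\<close> is no test field when v is merely integrable.
  After v is mollified, Fubini moves the mollification from the function back to the field. The
  metric varies with z, so an averaged field exceeds norm 1 by a factor that tends to 1 because
  \<open>eps \<noteq> 0\<close>; it is divided out. Conversely, a field that does not depend on t
  lacks compact support; it is cut off vertically, and the error vanishes because the sets concerned
  differ from the lower half-space by finite volume over the base.

  Before the minimality of u can be used, the function built from a competing set must be shown to
  lie in \<open>BV_loc\<close>; this is why graph area and total variation are compared in both
  directions.\<close>

definition C1_deriv :: "('a::euclidean_space \<Rightarrow> 'b::euclidean_space) \<Rightarrow> ('a \<Rightarrow> 'a \<Rightarrow> 'b) \<Rightarrow> bool" where
  "C1_deriv f f' \<longleftrightarrow> (\<forall>p. (f has_derivative f' p) (at p)) \<and> (\<forall>h. continuous_on UNIV (\<lambda>p. f' p h))"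

lemma C1_derivI:
  assumes "\<And>p. (f has_derivative f' p) (at p)" "\<And>h. continuous_on UNIV (\<lambda>p. f' p h)"
  shows "C1_deriv f f'"
  using assms by (auto simp: C1_deriv_def)

lemma C1_deriv_D:
  assumes "C1_deriv f f'"
  shows "(f has_derivative f' p) (at p)" "continuous_on UNIV (\<lambda>p. f' p h)"
    "frechet_derivative f (at p) = f' p" "linear (f' p)" "continuous_on UNIV f"
    "f differentiable at p"
proof -
  show d: "(f has_derivative f' p) (at p)" for p
    using assms by (auto simp: C1_deriv_def)
  show "continuous_on UNIV (\<lambda>p. f' p h)" using assms by (auto simp: C1_deriv_def)
  show "frechet_derivative f (at p) = f' p"
    using frechet_derivative_at[OF d] by simp
  show "linear (f' p)" using d has_derivative_linear by blast
  show "continuous_on UNIV f"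
    using d by (meson continuous_at_imp_continuous_on has_derivative_continuous)
  show "f differentiable at p" using d by (auto simp: differentiable_def)
qed

text \<open>Continuity of the derivatives in basis directions extends to every direction by
  linearity, so an explicit derivative can be carried along instead of
  \<open>frechet_derivative\<close>.\<close>

lemma C1c_iff: "C1c A U \<longleftrightarrow> (\<exists>U'. C1_deriv U U') \<and> cc {p. U p \<noteq> 0} A"
proof
  assume *: "C1c A U"
  have d: "(U has_derivative frechet_derivative U (at p)) (at p)" for p
    using * by (auto simp: C1c_def frechet_derivative_works)
  have "continuous_on UNIV (\<lambda>p. frechet_derivative U (at p) h)" for h
  proof -
    have "frechet_derivative U (at p) h = (\<Sum>b\<in>Basis. (h \<bullet> b) *\<^sub>R frechet_derivative U (at p) b)" for p
    proof -
      interpret linear "frechet_derivative U (at p)" using d has_derivative_linear by blast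
      have "frechet_derivative U (at p) h = frechet_derivative U (at p) (\<Sum>b\<in>Basis. (h \<bullet> b) *\<^sub>R b)"
        by (simp add: euclidean_representation)
      then show ?thesis by (simp add: sum scale)
    qed
    moreover have "continuous_on UNIV (\<lambda>p. \<Sum>b\<in>Basis. (h \<bullet> b) *\<^sub>R frechet_derivative U (at p) b)"
      using * by (intro continuous_intros) (auto simp: C1c_def)
    ultimately show ?thesis by simp
  qed
  then have "C1_deriv U (\<lambda>p. frechet_derivative U (at p))" using d by (intro C1_derivI)
  then show "(\<exists>U'. C1_deriv U U') \<and> cc {p. U p \<noteq> 0} A" using * by (auto simp: C1c_def)
next
  assume "(\<exists>U'. C1_deriv U U') \<and> cc {p. U p \<noteq> 0} A"
  then obtain U' where U: "C1_deriv U U'" and "cc {p. U p \<noteq> 0} A" by auto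
  then show "C1c A U" unfolding C1c_def using C1_deriv_D[OF U] by simp
qed

lemma ediv_C1_deriv: "C1_deriv U U' \<Longrightarrow> ediv U p = (\<Sum>b\<in>Basis. U' p b \<bullet> b)"
  by (simp add: ediv_def C1_deriv_D)

lemma continuous_on_ediv: "C1_deriv U U' \<Longrightarrow> continuous_on UNIV (ediv U)"
  by (simp add: ediv_C1_deriv continuous_on_sum continuous_on_inner C1_deriv_D cong: continuous_on_cong)

lemma C1_deriv_compose:
  assumes f: "C1_deriv f f'" and g: "C1_deriv g g'"
  shows "C1_deriv (\<lambda>p. f (g p)) (\<lambda>p h. f' (g p) (g' p h))"
proof (rule C1_derivI)
  show "((\<lambda>p. f (g p)) has_derivative (\<lambda>h. f' (g p) (g' p h))) (at p)" for p
    using has_derivative_compose[OF C1_deriv_D(1)[OF g] C1_deriv_D(1)[OF f]] by simp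
  fix h
  \<comment> \<open>\<open>C1_deriv\<close> gives continuity of \<open>f' p h\<close> in p for fixed
    h only, whereas here the direction moves with p; expanding it in the basis separates the two
    dependences.\<close>
  have "f' (g p) (g' p h) = (\<Sum>b\<in>Basis. (g' p h \<bullet> b) *\<^sub>R f' (g p) b)" for p
  proof -
    interpret linear "f' (g p)" by (rule C1_deriv_D(4)[OF f])
    have "f' (g p) (g' p h) = f' (g p) (\<Sum>b\<in>Basis. (g' p h \<bullet> b) *\<^sub>R b)"
      by (simp add: euclidean_representation)
    then show ?thesis by (simp add: sum scale)
  qed
  moreover have "continuous_on UNIV (\<lambda>p. f' (g p) b)" for b
    by (rule continuous_on_compose2[OF C1_deriv_D(2)[OF f] C1_deriv_D(5)[OF g]]) simp
  then have "continuous_on UNIV (\<lambda>p. \<Sum>b\<in>Basis. (g' p h \<bullet> b) *\<^sub>R f' (g p) b)"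
    by (intro continuous_intros C1_deriv_D(2)[OF g])
  ultimately show "continuous_on UNIV (\<lambda>p. f' (g p) (g' p h))" by simp
qed

lemma C1_deriv_linear: "bounded_linear f \<Longrightarrow> C1_deriv f (\<lambda>p h. f h)"
  by (intro C1_derivI bounded_linear_imp_has_derivative) auto

lemma C1_deriv_const: "C1_deriv (\<lambda>p. c) (\<lambda>p h. 0)"
  by (intro C1_derivI) auto

lemma C1_deriv_add:
  "C1_deriv f f' \<Longrightarrow> C1_deriv g g' \<Longrightarrow> C1_deriv (\<lambda>p. f p + g p) (\<lambda>p h. f' p h + g' p h)"
  by (auto simp: C1_deriv_def intro!: has_derivative_add continuous_on_add)

lemma C1_deriv_diff:
  "C1_deriv f f' \<Longrightarrow> C1_deriv g g' \<Longrightarrow> C1_deriv (\<lambda>p. f p - g p) (\<lambda>p h. f' p h - g' p h)"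
  by (auto simp: C1_deriv_def intro!: has_derivative_diff continuous_on_diff)

lemma C1_deriv_sum:
  "(\<And>i. i \<in> I \<Longrightarrow> C1_deriv (f i) (f' i)) \<Longrightarrow>
    C1_deriv (\<lambda>p. \<Sum>i\<in>I. f i p) (\<lambda>p h. \<Sum>i\<in>I. f' i p h)"
  by (auto simp: C1_deriv_def intro!: has_derivative_sum continuous_on_sum)

lemma C1_deriv_Pair:
  "C1_deriv f f' \<Longrightarrow> C1_deriv g g' \<Longrightarrow> C1_deriv (\<lambda>p. (f p, g p)) (\<lambda>p h. (f' p h, g' p h))"
  by (auto simp: C1_deriv_def intro!: has_derivative_Pair continuous_on_Pair)

lemma C1_deriv_scaleR:
  assumes f: "C1_deriv f f'" and g: "C1_deriv g g'"
  shows "C1_deriv (\<lambda>p. f p *\<^sub>R g p) (\<lambda>p h. f p *\<^sub>R g' p h + f' p h *\<^sub>R g p)"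
  by (intro C1_derivI has_derivative_scaleR continuous_intros C1_deriv_D[OF f] C1_deriv_D[OF g])

lemma C1_deriv_inner:
  assumes f: "C1_deriv f f'" and g: "C1_deriv g g'"
  shows "C1_deriv (\<lambda>p. f p \<bullet> g p) (\<lambda>p h. f p \<bullet> g' p h + f' p h \<bullet> g p)"
  by (intro C1_derivI has_derivative_inner continuous_intros C1_deriv_D[OF f] C1_deriv_D[OF g])

lemma C1_deriv_real:
  assumes "\<And>s. (f has_real_derivative f' s) (at s)" "continuous_on UNIV f'"
  shows "C1_deriv f (\<lambda>s h. f' s * h)"
  by (intro C1_derivI continuous_intros assms) (use assms in \<open>simp add: has_field_derivative_def\<close>)

section \<open>Rules for the divergence\<close>

lemma ediv_add:
  assumes "C1_deriv f f'" "C1_deriv g g'"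
  shows "ediv (\<lambda>p. f p + g p) p = ediv f p + ediv g p"
  by (simp add: ediv_C1_deriv[OF C1_deriv_add[OF assms]] ediv_C1_deriv[OF assms(1)]
      ediv_C1_deriv[OF assms(2)] inner_add_left sum.distrib)

lemma ediv_diff:
  assumes "C1_deriv f f'" "C1_deriv g g'"
  shows "ediv (\<lambda>p. f p - g p) p = ediv f p - ediv g p"
  by (simp add: ediv_C1_deriv[OF C1_deriv_diff[OF assms]] ediv_C1_deriv[OF assms(1)]
      ediv_C1_deriv[OF assms(2)] inner_diff_left sum_subtractf)

lemma ediv_scaleR_fun:
  assumes "C1_deriv f f'" "C1_deriv g g'"
  shows "ediv (\<lambda>p. f p *\<^sub>R g p) p = f p * ediv g p + f' p (g p)"
proof -
  interpret linear "f' p" by (rule C1_deriv_D(4)[OF assms(1)])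
  have "f' p (g p) = f' p (\<Sum>b\<in>Basis. (g p \<bullet> b) *\<^sub>R b)"
    by (simp add: euclidean_representation)
  also have "\<dots> = (\<Sum>b\<in>Basis. (g p \<bullet> b) * f' p b)"
    by (simp add: sum scale)
  finally show ?thesis
    by (simp add: ediv_C1_deriv[OF C1_deriv_scaleR[OF assms]] ediv_C1_deriv[OF assms(2)]
        inner_add_left sum.distrib sum_distrib_left mult.commute)
qed

lemma ediv_scaleR:
  assumes "C1_deriv g g'" shows "ediv (\<lambda>p. c *\<^sub>R g p) p = c * ediv g p"
  using ediv_scaleR_fun[OF C1_deriv_const[of c] assms] by simp

lemma C1_deriv_eq_0:
  assumes "C1_deriv f f'" "open S" "p \<in> S" "\<And>q. q \<in> S \<Longrightarrow> f q = 0"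
  shows "f' p = (\<lambda>h. 0)"
proof -
  have "(f has_derivative (\<lambda>h. 0)) (at p)"
    by (rule has_derivative_transform_within_open[OF has_derivative_const assms(2,3)]) (simp add: assms(4))
  then show ?thesis using C1_deriv_D(1)[OF assms(1)] has_derivative_unique by blast
qed

lemma C1_deriv_support:
  assumes "C1_deriv f f'" "p \<notin> closure {p. f p \<noteq> 0}"
  shows "f p = 0" "f' p h = 0"
proof -
  show "f p = 0" using assms(2) closure_subset[of "{p. f p \<noteq> 0}"] by blast
  have z: "f q = 0" if "q \<in> - closure {p. f p \<noteq> 0}" for q
    using that closure_subset[of "{p. f p \<noteq> 0}"] by blast
  have "f' p = (\<lambda>h. 0)"
  proof (rule C1_deriv_eq_0[OF assms(1)])
    show "open (- closure {p. f p \<noteq> 0})" by (intro open_Compl closed_closure)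
    show "p \<in> - closure {p. f p \<noteq> 0}" using assms(2) by simp
  qed (rule z)
  then show "f' p h = 0" by simp
qed

lemma ediv_support:
  assumes "C1_deriv f f'" "p \<notin> closure {p. f p \<noteq> 0}"
  shows "ediv f p = 0"
  by (simp add: ediv_C1_deriv[OF assms(1)] C1_deriv_support[OF assms])

section \<open>Cutoff functions\<close>

text \<open>Squaring makes the positive part continuously differentiable. Test fields have one
  continuous derivative, so all cutoffs and mollifiers are built from this function.\<close>

definition possq :: "real \<Rightarrow> real" where "possq s = (max 0 s)\<^sup>2"

lemma possq_deriv: "(possq has_real_derivative 2 * max 0 s) (at s)"
proof -
  consider "s < 0" | "s > 0" | "s = 0" by linarith
  then show ?thesis
  proof cases
    case 1
    have "(possq has_real_derivative 0) (at s)"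
      by (rule has_field_derivative_transform_within_open[of "\<lambda>_. 0" _ _ "{..<0}"])
        (use 1 in \<open>auto simp: possq_def\<close>)
    then show ?thesis using 1 by simp
  next
    case 2
    have "(possq has_real_derivative 2 * s) (at s)"
      by (rule has_field_derivative_transform_within_open[of "\<lambda>x. x\<^sup>2" _ _ "{0<..}"])
         (use 2 in \<open>auto simp: possq_def intro!: derivative_eq_intros\<close>)
    then show ?thesis using 2 by simp
  next
    case 3
    have "((\<lambda>h. possq h / h) \<longlongrightarrow> 0) (at 0)"
    proof (rule Lim_null_comparison)
      show "\<forall>\<^sub>F h in at 0. norm (possq h / h) \<le> \<bar>h\<bar>"
        by (rule always_eventually) (auto simp: possq_def max_def power2_eq_square)
      show "((\<lambda>h::real. \<bar>h\<bar>) \<longlongrightarrow> 0) (at 0)" by (auto intro!: tendsto_eq_intros)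
    qed
    then show ?thesis using 3 by (simp add: DERIV_def possq_def)
  qed
qed

lemma possq_C1: "C1_deriv possq (\<lambda>s h. 2 * max 0 s * h)"
  by (rule C1_deriv_real[OF possq_deriv]) (intro continuous_intros)

text \<open>On [0,1] this is \<open>1 - (1 - s^2)^2\<close>, with derivative
  \<open>4 * s * (1 - s^2)\<close>. The derivative vanishes at both ends, so the constants 0 and 1
  attach in a C1 way.\<close>

definition smoothstep :: "real \<Rightarrow> real" where "smoothstep s = 1 - possq (1 - possq s)"
definition smoothstep' :: "real \<Rightarrow> real" where "smoothstep' s = 4 * max 0 (1 - possq s) * max 0 s"

lemma smoothstep_deriv: "(smoothstep has_real_derivative smoothstep' s) (at s)"
proof -
  have "((\<lambda>s. 1 - possq (1 - possq s)) has_real_derivative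
      0 - 2 * max 0 (1 - possq s) * (0 - 2 * max 0 s)) (at s)"
    by (intro DERIV_diff DERIV_const DERIV_chain2[OF possq_deriv] possq_deriv)
  then show ?thesis by (simp add: smoothstep_def[abs_def] smoothstep'_def algebra_simps)
qed

lemma continuous_possq: "continuous_on S possq"
  unfolding possq_def by (intro continuous_intros)

lemma smoothstep_C1: "C1_deriv smoothstep (\<lambda>s h. smoothstep' s * h)"
proof (rule C1_deriv_real[OF smoothstep_deriv])
  show "continuous_on UNIV smoothstep'"
    unfolding smoothstep'_def by (intro continuous_intros continuous_possq)
qed

lemma smoothstep_bounds: "0 \<le> smoothstep s" "smoothstep s \<le> 1"
proof -
  have "possq s \<ge> 0" by (simp add: possq_def)
  then have "(max 0 (1 - possq s))\<^sup>2 \<le> 1" by (intro power_le_one) auto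
  then show "0 \<le> smoothstep s" "smoothstep s \<le> 1"
    by (simp_all add: smoothstep_def possq_def[of "1 - possq s"])
qed

lemma smoothstep_0: "s \<le> 0 \<Longrightarrow> smoothstep s = 0"
  by (simp add: smoothstep_def possq_def)

lemma smoothstep_1:
  assumes "s \<ge> 1" shows "smoothstep s = 1" "smoothstep' s = 0"
proof -
  have "possq s \<ge> 1" using assms by (simp add: possq_def)
  then show "smoothstep s = 1" "smoothstep' s = 0"
    by (auto simp: smoothstep_def smoothstep'_def possq_def[of "1 - possq s"])
qed

lemma smoothstep'_0: "s \<le> 0 \<Longrightarrow> smoothstep' s = 0"
  by (simp add: smoothstep'_def)

lemma smoothstep'_bound: "\<bar>smoothstep' s\<bar> \<le> 4"
proof -
  consider "s \<le> 0" | "s \<ge> 1" | "0 < s" "s < 1" by linarith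
  then show ?thesis
  proof cases
    case 3
    have "0 \<le> possq s" by (simp add: possq_def)
    then have "max 0 (1 - possq s) * max 0 s \<le> 1 * 1"
      by (intro mult_mono) (use 3 in auto)
    moreover have "max 0 (1 - possq s) * max 0 s \<ge> 0" by simp
    ultimately show ?thesis unfolding smoothstep'_def by linarith
  qed (auto simp: smoothstep'_0 smoothstep_1)
qed

text \<open>Finitely many balls whose closures lie in A cover K, and the sum of their bumps is
  positive on K. Dividing by its minimum over K makes the argument of \<open>smoothstep\<close> at
  least 1 there, where it saturates. The support stays in the compact union of the closed
  balls.\<close>

lemma cutoff_exists:
  fixes K A :: "'a::euclidean_space set"
  assumes K: "compact K" and A: "open A" and "K \<subseteq> A"
  obtains \<theta> :: "'a \<Rightarrow> real" where "C1c A \<theta>" "\<And>p. 0 \<le> \<theta> p" "\<And>p. \<theta> p \<le> 1" "\<And>p. p \<in> K \<Longrightarrow> \<theta> p = 1"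
proof (cases "K = {}")
  case True
  show ?thesis
    by (rule that[of "\<lambda>p. 0"]) (use True C1_deriv_const[of 0] in \<open>auto simp: C1c_iff cc_def\<close>)
next
  case False
  have "\<forall>p\<in>K. \<exists>r>0. cball p r \<subseteq> A"
    using assms open_contains_cball by (meson subsetD)
  then obtain r where r: "\<And>p. p \<in> K \<Longrightarrow> r p > 0 \<and> cball p (r p) \<subseteq> A" by metis
  have "K \<subseteq> (\<Union>p\<in>K. ball p (r p))" using r centre_in_ball by blast
  then obtain I where I: "I \<subseteq> K" "finite I" "K \<subseteq> (\<Union>p\<in>I. ball p (r p))"
    by (rule compactE_image[OF K open_ball])
  define \<beta> where "\<beta> q = (\<Sum>p\<in>I. possq ((r p)\<^sup>2 - (q - p) \<bullet> (q - p)))" for q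
  have "\<exists>f'. C1_deriv (\<lambda>q. possq ((r p)\<^sup>2 - (q - p) \<bullet> (q - p))) f'" for p
    using C1_deriv_compose[OF possq_C1 C1_deriv_diff[OF C1_deriv_const C1_deriv_inner[OF
          C1_deriv_diff[OF C1_deriv_linear[OF bounded_linear_ident] C1_deriv_const]
          C1_deriv_diff[OF C1_deriv_linear[OF bounded_linear_ident] C1_deriv_const]]]]
    by blast
  then obtain f' where "\<And>p. C1_deriv (\<lambda>q. possq ((r p)\<^sup>2 - (q - p) \<bullet> (q - p))) (f' p)" by metis
  then have \<beta>C: "C1_deriv \<beta> (\<lambda>q h. \<Sum>p\<in>I. f' p q h)"
    unfolding \<beta>_def by (rule C1_deriv_sum)
  have nn: "possq s \<ge> 0" for s by (simp add: possq_def)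
  have pos: "\<beta> q > 0" if "q \<in> K" for q
  proof -
    have "q \<in> (\<Union>p\<in>I. ball p (r p))" using I(3) that by (rule subsetD)
    then obtain p where p: "p \<in> I" "dist p q < r p" by auto
    have "(q - p) \<bullet> (q - p) = (dist p q)\<^sup>2" by (simp add: dist_norm norm_minus_commute dot_square_norm)
    also have "\<dots> < (r p)\<^sup>2" using p by (simp add: power_strict_mono)
    finally have "possq ((r p)\<^sup>2 - (q - p) \<bullet> (q - p)) > 0" by (simp add: possq_def)
    then show ?thesis unfolding \<beta>_def using p I nn by (intro sum_pos2[of _ p]) auto
  qed
  obtain q0 where q0: "q0 \<in> K" "\<And>q. q \<in> K \<Longrightarrow> \<beta> q0 \<le> \<beta> q"
    using continuous_attains_inf[OF K False continuous_on_subset[OF C1_deriv_D(5)[OF \<beta>C] subset_UNIV]] by auto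
  define \<theta> where "\<theta> q = smoothstep (\<beta> q * inverse (\<beta> q0))" for q
  have "bounded_linear (\<lambda>s. s * inverse (\<beta> q0))" by (rule bounded_linear_mult_left)
  from C1_deriv_compose[OF smoothstep_C1 C1_deriv_compose[OF C1_deriv_linear[OF this] \<beta>C]]
  have C: "\<exists>f'. C1_deriv \<theta> f'" unfolding \<theta>_def by blast
  have supp: "{q. \<theta> q \<noteq> 0} \<subseteq> (\<Union>p\<in>I. cball p (r p))"
  proof
    fix q assume "q \<in> {q. \<theta> q \<noteq> 0}"
    then have "\<theta> q \<noteq> 0" by simp
    then have "\<beta> q \<noteq> 0" by (auto simp: \<theta>_def smoothstep_0)
    then obtain p where p: "p \<in> I" "possq ((r p)\<^sup>2 - (q - p) \<bullet> (q - p)) \<noteq> 0"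
      unfolding \<beta>_def by (rule sum.not_neutral_contains_not_neutral)
    then have "(q - p) \<bullet> (q - p) < (r p)\<^sup>2" by (auto simp: possq_def max_def split: if_splits)
    then have "(dist p q)\<^sup>2 < (r p)\<^sup>2" by (simp add: dist_norm norm_minus_commute dot_square_norm)
    then have "dist p q < r p" 
      by (rule power_less_imp_less_base) (meson I(1) less_imp_le p(1) r subsetD)
    then show "q \<in> (\<Union>p\<in>I. cball p (r p))" using p by (auto intro: less_imp_le)
  qed
  have comp: "compact (\<Union>p\<in>I. cball p (r p))" using I by (intro compact_UN) auto
  then have cl: "closure {q. \<theta> q \<noteq> 0} \<subseteq> (\<Union>p\<in>I. cball p (r p))"
    using supp by (simp add: closure_minimal compact_imp_closed)
  have "compact (closure {q. \<theta> q \<noteq> 0})"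
    unfolding compact_closure by (rule bounded_subset[OF compact_imp_bounded[OF comp] supp])
  moreover have "(\<Union>p\<in>I. cball p (r p)) \<subseteq> A" using r I by blast
  ultimately have "C1c A \<theta>" unfolding C1c_iff cc_def using C cl by blast
  then show ?thesis
  proof (rule that)
    show "\<theta> p = 1" if "p \<in> K" for p
      unfolding \<theta>_def
      using q0(2)[OF that] pos[OF q0(1)] by (intro smoothstep_1(1)) (simp add: field_simps)
  qed (simp_all add: \<theta>_def smoothstep_bounds)
qed

section \<open>Compactly supported integrands\<close>

lemma C1_deriv_outside:
  assumes "C1_deriv f f'" "closed S" "{x. f x \<noteq> 0} \<subseteq> S" "p \<notin> S"
  shows "f p = 0" "f' p h = 0"
proof -
  have "p \<notin> closure {x. f x \<noteq> 0}" using closure_minimal[OF assms(3,2)] assms(4) by blast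
  then show "f p = 0" "f' p h = 0" by (rule C1_deriv_support[OF assms(1)])+
qed

lemma integrable_bounded_support:
  fixes f :: "'a::euclidean_space \<Rightarrow> 'b::euclidean_space"
  assumes f: "f \<in> borel_measurable lebesgue" and S: "bounded S"
    and z: "\<And>x. x \<notin> S \<Longrightarrow> f x = 0" and C: "\<And>x. norm (f x) \<le> C"
  shows "integrable lebesgue f"
proof -
  obtain R where R: "S \<subseteq> cball 0 R" using bounded_subset_ballD[OF S, of 0] ball_subset_cball subset_trans by metis
  have "integrable lebesgue (\<lambda>x. C * indicator (cball (0::'a) R) x)"
    using emeasure_bounded_finite[OF bounded_cball, of "0::'a" R]
    by (intro integrable_mult_right integrable_real_indicator) auto
  then show ?thesis
    by (rule Bochner_Integration.integrable_bound[OF _ f])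
       (use z[of _] subsetD[OF R] in \<open>force simp: indicator_def intro!: AE_I2 order_trans[OF C abs_ge_self]\<close>)
qed

lemma bounded_range_compact_support:
  fixes f :: "'a::euclidean_space \<Rightarrow> 'b::euclidean_space"
  assumes f: "continuous_on UNIV f" and S: "bounded S" and z: "\<And>x. x \<notin> S \<Longrightarrow> f x = 0"
  obtains C where "C \<ge> 0" "\<And>x. norm (f x) \<le> C"
proof -
  have "bounded (f ` closure S)"
    using f S by (intro compact_imp_bounded compact_continuous_image)
      (auto intro: continuous_on_subset)
  then obtain C where C: "\<And>x. x \<in> closure S \<Longrightarrow> norm (f x) \<le> C" by (auto simp: bounded_iff)
  have "norm (f x) \<le> max 0 C" for x
  proof (cases "x \<in> S")
    case True
    then have "x \<in> closure S" using closure_subset by blast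
    then show ?thesis using C[of x] by auto
  qed (simp add: z)
  then show ?thesis using that[of "max 0 C"] by auto
qed

lemma continuous_imp_lebesgue_measurable:
  "continuous_on UNIV f \<Longrightarrow> f \<in> borel_measurable lebesgue"
  by (intro measurable_completion) (simp add: borel_measurable_continuous_onI)

lemma integrable_compact_support:
  fixes f :: "'a::euclidean_space \<Rightarrow> 'b::euclidean_space"
  assumes f: "continuous_on UNIV f" and S: "bounded S" and z: "\<And>x. x \<notin> S \<Longrightarrow> f x = 0"
  shows "integrable lebesgue f" "integrable lborel f"
proof -
  obtain C where C: "\<And>x. norm (f x) \<le> C" using bounded_range_compact_support[OF assms] by blast
  show i: "integrable lebesgue f"
    by (rule integrable_bounded_support[OF continuous_imp_lebesgue_measurable[OF f] S z C])
  have "f \<in> borel_measurable lborel" using f by (simp add: borel_measurable_continuous_onI)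
  then show "integrable lborel f" using i integrable_completion by blast
qed

lemma uniformly_continuous_compact_support:
  fixes f :: "'a::euclidean_space \<Rightarrow> 'b::real_normed_vector"
  assumes f: "continuous_on UNIV f" and S: "bounded S" and z: "\<And>x. x \<notin> S \<Longrightarrow> f x = 0"
    and "e > 0"
  shows "\<exists>d>0. \<forall>x y. dist x y < d \<longrightarrow> dist (f x) (f y) < e"
proof -
  obtain R where R: "S \<subseteq> cball 0 R" using bounded_subset_ballD[OF S, of 0] ball_subset_cball subset_trans by metis
  have "uniformly_continuous_on (cball 0 (R + 1)) f"
    by (intro compact_uniformly_continuous continuous_on_subset[OF f]) auto
  then obtain d where d: "d > 0"
    "\<And>x y. x \<in> cball 0 (R + 1) \<Longrightarrow> y \<in> cball 0 (R + 1) \<Longrightarrow> dist y x < d \<Longrightarrow> dist (f y) (f x) < e"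
    unfolding uniformly_continuous_on_def using \<open>e > 0\<close> by metis
  \<comment> \<open>The bound 1 on the distance forces both points into the enlarged ball as soon as
    one lies in \<open>cball 0 R\<close>; otherwise both values are 0.\<close>
  have "dist (f x) (f y) < e" if xy: "dist x y < min d 1" for x y
  proof (cases "x \<in> cball 0 R \<or> y \<in> cball 0 R")
    case True
    have "norm x \<le> norm y + dist x y" "norm y \<le> norm x + dist x y"
      by (simp_all add: dist_norm norm_triangle_sub) (metis norm_minus_commute norm_triangle_sub)
    then have "x \<in> cball 0 (R + 1)" "y \<in> cball 0 (R + 1)" using True xy by auto
    then show ?thesis using d(2)[of y x] xy by auto
  next
    case False
    then have "x \<notin> S" "y \<notin> S" using R by auto
    then have "f x = 0" "f y = 0" by (auto intro: z)
    then show ?thesis using \<open>e > 0\<close> by simp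
  qed
  then show ?thesis using d(1) by (intro exI[of _ "min d 1"]) auto
qed

text \<open>Uniform continuity is first known for each direction separately. A tolerance
  \<open>e / N\<close> per basis vector, with N the dimension, controls the whole linear
  map.\<close>

lemma C1_uniformly_continuous_deriv:
  assumes f: "C1_deriv f f'" and S: "bounded {x. f x \<noteq> 0}" and "e > 0"
  shows "\<exists>d>0. \<forall>x y h. dist x y < d \<longrightarrow> norm (f' x h - f' y h) \<le> e * norm h"
proof -
  define N where "N = real DIM('a)"
  have N: "N > 0" by (simp add: N_def)
  have bc: "bounded (closure {x. f x \<noteq> 0})" by (rule bounded_closure[OF S])
  have "\<exists>d>0. \<forall>x y. dist x y < d \<longrightarrow> dist (f' x b) (f' y b) < e / N" for b
    by (rule uniformly_continuous_compact_support[OF C1_deriv_D(2)[OF f] bc])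
       (simp_all add: C1_deriv_support(2)[OF f] \<open>e > 0\<close> N)
  then obtain d where d: "\<And>b. d b > 0"
    "\<And>b x y. dist x y < d b \<Longrightarrow> dist (f' x b) (f' y b) < e / N" by metis
  define \<delta> where "\<delta> = Min (d ` Basis)"
  have \<delta>: "\<delta> > 0" "\<And>b. b \<in> Basis \<Longrightarrow> \<delta> \<le> d b" unfolding \<delta>_def using d(1) by auto
  have "norm (f' x h - f' y h) \<le> e * norm h" if xy: "dist x y < \<delta>" for x y h
  proof -
    interpret l: linear "\<lambda>h. f' x h - f' y h"
      using C1_deriv_D(4)[OF f] by (intro linear_compose_sub) auto
    have "f' x h - f' y h = (\<Sum>b\<in>Basis. (h \<bullet> b) *\<^sub>R (f' x b - f' y b))"
      using l.sum[of "\<lambda>b. (h \<bullet> b) *\<^sub>R b" Basis] by (simp add: l.scale euclidean_representation)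
    also have "norm \<dots> \<le> (\<Sum>b\<in>(Basis::'a set). norm h * (e / N))"
    proof (intro sum_norm_le)
      fix b :: 'a assume b: "b \<in> Basis"
      have "norm (f' x b - f' y b) \<le> e / N" using d(2)[of x y b] xy \<delta>(2)[OF b] by (auto simp: dist_norm)
      then show "norm ((h \<bullet> b) *\<^sub>R (f' x b - f' y b)) \<le> norm h * (e / N)"
        unfolding norm_scaleR using b by (intro mult_mono) (auto simp: Basis_le_norm)
    qed
    also have "\<dots> = e * norm h" using N by (simp add: N_def)
    finally show ?thesis .
  qed
  then show ?thesis using \<delta>(1) by blast
qed

text \<open>The mean value inequality for f minus its linearization at z, with d independent of z.
  This uniformity lets derivatives pass under integrals below by a direct estimate.\<close>

lemma C1_uniformly_differentiable:
  assumes f: "C1_deriv f f'" and S: "bounded {x. f x \<noteq> 0}" and "e > 0"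
  shows "\<exists>d>0. \<forall>z h. norm h < d \<longrightarrow> norm (f (z + h) - f z - f' z h) \<le> e * norm h"
proof -
  obtain d where d: "d > 0" "\<And>x y h. dist x y < d \<Longrightarrow> norm (f' x h - f' y h) \<le> e * norm h"
    using C1_uniformly_continuous_deriv[OF assms] by blast
  have "norm (f (z + h) - f z - f' z h) \<le> e * norm h" if h: "norm h < d" for z h
  proof -
    have "norm (f (z + h) - f z - f' z (z + h - z)) \<le> norm (z + h - z) * e"
    proof (rule differentiable_bound_linearization[where S="ball z d" and f'="f'"])
      show "z + t *\<^sub>R (z + h - z) \<in> ball z d" if "t \<in> {0..1}" for t
      proof -
        have "\<bar>t\<bar> * norm h \<le> 1 * norm h" using that by (intro mult_right_mono) auto
        then show ?thesis using h by (simp add: dist_norm)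
      qed
      show "(f has_derivative f' x) (at x within ball z d)" for x
        using C1_deriv_D(1)[OF f] has_derivative_at_withinI by blast
      show "onorm (f' x - f' z) \<le> e" if "x \<in> ball z d" for x
        using d(2)[of x z] that by (intro onorm_le) (auto simp: dist_commute fun_diff_def)
      show "z \<in> ball z d" using d(1) by simp
    qed
    then show ?thesis by (simp add: mult.commute)
  qed
  then show ?thesis using d(1) by blast
qed

section \<open>Translation invariance and the divergence theorem for compact support\<close>

lemma integral_lborel_translation:
  fixes f :: "'a::euclidean_space \<Rightarrow> 'b::{banach,second_countable_topology}"
  assumes [measurable]: "f \<in> borel_measurable borel"
  shows "(\<integral>x. f (x + a) \<partial>lborel) = (\<integral>x. f x \<partial>lborel)"
proof -
  have "(\<integral>x. f x \<partial>lborel) = (\<integral>x. f x \<partial>distr lborel borel ((+) a))"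
    by (simp only: lborel_distr_plus)
  also have "\<dots> = (\<integral>x. f (a + x) \<partial>lborel)" by (subst integral_distr) auto
  finally show ?thesis by (simp add: add.commute)
qed

lemma integrable_lborel_translation:
  fixes f :: "'a::euclidean_space \<Rightarrow> 'b::{banach,second_countable_topology}"
  assumes f: "integrable lborel f"
  shows "integrable lborel (\<lambda>x. f (x + a))"
proof -
  have [measurable]: "f \<in> borel_measurable borel" using f borel_measurable_integrable by fastforce
  have "integrable (distr lborel borel ((+) a)) f" using f by (simp only: lborel_distr_plus)
  then have "integrable lborel (\<lambda>x. f (a + x))" by (subst (asm) integrable_distr_eq) auto
  then show ?thesis by (simp add: add.commute)
qed

lemma integral_lebesgue_lborel:
  fixes f :: "'a::euclidean_space \<Rightarrow> 'b::{banach,second_countable_topology}"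
  shows "f \<in> borel_measurable borel \<Longrightarrow> integral\<^sup>L lebesgue f = integral\<^sup>L lborel f"
  by (rule integral_completion) simp

text \<open>By translation invariance \<open>f (p + t *\<^sub>R h) - f p\<close> has integral 0, so
  the integral of \<open>t * f' p h\<close> is, up to sign, that of the Taylor remainder, which is
  at most \<open>e * t\<close> times a constant. Dividing by t leaves an arbitrarily small
  bound.\<close>

lemma integral_directional_derivative_zero:
  fixes f :: "'a::euclidean_space \<Rightarrow> real"
  assumes f: "C1_deriv f f'" and S: "bounded {x. f x \<noteq> 0}"
  shows "(\<integral>p. f' p h \<partial>lebesgue) = 0"
proof -
  have bm: "f \<in> borel_measurable borel" "(\<lambda>p. f' p h) \<in> borel_measurable borel"
    using C1_deriv_D(2,5)[OF f] by (simp_all add: borel_measurable_continuous_onI)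
  obtain R where R: "{x. f x \<noteq> 0} \<subseteq> cball 0 R" using bounded_subset_ballD[OF S, of 0] ball_subset_cball subset_trans by metis
  define B where "B = cball (0::'a) (R + norm h)"
  define M where "M = measure lborel B"
  have f0: "f x = 0" "f' x h = 0" if "norm x > R" for x
    by (rule C1_deriv_outside[OF f closed_cball R], use that in simp)+
  have iB: "integrable lborel (indicator B :: 'a \<Rightarrow> real)"
    unfolding B_def using emeasure_bounded_finite[OF bounded_cball, of "0::'a" "R + norm h"]
    by (intro integrable_real_indicator) auto
  have if0: "integrable lborel f"
    by (rule integrable_compact_support(2)[OF C1_deriv_D(5)[OF f] S]) simp
  have if': "integrable lborel (\<lambda>p. f' p h)"
    by (rule integrable_compact_support(2)[OF C1_deriv_D(2)[OF f], of "cball 0 R"]) (auto simp: f0)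
  have bound: "\<bar>\<integral>p. f' p h \<partial>lborel\<bar> \<le> e * (norm h * M)" if "e > 0" for e
  proof -
    obtain d where d: "d > 0" "\<And>z k. norm k < d \<Longrightarrow> norm (f (z + k) - f z - f' z k) \<le> e * norm k"
      using C1_uniformly_differentiable[OF f S \<open>e > 0\<close>] by blast
    \<comment> \<open>\<open>t \<le> 1\<close> keeps the integrand supported in B, the ball enlarged
      by \<open>norm h\<close>; the other bound makes \<open>t *\<^sub>R h\<close> short enough for
      the remainder estimate.\<close>
    define t where "t = min 1 (d / (2 * (norm h + 1)))"
    have t: "t > 0" "t \<le> 1" using d(1) by (auto simp: t_def add_nonneg_pos)
    have "t * norm h \<le> d / (2 * (norm h + 1)) * norm h" unfolding t_def by (intro mult_right_mono) auto
    also have "\<dots> < d" using d(1) by (simp add: divide_simps add_nonneg_pos)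
    finally have td: "norm (t *\<^sub>R h) < d" using t by simp
    have pt: "norm (f (p + t *\<^sub>R h) - f p - t * f' p h) \<le> e * (t * norm h) * indicator B p" for p
    proof (cases "p \<in> B")
      case True
      have "f' p (t *\<^sub>R h) = t * f' p h" using linear_cmul[OF C1_deriv_D(4)[OF f, of p], of t h] by simp
      then show ?thesis using d(2)[OF td, of p] True t by simp
    next
      case False
      then have "norm p > R + norm h" by (simp add: B_def)
      moreover have "norm p \<le> norm (p + t *\<^sub>R h) + norm (t *\<^sub>R h)"
        by (metis add_diff_cancel_right' norm_triangle_ineq4)
      moreover have "norm (t *\<^sub>R h) \<le> 1 * norm h" using t by (simp only: norm_scaleR) (intro mult_right_mono, auto)
      moreover have "norm h \<ge> 0" by simp
      ultimately have "norm p > R" "norm (p + t *\<^sub>R h) > R" by linarith+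
      then show ?thesis using False f0 by simp
    qed
    have "\<bar>\<integral>p. f (p + t *\<^sub>R h) - f p - t * f' p h \<partial>lborel\<bar> \<le> (\<integral>p. e * (t * norm h) * indicator B p \<partial>lborel)"
      by (rule order_trans[OF integral_abs_bound], rule integral_mono)
         (use pt in \<open>auto intro!: Bochner_Integration.integrable_diff integrable_abs integrable_mult_right iB if' if0 integrable_lborel_translation\<close>)
    also have "\<dots> = e * (t * norm h) * M" by (simp add: M_def B_def)
    also have "(\<integral>p. f (p + t *\<^sub>R h) - f p - t * f' p h \<partial>lborel) = - t * (\<integral>p. f' p h \<partial>lborel)"
      using if0 if' integrable_lborel_translation[OF if0, of "t *\<^sub>R h"] integral_lborel_translation[OF bm(1), of "t *\<^sub>R h"]
      by simp
    finally show ?thesis using t by (simp add: abs_mult mult.assoc mult.left_commute)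
  qed
  have "\<bar>\<integral>p. f' p h \<partial>lborel\<bar> \<le> 0"
  proof (rule field_le_epsilon)
    fix e :: real assume e: "e > 0"
    have hM: "norm h * M \<ge> 0" by (simp add: M_def)
    have "\<bar>\<integral>p. f' p h \<partial>lborel\<bar> \<le> e / (norm h * M + 1) * (norm h * M)"
      by (rule bound) (use e hM in auto)
    also have "\<dots> \<le> e / (norm h * M + 1) * (norm h * M + 1)" using e hM by (intro mult_left_mono) auto
    also have "\<dots> = e" using hM by simp
    finally show "\<bar>\<integral>p. f' p h \<partial>lborel\<bar> \<le> 0 + e" by simp
  qed
  then show ?thesis using bm(2) by (simp add: integral_lebesgue_lborel)
qed

lemma integral_ediv_zero:
  assumes W: "C1_deriv W W'" and S: "bounded {x. W x \<noteq> 0}"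
  shows "(\<integral>p. ediv W p \<partial>lebesgue) = 0"
proof -
  have d: "C1_deriv (\<lambda>p. W p \<bullet> b) (\<lambda>p h. W' p h \<bullet> b)" for b
    using C1_deriv_inner[OF W C1_deriv_const[of b]] by simp
  have z: "W' p h = 0" if "p \<notin> closure {x. W x \<noteq> 0}" for p h
    using C1_deriv_support[OF W that] by simp
  have i: "integrable lebesgue (\<lambda>p. W' p b \<bullet> b)" for b
    by (rule integrable_compact_support(1)[of _ "closure {x. W x \<noteq> 0}"])
       (use S z in \<open>auto intro!: continuous_intros C1_deriv_D[OF W]\<close>)
  have "(\<integral>p. W' p b \<bullet> b \<partial>lebesgue) = 0" for b
    by (rule integral_directional_derivative_zero[OF d]) (rule bounded_subset[OF S], auto)
  then show ?thesis using i by (simp add: ediv_C1_deriv[OF W])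
qed

section \<open>Fubini for Lebesgue measurable functions\<close>

lemma null_sets_Times_UNIV:
  fixes N :: "'a::euclidean_space set"
  assumes "N \<in> null_sets lborel"
  shows "N \<times> (UNIV::'b::euclidean_space set) \<in> null_sets lborel"
proof -
  have "emeasure lborel (N \<times> (UNIV::'b set)) = emeasure lborel N * emeasure lborel (UNIV::'b set)"
    using lborel.emeasure_pair_measure_Times[of N lborel "UNIV::'b set"] assms unfolding lborel_prod by auto
  moreover have "N \<times> (UNIV::'b set) \<in> sets lborel"
    unfolding lborel_prod[symmetric] using assms by (intro pair_measureI) auto
  ultimately show ?thesis using assms by (intro null_setsI) auto
qed

text \<open>Continuity only handles Borel sets in the target. For the completed sigma-algebra
  preimages of null sets must be null as well, and here they are cylinders over null sets.\<close>

lemma fst_lebesgue_measurable: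
  "(fst :: 'a::euclidean_space \<times> 'b::euclidean_space \<Rightarrow> 'a) \<in> measurable lebesgue lebesgue"
proof (rule completion.measurable_completion2)
  show fm: "(fst :: 'a \<times> 'b \<Rightarrow> 'a) \<in> measurable lebesgue lborel"
    by (rule measurable_completion) (simp add: borel_measurable_continuous_onI continuous_on_fst)
  show "null_sets lborel \<subseteq> null_sets (distr lebesgue lborel (fst :: 'a \<times> 'b \<Rightarrow> 'a))"
  proof
    fix A :: "'a set" assume A: "A \<in> null_sets lborel"
    have "A \<times> (UNIV::'b set) \<in> null_sets lborel" by (rule null_sets_Times_UNIV[OF A])
    moreover have "fst -` A \<inter> space lebesgue = A \<times> (UNIV::'b set)" by auto
    ultimately show "A \<in> null_sets (distr lebesgue lborel (fst :: 'a \<times> 'b \<Rightarrow> 'a))"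
      using A null_sets_completionI by (auto simp: null_sets_distr_iff[OF fm])
  qed
qed

lemma lebesgue_measurable_fst:
  fixes f :: "'a::euclidean_space \<Rightarrow> 'c::topological_space"
  assumes "f \<in> borel_measurable lebesgue"
  shows "(\<lambda>p::'a \<times> 'b::euclidean_space. f (fst p)) \<in> borel_measurable lebesgue"
  by (rule measurable_compose[OF fst_lebesgue_measurable assms])

lemma lebesgue_measurable_snd:
  "(snd :: 'a::euclidean_space \<times> 'b::euclidean_space \<Rightarrow> 'b) \<in> borel_measurable lebesgue"
  by (intro continuous_imp_lebesgue_measurable continuous_intros)

lemma AE_lborel_pair:
  fixes P :: "'a::euclidean_space \<times> 'b::euclidean_space \<Rightarrow> bool"
  assumes "AE p in lborel. P p"
  shows "AE x in lborel. AE y in lborel. P (x, y)"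
  using assms unfolding lborel_prod[symmetric] by (rule lborel_pair.AE_pair)

lemma nn_integral_lebesgue_pair:
  fixes f :: "'a::euclidean_space \<times> 'b::euclidean_space \<Rightarrow> ennreal"
  assumes "f \<in> borel_measurable lebesgue"
  shows "(\<integral>\<^sup>+p. f p \<partial>lebesgue) = (\<integral>\<^sup>+x. \<integral>\<^sup>+y. f (x, y) \<partial>lborel \<partial>lborel)"
proof -
  obtain g where g: "g \<in> borel_measurable lborel" and fg: "AE p in lborel. f p = g p"
    using completion_ex_borel_measurable[OF assms] by auto
  have "(\<integral>\<^sup>+p. f p \<partial>lebesgue) = (\<integral>\<^sup>+p. g p \<partial>lborel)"
    unfolding nn_integral_completion by (rule nn_integral_cong_AE[OF fg])
  also have "\<dots> = (\<integral>\<^sup>+x. \<integral>\<^sup>+y. g (x, y) \<partial>lborel \<partial>lborel)"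
    using lborel.nn_integral_fst[of g lborel] g unfolding lborel_prod by simp
  also have "\<dots> = (\<integral>\<^sup>+x. \<integral>\<^sup>+y. f (x, y) \<partial>lborel \<partial>lborel)"
    by (intro nn_integral_cong_AE eventually_mono[OF AE_lborel_pair[OF fg]])
       (auto elim: eventually_mono)
  finally show ?thesis .
qed

text \<open>Lebesgue measure on the product is the completion of the product measure, so Fubini is
  applied to a Borel representative g. Almost every slice of f agrees almost everywhere with that of
  g, which carries the statements back to f.\<close>

lemma lebesgue_Fubini:
  fixes f :: "'a::euclidean_space \<times> 'b::euclidean_space \<Rightarrow> real"
  assumes f: "integrable lebesgue f"
  shows "AE x in lebesgue. integrable lebesgue (\<lambda>y. f (x, y))"
    and "integrable lebesgue (\<lambda>x. \<integral>y. f (x, y) \<partial>lebesgue)"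
    and "(\<integral>p. f p \<partial>lebesgue) = (\<integral>x. \<integral>y. f (x, y) \<partial>lebesgue \<partial>lebesgue)"
proof -
  obtain g where g: "g \<in> borel_measurable lborel" and fg: "AE p in lborel. f p = g p"
    using completion_ex_borel_measurable_real[OF borel_measurable_integrable[OF f]] by auto
  have fgL: "AE p in lebesgue. f p = g p" using fg by (rule AE_completion)
  have gL: "g \<in> borel_measurable lebesgue" by (rule measurable_completion[OF g])
  have ig: "integrable lborel g"
    using integrable_cong_AE[OF borel_measurable_integrable[OF f] gL fgL] f integrable_completion[OF g] by simp
  then have ig2: "integrable (lborel \<Otimes>\<^sub>M lborel) g" by (simp add: lborel_prod)
  have slice: "AE x in lborel. AE y in lborel. f (x, y) = g (x, y)" by (rule AE_lborel_pair[OF fg])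
  have gx: "(\<lambda>y. g (x, y)) \<in> borel_measurable lborel" for x using g by measurable
  have eq: "integrable lebesgue (\<lambda>y. f (x, y)) = integrable lborel (\<lambda>y. g (x, y))"
    "(\<integral>y. f (x, y) \<partial>lebesgue) = (\<integral>y. g (x, y) \<partial>lborel)"
    if ae: "AE y in lborel. f (x, y) = g (x, y)" for x
  proof -
    have m: "(\<lambda>y. g (x, y)) \<in> borel_measurable lebesgue" by (rule measurable_completion[OF gx])
    have ae': "AE y in lebesgue. g (x, y) = f (x, y)" using ae by (intro AE_completion) (auto elim: eventually_mono)
    have fm: "(\<lambda>y. f (x, y)) \<in> borel_measurable lebesgue"
      by (rule borel_measurable_AE[OF m ae'])
    show "integrable lebesgue (\<lambda>y. f (x, y)) = integrable lborel (\<lambda>y. g (x, y))"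
      using integrable_cong_AE[OF m fm ae'] integrable_completion[OF gx] by simp
    show "(\<integral>y. f (x, y) \<partial>lebesgue) = (\<integral>y. g (x, y) \<partial>lborel)"
      using integral_cong_AE[OF m fm ae'] integral_completion[OF gx] by simp
  qed
  have "AE x in lborel. integrable lborel (\<lambda>y. g (x, y))"
    by (rule lborel_pair.AE_integrable_fst'[OF ig2])
  with slice have "AE x in lborel. integrable lebesgue (\<lambda>y. f (x, y))"
    by eventually_elim (simp add: eq)
  then show "AE x in lebesgue. integrable lebesgue (\<lambda>y. f (x, y))" by (rule AE_completion)
  have sl2: "AE x in lebesgue. (\<integral>y. g (x, y) \<partial>lborel) = (\<integral>y. f (x, y) \<partial>lebesgue)"
    using slice by (intro AE_completion) (auto elim!: eventually_mono simp: eq)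
  have i1: "integrable lborel (\<lambda>x. \<integral>y. g (x, y) \<partial>lborel)"
    by (rule lborel_pair.integrable_fst'[OF ig2])
  then have i1m: "(\<lambda>x. \<integral>y. g (x, y) \<partial>lborel) \<in> borel_measurable lborel"
    by (rule borel_measurable_integrable)
  have mL: "(\<lambda>x. \<integral>y. g (x, y) \<partial>lborel) \<in> borel_measurable lebesgue"
    by (rule measurable_completion[OF i1m])
  have mf: "(\<lambda>x. \<integral>y. f (x, y) \<partial>lebesgue) \<in> borel_measurable lebesgue"
    by (rule borel_measurable_AE[OF mL sl2])
  show "integrable lebesgue (\<lambda>x. \<integral>y. f (x, y) \<partial>lebesgue)"
    using integrable_cong_AE[OF mL mf sl2] integrable_completion[OF i1m] i1 by simp
  have "(\<integral>p. f p \<partial>lebesgue) = (\<integral>p. g p \<partial>lborel)"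
    using integral_cong_AE[OF borel_measurable_integrable[OF f] gL fgL] integral_completion[OF g] by simp
  also have "\<dots> = (\<integral>x. \<integral>y. g (x, y) \<partial>lborel \<partial>lborel)"
    using lborel_pair.integral_fst'[OF ig2] by (simp add: lborel_prod)
  also have "\<dots> = (\<integral>x. \<integral>y. f (x, y) \<partial>lebesgue \<partial>lebesgue)"
    using integral_cong_AE[OF mL mf sl2] integral_completion[OF i1m] by simp
  finally show "(\<integral>p. f p \<partial>lebesgue) = (\<integral>x. \<integral>y. f (x, y) \<partial>lebesgue \<partial>lebesgue)" .
qed

section \<open>Volume between two graphs\<close>

definition below :: "real \<Rightarrow> real \<Rightarrow> real" where "below a t = (if t < a then 1 else 0)"

lemma below_borel [measurable]: "below a \<in> borel_measurable borel"
  unfolding below_def by measurable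

lemma below_diff_cases:
  "below a t - below b t = (if b \<le> a then indicator {b..<a} t else - indicator {a..<b} t)"
  by (auto simp: below_def indicator_def)

lemma integral_below_diff: "(\<integral>t. below a t - below b t \<partial>lebesgue) = a - b"
  unfolding below_diff_cases by (cases "b \<le> a") simp_all

lemma nn_integral_below_diff: "(\<integral>\<^sup>+t. ennreal \<bar>below a t - below b t\<bar> \<partial>lborel) = ennreal \<bar>a - b\<bar>"
proof -
  have "ennreal \<bar>below a t - below b t\<bar> = indicator {min a b..<max a b} t" for t
    by (auto simp: below_def indicator_def)
  then show ?thesis by (auto simp: min_def max_def)
qed

lemma measurable_below:
  assumes "a \<in> borel_measurable lebesgue"
  shows "(\<lambda>p::'a::euclidean_space \<times> real. below (a (fst p)) (snd p)) \<in> borel_measurable lebesgue"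
proof -
  note [measurable] = lebesgue_measurable_fst[OF assms, where 'b=real] lebesgue_measurable_snd[where 'a='a and 'b=real]
  show ?thesis unfolding below_def by measurable
qed

text \<open>A single subgraph has infinite volume, so differences are integrated. Tonelli is applied
  to the absolute value first, because integrability of f is a conclusion: what is assumed
  integrable is \<open>h z * (a z - b z)\<close>, not a and b separately.\<close>

lemma between_graphs:
  fixes a b h :: "'a::euclidean_space \<Rightarrow> real"
  assumes m: "a \<in> borel_measurable lebesgue" "b \<in> borel_measurable lebesgue" "h \<in> borel_measurable lebesgue"
    and i: "integrable lebesgue (\<lambda>z. h z * (a z - b z))"
  defines "f \<equiv> \<lambda>p. h (fst p) * (below (a (fst p)) (snd p) - below (b (fst p)) (snd p))"
  shows "integrable lebesgue f" "(\<integral>p. f p \<partial>lebesgue) = (\<integral>z. h z * (a z - b z) \<partial>lebesgue)"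
    "(\<integral>p. \<bar>f p\<bar> \<partial>lebesgue) = (\<integral>z. \<bar>h z * (a z - b z)\<bar> \<partial>lebesgue)"
proof -
  have fm: "f \<in> borel_measurable lebesgue"
    unfolding f_def using m
    by (intro borel_measurable_times borel_measurable_diff measurable_below lebesgue_measurable_fst)
  have "(\<integral>\<^sup>+p. ennreal (norm (f p)) \<partial>lebesgue) =
      (\<integral>\<^sup>+z. \<integral>\<^sup>+t. ennreal \<bar>h z\<bar> * ennreal \<bar>below (a z) t - below (b z) t\<bar> \<partial>lborel \<partial>lborel)"
  proof (subst nn_integral_lebesgue_pair)
    show "(\<lambda>p. ennreal (norm (f p))) \<in> borel_measurable lebesgue" using fm by measurable
  qed (simp add: f_def abs_mult ennreal_mult)
  also have "\<dots> = (\<integral>\<^sup>+z. ennreal \<bar>h z\<bar> * ennreal \<bar>a z - b z\<bar> \<partial>lborel)"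
    by (intro nn_integral_cong, subst nn_integral_cmult) (simp_all add: nn_integral_below_diff)
  also have "\<dots> = (\<integral>\<^sup>+z. ennreal (norm (h z * (a z - b z))) \<partial>lebesgue)"
    by (simp add: nn_integral_completion abs_mult ennreal_mult)
  finally have nn: "(\<integral>\<^sup>+p. ennreal (norm (f p)) \<partial>lebesgue) = (\<integral>\<^sup>+z. ennreal (norm (h z * (a z - b z))) \<partial>lebesgue)" .
  show int: "integrable lebesgue f"
    using i fm unfolding integrable_iff_bounded nn by simp
  show "(\<integral>p. f p \<partial>lebesgue) = (\<integral>z. h z * (a z - b z) \<partial>lebesgue)"
    unfolding lebesgue_Fubini(3)[OF int] by (simp add: f_def integral_below_diff)
  have "ennreal (\<integral>p. norm (f p) \<partial>lebesgue) = ennreal (\<integral>z. norm (h z * (a z - b z)) \<partial>lebesgue)"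
    using nn nn_integral_eq_integral[OF integrable_norm[OF int]] nn_integral_eq_integral[OF integrable_norm[OF i]]
    by simp
  then show "(\<integral>p. \<bar>f p\<bar> \<partial>lebesgue) = (\<integral>z. \<bar>h z * (a z - b z)\<bar> \<partial>lebesgue)"
    by (subst (asm) ennreal_inj) auto
qed

section \<open>Mollification\<close>

text \<open>The free shift \<tau> serves two convolutions: with \<open>uminus\<close> an integrable
  g is smoothed by a mollifier f, with the identity a vector field f is averaged against a mollifier
  g. The derivative falls on f, whose Taylor remainder is small uniformly in the base point.\<close>

lemma C1_deriv_convolution:
  fixes g :: "'a::euclidean_space \<Rightarrow> real" and f :: "'a \<Rightarrow> 'b::euclidean_space"
  assumes g: "integrable lborel g" and f: "C1_deriv f f'" and S: "bounded {x. f x \<noteq> 0}"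
    and \<tau>: "\<tau> \<in> borel_measurable borel"
  shows "C1_deriv (\<lambda>z. \<integral>w. g w *\<^sub>R f (z + \<tau> w) \<partial>lborel) (\<lambda>z h. \<integral>w. g w *\<^sub>R f' (z + \<tau> w) h \<partial>lborel)"
    and "\<And>z. integrable lborel (\<lambda>w. g w *\<^sub>R f (z + \<tau> w))"
    and "\<And>z h. integrable lborel (\<lambda>w. g w *\<^sub>R f' (z + \<tau> w) h)"
proof -
  note [measurable] = \<tau>
  have gm [measurable]: "g \<in> borel_measurable borel" using g borel_measurable_integrable by fastforce
  have fm [measurable]: "f \<in> borel_measurable borel" "(\<lambda>z. f' z h) \<in> borel_measurable borel" for h
    using C1_deriv_D(2,5)[OF f] by (simp_all add: borel_measurable_continuous_onI)
  have bound: "integrable lborel (\<lambda>w. g w *\<^sub>R k (z + \<tau> w))"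
    if k: "continuous_on UNIV k" "\<And>x. x \<notin> closure {x. f x \<noteq> 0} \<Longrightarrow> k x = 0" for k :: "'a \<Rightarrow> 'b" and z
  proof -
    have [measurable]: "k \<in> borel_measurable borel" using k by (simp add: borel_measurable_continuous_onI)
    obtain C where C: "C \<ge> 0" "\<And>x. norm (k x) \<le> C"
      using bounded_range_compact_support[OF k(1) bounded_closure[OF S] k(2)] by blast
    have "integrable lborel (\<lambda>w. norm (g w) * C)" using g by simp
    then show ?thesis
      by (rule Bochner_Integration.integrable_bound)
         (use C in \<open>auto intro!: AE_I2 mult_left_mono simp: abs_mult\<close>)
  qed
  show i: "integrable lborel (\<lambda>w. g w *\<^sub>R f (z + \<tau> w))" for z
    by (rule bound) (auto intro: C1_deriv_D[OF f] C1_deriv_support(1)[OF f])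
  show i': "integrable lborel (\<lambda>w. g w *\<^sub>R f' (z + \<tau> w) h)" for z h
    by (rule bound) (auto intro: C1_deriv_D[OF f] C1_deriv_support(2)[OF f])
  \<comment> \<open>Adding 1 keeps M positive, so that division by M is safe even if g is 0.\<close>
  define M where "M = (\<integral>w. \<bar>g w\<bar> \<partial>lborel) + 1"
  have M: "M > 0" "(\<integral>w. \<bar>g w\<bar> \<partial>lborel) \<le> M" by (auto simp: M_def add_nonneg_pos)
  have est: "norm (\<integral>w. g w *\<^sub>R k w \<partial>lborel) \<le> e * M"
    if "\<And>w. norm (k w) \<le> e" "integrable lborel (\<lambda>w. g w *\<^sub>R k w)" for k :: "'a \<Rightarrow> 'b" and e
  proof -
    have e: "e \<ge> 0" using that(1)[of undefined] norm_ge_zero order_trans by blast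
    have "norm (\<integral>w. g w *\<^sub>R k w \<partial>lborel) \<le> (\<integral>w. norm (g w *\<^sub>R k w) \<partial>lborel)" by (rule integral_norm_bound)
    also have "\<dots> \<le> (\<integral>w. e * \<bar>g w\<bar> \<partial>lborel)"
    proof (intro integral_mono integrable_norm that(2))
      show "norm (g w *\<^sub>R k w) \<le> e * \<bar>g w\<bar>" for w
        using mult_right_mono[OF that(1)[of w], of "\<bar>g w\<bar>"] by (simp add: mult.commute)
    qed (use g in simp)
    also have "\<dots> = e * (\<integral>w. \<bar>g w\<bar> \<partial>lborel)" by simp
    also have "\<dots> \<le> e * M" using M e by (intro mult_left_mono)
    finally show ?thesis .
  qed
  show "C1_deriv (\<lambda>z. \<integral>w. g w *\<^sub>R f (z + \<tau> w) \<partial>lborel) (\<lambda>z h. \<integral>w. g w *\<^sub>R f' (z + \<tau> w) h \<partial>lborel)"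
  proof (rule C1_derivI)
    fix z
    have lin: "linear (\<lambda>h. \<integral>w. g w *\<^sub>R f' (z + \<tau> w) h \<partial>lborel)"
    proof (rule linearI)
      show "(\<integral>w. g w *\<^sub>R f' (z + \<tau> w) (a + b) \<partial>lborel) =
          (\<integral>w. g w *\<^sub>R f' (z + \<tau> w) a \<partial>lborel) + (\<integral>w. g w *\<^sub>R f' (z + \<tau> w) b \<partial>lborel)" for a b
        using i' by (simp add: linear_add[OF C1_deriv_D(4)[OF f]] scaleR_add_right)
      show "(\<integral>w. g w *\<^sub>R f' (z + \<tau> w) (c *\<^sub>R b) \<partial>lborel) = c *\<^sub>R (\<integral>w. g w *\<^sub>R f' (z + \<tau> w) b \<partial>lborel)" for c b
      proof -
        have "g w *\<^sub>R f' (z + \<tau> w) (c *\<^sub>R b) = c *\<^sub>R (g w *\<^sub>R f' (z + \<tau> w) b)" for w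
          by (simp add: linear_cmul[OF C1_deriv_D(4)[OF f]])
        then show ?thesis by (simp only: integral_scaleR_right i')
      qed
    qed
    show "((\<lambda>z. \<integral>w. g w *\<^sub>R f (z + \<tau> w) \<partial>lborel) has_derivative (\<lambda>h. \<integral>w. g w *\<^sub>R f' (z + \<tau> w) h \<partial>lborel)) (at z)"
      unfolding has_derivative_at_alt
    proof (intro conjI allI impI)
      show "bounded_linear (\<lambda>h. \<integral>w. g w *\<^sub>R f' (z + \<tau> w) h \<partial>lborel)"
        using lin by (simp add: linear_conv_bounded_linear)
      fix e :: real assume "e > 0"
      then have "e / M > 0" using M by simp
      then obtain d where d: "d > 0" "\<And>z h. norm h < d \<Longrightarrow> norm (f (z + h) - f z - f' z h) \<le> e / M * norm h"
        using C1_uniformly_differentiable[OF f S] by blast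
      have "norm ((\<integral>w. g w *\<^sub>R f (y + \<tau> w) \<partial>lborel) - (\<integral>w. g w *\<^sub>R f (z + \<tau> w) \<partial>lborel)
          - (\<integral>w. g w *\<^sub>R f' (z + \<tau> w) (y - z) \<partial>lborel)) \<le> e * norm (y - z)" if y: "norm (y - z) < d" for y
      proof -
        have eq: "g w *\<^sub>R (f (y + \<tau> w) - f (z + \<tau> w) - f' (z + \<tau> w) (y - z)) =
            g w *\<^sub>R f (y + \<tau> w) - g w *\<^sub>R f (z + \<tau> w) - g w *\<^sub>R f' (z + \<tau> w) (y - z)" for w
          by (simp add: scaleR_diff_right)
        have "norm (\<integral>w. g w *\<^sub>R (f (y + \<tau> w) - f (z + \<tau> w) - f' (z + \<tau> w) (y - z)) \<partial>lborel) \<le> e / M * norm (y - z) * M"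
        proof (rule est)
          show "norm (f (y + \<tau> w) - f (z + \<tau> w) - f' (z + \<tau> w) (y - z)) \<le> e / M * norm (y - z)" for w
            using d(2)[OF y, of "z + \<tau> w"] by (simp add: algebra_simps)
          show "integrable lborel (\<lambda>w. g w *\<^sub>R (f (y + \<tau> w) - f (z + \<tau> w) - f' (z + \<tau> w) (y - z)))"
            unfolding eq using i i' by (intro Bochner_Integration.integrable_diff)
        qed
        then show ?thesis unfolding eq using i i' M by simp
      qed
      then show "\<exists>d>0. \<forall>y. norm (y - z) < d \<longrightarrow> norm ((\<integral>w. g w *\<^sub>R f (y + \<tau> w) \<partial>lborel) - (\<integral>w. g w *\<^sub>R f (z + \<tau> w) \<partial>lborel)
          - (\<integral>w. g w *\<^sub>R f' (z + \<tau> w) (y - z) \<partial>lborel)) \<le> e * norm (y - z)"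
        using d(1) by blast
    qed
  next
    fix h
    show "continuous_on UNIV (\<lambda>z. \<integral>w. g w *\<^sub>R f' (z + \<tau> w) h \<partial>lborel)"
    proof (rule continuous_at_imp_continuous_on, rule ballI, unfold continuous_at_eps_delta, intro allI impI)
      fix z e assume "(e::real) > 0"
      \<comment> \<open>The derivative may vary by \<open>q / M\<close> per unit length of h;
        \<open>norm h + 1\<close> in place of \<open>norm h\<close> covers the case h = 0.\<close>
      define q where "q = e / (2 * (norm h + 1))"
      have q: "q > 0" unfolding q_def using \<open>e > 0\<close> by (auto simp: add_nonneg_pos intro!: divide_pos_pos)
      have qe: "q * (norm h + 1) = e / 2" unfolding q_def using norm_ge_zero[of h] by (simp add: field_simps del: norm_ge_zero)
      have "q / M > 0" using M q by simp
      then obtain d where d: "d > 0" "\<And>x y h'. dist x y < d \<Longrightarrow> norm (f' x h' - f' y h') \<le> q / M * norm h'"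
        using C1_uniformly_continuous_deriv[OF f S] by blast
      have "dist (\<integral>w. g w *\<^sub>R f' (y + \<tau> w) h \<partial>lborel) (\<integral>w. g w *\<^sub>R f' (z + \<tau> w) h \<partial>lborel) < e" if y: "dist y z < d" for y
      proof -
        have "norm (\<integral>w. g w *\<^sub>R (f' (y + \<tau> w) h - f' (z + \<tau> w) h) \<partial>lborel) \<le> q / M * norm h * M"
          by (rule est) (use d(2) y i' in \<open>auto simp: scaleR_diff_right\<close>)
        also have "\<dots> < e"
        proof -
          have "q / M * norm h * M = q * norm h" using M by simp
          also have "\<dots> \<le> q * (norm h + 1)" using q by (intro mult_left_mono) auto
          also have "\<dots> < e" using qe \<open>e > 0\<close> by simp
          finally show ?thesis .
        qed
        finally show ?thesis using i' by (simp add: dist_norm scaleR_diff_right)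
      qed
      then show "\<exists>d>0. \<forall>y. dist y z < d \<longrightarrow> dist (\<integral>w. g w *\<^sub>R f' (y + \<tau> w) h \<partial>lborel) (\<integral>w. g w *\<^sub>R f' (z + \<tau> w) h \<partial>lborel) < e"
        using d(1) by blast
    qed
  qed
qed

text \<open>Evenness turns convolution into an average over translates and makes it symmetric as an
  operator, so it can be moved from one factor of an integral to the other.\<close>

definition mollifier :: "real \<Rightarrow> ('a::euclidean_space \<Rightarrow> real) \<Rightarrow> bool" where
  "mollifier d \<rho> \<longleftrightarrow> (\<exists>\<rho>'. C1_deriv \<rho> \<rho>') \<and> (\<forall>x. 0 \<le> \<rho> x) \<and> (\<forall>x. \<rho> (- x) = \<rho> x)
     \<and> (\<forall>x. norm x \<ge> d \<longrightarrow> \<rho> x = 0) \<and> (\<integral>x. \<rho> x \<partial>lborel) = 1"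

lemma mollifier_exists:
  assumes "d > 0" shows "\<exists>\<rho>::'a::euclidean_space \<Rightarrow> real. mollifier d \<rho>"
proof -
  define f :: "'a \<Rightarrow> real" where "f x = possq (d\<^sup>2 - x \<bullet> x)" for x
  have "\<exists>f'. C1_deriv f f'"
    using C1_deriv_compose[OF possq_C1 C1_deriv_diff[OF C1_deriv_const C1_deriv_inner[OF
          C1_deriv_linear[OF bounded_linear_ident] C1_deriv_linear[OF bounded_linear_ident]]]]
    unfolding f_def by blast
  then obtain f' where f': "C1_deriv f f'" by blast
  have nn: "f x \<ge> 0" for x by (simp add: f_def possq_def)
  have sym: "f (- x) = f x" for x by (simp add: f_def)
  have z: "f x = 0" if "norm x \<ge> d" for x
  proof -
    have "d\<^sup>2 \<le> (norm x)\<^sup>2" using that assms by (intro power_mono) auto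
    then show ?thesis by (simp add: f_def possq_def dot_square_norm)
  qed
  have fi: "integrable lborel f"
    by (rule integrable_compact_support(2)[OF C1_deriv_D(5)[OF f'] bounded_ball[of 0 d]]) (simp add: z)
  \<comment> \<open>The value of f at distance \<open>d / 2\<close>, where
    \<open>d\<^sup>2 - x \<bullet> x\<close> is \<open>3 * d\<^sup>2 / 4\<close>. As f is at least c
    on that ball, its integral is positive.\<close>
  define c where "c = (3 * d\<^sup>2 / 4)\<^sup>2"
  have c: "c > 0" using assms by (simp add: c_def)
  have low: "c * indicator (ball 0 (d/2)) x \<le> f x" for x
  proof (cases "x \<in> ball 0 (d/2)")
    case True
    have "(norm x)\<^sup>2 \<le> (d/2)\<^sup>2" using True by (intro power_mono) auto
    then have "3 * d\<^sup>2 / 4 \<le> d\<^sup>2 - x \<bullet> x" by (simp add: dot_square_norm power_divide)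
    then have "3 * d\<^sup>2 / 4 \<le> max 0 (d\<^sup>2 - x \<bullet> x)" by (rule max.coboundedI2)
    then have "c \<le> (max 0 (d\<^sup>2 - x \<bullet> x))\<^sup>2" unfolding c_def by (intro power_mono) auto
    then show ?thesis using True by (simp add: f_def possq_def)
  qed (simp add: nn)
  have "0 < c * measure lborel (ball (0::'a) (d/2))" using c assms by (simp add: content_ball_pos)
  also have "\<dots> = (\<integral>x. c * indicator (ball (0::'a) (d/2)) x \<partial>lborel)" by simp
  also have "\<dots> \<le> (\<integral>x. f x \<partial>lborel)"
    using low fi emeasure_bounded_finite[OF bounded_ball, of "0::'a" "d/2"]
    by (intro integral_mono integrable_mult_right integrable_real_indicator) auto
  finally have I: "(\<integral>x. f x \<partial>lborel) > 0" .
  define \<rho> where "\<rho> x = inverse (\<integral>x. f x \<partial>lborel) *\<^sub>R f x" for x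
  have "\<exists>\<rho>'. C1_deriv \<rho> \<rho>'" unfolding \<rho>_def using C1_deriv_scaleR[OF C1_deriv_const f'] by blast
  moreover have "(\<integral>x. \<rho> x \<partial>lborel) = 1" using I unfolding \<rho>_def by simp
  ultimately have "mollifier d \<rho>"
    using nn sym z I unfolding mollifier_def \<rho>_def by simp
  then show ?thesis by blast
qed

lemma mollifierD:
  assumes "mollifier d \<rho>"
  shows "\<And>x. 0 \<le> \<rho> x" "\<And>x. \<rho> (- x) = \<rho> x" "\<And>x. norm x \<ge> d \<Longrightarrow> \<rho> x = 0" "(\<integral>x. \<rho> x \<partial>lborel) = 1"
    "continuous_on UNIV \<rho>" "integrable lborel \<rho>" "bounded {x. \<rho> x \<noteq> 0}" "\<rho> \<in> borel_measurable borel"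
proof -
  obtain \<rho>' where r: "C1_deriv \<rho> \<rho>'" using assms by (auto simp: mollifier_def)
  show z: "\<And>x. norm x \<ge> d \<Longrightarrow> \<rho> x = 0" using assms by (auto simp: mollifier_def)
  show "\<And>x. 0 \<le> \<rho> x" "\<And>x. \<rho> (- x) = \<rho> x" "(\<integral>x. \<rho> x \<partial>lborel) = 1"
    using assms by (auto simp: mollifier_def)
  show c: "continuous_on UNIV \<rho>" by (rule C1_deriv_D(5)[OF r])
  have "{x. \<rho> x \<noteq> 0} \<subseteq> ball 0 d" using z by (auto simp: not_le[symmetric])
  then show b: "bounded {x. \<rho> x \<noteq> 0}" using bounded_subset bounded_ball by blast
  show "integrable lborel \<rho>" by (rule integrable_compact_support(2)[OF c b]) simp
  show "\<rho> \<in> borel_measurable borel" using c by (rule borel_measurable_continuous_onI)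
qed

section \<open>Approximation in L1 and continuity of translations\<close>

lemma L1_approx_continuous:
  fixes g :: "'a::euclidean_space \<Rightarrow> real"
  assumes g: "integrable lborel g" and e: "e > 0"
  obtains c S where "continuous_on UNIV c" "bounded S" "\<And>x. x \<notin> S \<Longrightarrow> c x = 0" "(\<integral>x. \<bar>g x - c x\<bar> \<partial>lborel) < e"
proof -
  have gm [measurable]: "g \<in> borel_measurable borel" using g borel_measurable_integrable by fastforce
  \<comment> \<open>Truncating both in space and in height prepares an integrable majorant for the
    second approximation, by continuous functions.\<close>
  define G where "G n x = (if norm x \<le> real n \<and> \<bar>g x\<bar> \<le> real n then g x else 0)" for n :: nat and x
  have Gm [measurable]: "G n \<in> borel_measurable borel" for n unfolding G_def by measurable
  have "(\<lambda>n. \<integral>x. \<bar>g x - G n x\<bar> \<partial>lborel) \<longlonglongrightarrow> (\<integral>x. 0 \<partial>(lborel::'a measure))"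
  proof (rule integral_dominated_convergence[where w="\<lambda>x. \<bar>g x\<bar>"])
    show "AE x in lborel. (\<lambda>n. \<bar>g x - G n x\<bar>) \<longlonglongrightarrow> 0"
    proof (rule AE_I2)
      fix x
      obtain N where N: "real N \<ge> max (norm x) \<bar>g x\<bar>" using real_arch_simple by blast
      have "eventually (\<lambda>n. \<bar>g x - G n x\<bar> = 0) sequentially"
        using eventually_ge_at_top[of N] by eventually_elim (use N in \<open>auto simp: G_def\<close>)
      then show "(\<lambda>n. \<bar>g x - G n x\<bar>) \<longlonglongrightarrow> 0" by (rule tendsto_eventually)
    qed
  qed (use g in \<open>auto simp: G_def\<close>)
  then have "eventually (\<lambda>n. (\<integral>x. \<bar>g x - G n x\<bar> \<partial>lborel) < e / 2) sequentially"
    using e by (intro order_tendstoD(2)) auto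
  then obtain n where n: "(\<integral>x. \<bar>g x - G n x\<bar> \<partial>lborel) < e / 2" by (auto simp: eventually_sequentially)
  have iG: "integrable lborel (G n)" by (rule Bochner_Integration.integrable_bound[OF g]) (auto simp: G_def)
  have "G n measurable_on UNIV"
    by (rule lebesgue_measurable_imp_measurable_on) (auto intro: measurable_completion)
  then obtain N k where N: "negligible N" and k: "\<And>j. continuous_on UNIV (k j)"
    and lim: "\<And>x. x \<notin> N \<Longrightarrow> (\<lambda>j. k j x) \<longlonglongrightarrow> G n x"
    unfolding measurable_on_def by auto
  obtain \<theta> :: "'a \<Rightarrow> real" where \<theta>: "C1c (ball 0 (real n + 1)) \<theta>" "\<And>p. 0 \<le> \<theta> p" "\<And>p. \<theta> p \<le> 1"
    "\<And>p. p \<in> cball 0 (real n) \<Longrightarrow> \<theta> p = 1"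
    by (rule cutoff_exists[of "cball 0 (real n)" "ball 0 (real n + 1)"]) (auto simp: subset_iff)
  have \<theta>c: "continuous_on UNIV \<theta>" using \<theta>(1) C1_deriv_D(5) by (auto simp: C1c_iff)
  have \<theta>z: "\<theta> x = 0" if "x \<notin> ball 0 (real n + 1)" for x
    using \<theta>(1) that closure_subset[of "{p. \<theta> p \<noteq> 0}"] unfolding C1c_def cc_def by blast
  \<comment> \<open>Clipping to height n and multiplying by \<theta> do not change the limit, since
    \<open>G n\<close> is bounded by n and vanishes outside the ball where \<theta> is 1; they give
    a majorant common to all j.\<close>
  define c where "c j x = max (- real n) (min (real n) (k j x)) * \<theta> x" for j x
  have cc: "continuous_on UNIV (c j)" for j unfolding c_def by (intro continuous_intros k \<theta>c)
  have cm [measurable]: "c j \<in> borel_measurable borel" for j using cc by (rule borel_measurable_continuous_onI)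
  have cz: "c j x = 0" if "x \<notin> ball 0 (real n + 1)" for j x using \<theta>z[OF that] by (simp add: c_def)
  have cb: "\<bar>c j x\<bar> \<le> real n * indicator (ball 0 (real n + 1)) x" for j x
  proof (cases "x \<in> ball 0 (real n + 1)")
    case True
    have "\<bar>c j x\<bar> \<le> real n * 1" unfolding c_def abs_mult using \<theta>(2,3)[of x] by (intro mult_mono) auto
    then show ?thesis using True by simp
  qed (simp add: cz)
  have "(\<lambda>j. \<integral>x. \<bar>G n x - c j x\<bar> \<partial>lborel) \<longlonglongrightarrow> (\<integral>x. 0 \<partial>(lborel::'a measure))"
  proof (rule integral_dominated_convergence[where w="\<lambda>x. \<bar>G n x\<bar> + real n * indicator (ball 0 (real n + 1)) x"])
    show "integrable lborel (\<lambda>x. \<bar>G n x\<bar> + real n * indicator (ball (0::'a) (real n + 1)) x)"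
      using iG emeasure_bounded_finite[OF bounded_ball, of "0::'a" "real n + 1"]
      by (intro Bochner_Integration.integrable_add integrable_mult_right integrable_real_indicator) auto
    have "AE x in lebesgue. x \<notin> N" using N by (simp add: negligible_iff_null_sets AE_not_in)
    then have "AE x in lborel. x \<notin> N" by (simp add: AE_completion_iff)
    then show "AE x in lborel. (\<lambda>j. \<bar>G n x - c j x\<bar>) \<longlonglongrightarrow> 0"
    proof eventually_elim
      case (elim x)
      have "(\<lambda>j. \<bar>G n x - c j x\<bar>) \<longlonglongrightarrow> \<bar>G n x - max (- real n) (min (real n) (G n x)) * \<theta> x\<bar>"
        unfolding c_def by (intro tendsto_intros lim elim)
      moreover have "G n x = max (- real n) (min (real n) (G n x)) * \<theta> x"
        using \<theta>(4)[of x] by (auto simp: G_def)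
      ultimately show ?case by simp
    qed
    show "AE x in lborel. norm \<bar>G n x - c j x\<bar> \<le> \<bar>G n x\<bar> + real n * indicator (ball 0 (real n + 1)) x" for j
      using cb[of j] by (auto intro!: AE_I2) (smt (verit))
  qed auto
  then have "eventually (\<lambda>j. (\<integral>x. \<bar>G n x - c j x\<bar> \<partial>lborel) < e / 2) sequentially"
    using e by (intro order_tendstoD(2)) auto
  then obtain j where j: "(\<integral>x. \<bar>G n x - c j x\<bar> \<partial>lborel) < e / 2" by (auto simp: eventually_sequentially)
  have ic: "integrable lborel (c j)" by (rule integrable_compact_support(2)[OF cc bounded_ball cz])
  have "(\<integral>x. \<bar>g x - c j x\<bar> \<partial>lborel) \<le> (\<integral>x. \<bar>g x - G n x\<bar> + \<bar>G n x - c j x\<bar> \<partial>lborel)"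
    using g iG ic by (intro integral_mono) auto
  also have "\<dots> = (\<integral>x. \<bar>g x - G n x\<bar> \<partial>lborel) + (\<integral>x. \<bar>G n x - c j x\<bar> \<partial>lborel)"
    using g iG ic by (intro Bochner_Integration.integral_add) auto
  also have "\<dots> < e" using n j by simp
  finally show ?thesis using that[OF cc bounded_ball cz] by blast
qed

text \<open>A continuous compactly supported c moves little under a small shift, and by translation
  invariance the two remaining errors both equal the L1 distance of g and c, less than
  \<open>e / 3\<close>.\<close>

lemma L1_translation_continuous:
  fixes g :: "'a::euclidean_space \<Rightarrow> real"
  assumes g: "integrable lborel g" and e: "e > 0"
  shows "\<exists>d>0. \<forall>x. norm x < d \<longrightarrow> (\<integral>z. \<bar>g (z + x) - g z\<bar> \<partial>lborel) \<le> e"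
proof -
  obtain c S where c: "continuous_on UNIV c" "bounded S" "\<And>x. x \<notin> S \<Longrightarrow> c x = 0"
    and gc: "(\<integral>x. \<bar>g x - c x\<bar> \<partial>lborel) < e / 3"
    using L1_approx_continuous[OF g, of "e / 3"] e by auto
  obtain R where R: "S \<subseteq> cball 0 R" using bounded_subset_ballD[OF c(2), of 0] ball_subset_cball subset_trans by metis
  define M where "M = measure lborel (cball (0::'a) (R + 1)) + 1"
  have M: "M > 0" by (simp add: M_def add_nonneg_pos)
  have ic: "integrable lborel c" by (rule integrable_compact_support(2)[OF c])
  obtain d where d: "d > 0" "\<And>x y. dist x y < d \<Longrightarrow> dist (c x) (c y) < e / (3 * M)"
    using uniformly_continuous_compact_support[OF c, of "e / (3 * M)"] e M by auto
  have "(\<integral>z. \<bar>g (z + x) - g z\<bar> \<partial>lborel) \<le> e" if x: "norm x < min d 1" for x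
  proof -
    have cc: "\<bar>c (z + x) - c z\<bar> \<le> e / (3 * M) * indicator (cball 0 (R + 1)) z" for z
    proof (cases "z \<in> cball 0 (R + 1)")
      case True
      then show ?thesis using d(2)[of "z + x" z] x by (simp add: dist_norm)
    next
      case False
      have "norm z \<le> norm (z + x) + norm x" by (metis add_diff_cancel_right' norm_triangle_ineq4)
      then have "z \<notin> S" "z + x \<notin> S" using False R x by auto
      then show ?thesis using False c(3) by simp
    qed
    have i: "integrable lborel (\<lambda>z. g (z + x))" "integrable lborel (\<lambda>z. c (z + x))"
      by (rule integrable_lborel_translation[OF g] integrable_lborel_translation[OF ic])+
    have "(\<integral>z. \<bar>g (z + x) - g z\<bar> \<partial>lborel) \<le> (\<integral>z. \<bar>g (z + x) - c (z + x)\<bar> + \<bar>c (z + x) - c z\<bar> + \<bar>g z - c z\<bar> \<partial>lborel)"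
      using i g ic by (intro integral_mono) auto
    also have "\<dots> = (\<integral>z. \<bar>g (z + x) - c (z + x)\<bar> \<partial>lborel) + (\<integral>z. \<bar>c (z + x) - c z\<bar> \<partial>lborel) + (\<integral>z. \<bar>g z - c z\<bar> \<partial>lborel)"
      using i g ic by simp
    also have "(\<integral>z. \<bar>g (z + x) - c (z + x)\<bar> \<partial>lborel) = (\<integral>z. \<bar>g z - c z\<bar> \<partial>lborel)"
      using g ic borel_measurable_integrable by (intro integral_lborel_translation[of "\<lambda>z. \<bar>g z - c z\<bar>"]) fastforce
    also have "(\<integral>z. \<bar>c (z + x) - c z\<bar> \<partial>lborel) \<le> (\<integral>z. e / (3 * M) * indicator (cball (0::'a) (R + 1)) z \<partial>lborel)"
      using cc i ic emeasure_bounded_finite[OF bounded_cball, of "0::'a" "R + 1"]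
      by (intro integral_mono integrable_mult_right integrable_real_indicator) auto
    also have "\<dots> = e / (3 * M) * (M - 1)" by (simp add: M_def)
    also have "\<dots> \<le> e / (3 * M) * M" using e M by (intro mult_left_mono) auto
    also have "\<dots> = e / 3" using M by simp
    finally show ?thesis using gc by linarith
  qed
  then show ?thesis using d(1) by (intro exI[of _ "min d 1"]) auto
qed

text \<open>The spelling \<open>z + (- y)\<close> fits \<open>C1_deriv_convolution\<close> with the
  shift \<open>uminus\<close>, so that smoothness comes from \<rho>.\<close>

definition mollify :: "('a::euclidean_space \<Rightarrow> real) \<Rightarrow> ('a \<Rightarrow> real) \<Rightarrow> 'a \<Rightarrow> real" where
  "mollify \<rho> g z = (\<integral>y. g y *\<^sub>R \<rho> (z + (- y)) \<partial>lborel)"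

lemma mollify_C1:
  assumes "mollifier d \<rho>" "integrable lborel g"
  shows "\<exists>w'. C1_deriv (mollify \<rho> g) w'"
proof -
  obtain \<rho>' where "C1_deriv \<rho> \<rho>'" using assms(1) by (auto simp: mollifier_def)
  from C1_deriv_convolution(1)[OF assms(2) this mollifierD(7)[OF assms(1)], of uminus]
  show ?thesis unfolding mollify_def[abs_def] by auto
qed

lemma mollify_translated:
  assumes \<rho>: "mollifier d \<rho>" and g: "integrable lborel g"
  shows "mollify \<rho> g z = (\<integral>x. \<rho> x * g (z + x) \<partial>lborel)"
    "integrable lborel (\<lambda>x. \<rho> x * g (z + x))"
proof -
  obtain \<rho>' where r: "C1_deriv \<rho> \<rho>'" using \<rho> by (auto simp: mollifier_def)
  have eq: "\<rho> (z + - y) = \<rho> (y + - z)" for y using mollifierD(2)[OF \<rho>, of "y + - z"] by simp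
  have [measurable]: "g \<in> borel_measurable borel" "\<rho> \<in> borel_measurable borel"
    using g borel_measurable_integrable mollifierD(8)[OF \<rho>] by fastforce+
  have "integrable lborel (\<lambda>y. g y *\<^sub>R \<rho> (z + - y))"
    by (rule C1_deriv_convolution(2)[OF g r mollifierD(7)[OF \<rho>]]) simp
  then have i: "integrable lborel (\<lambda>y. g y * \<rho> (y + - z))" by (simp only: eq real_scaleR_def)
  have "mollify \<rho> g z = (\<integral>y. g y * \<rho> (y + - z) \<partial>lborel)" by (simp only: eq mollify_def real_scaleR_def)
  also have "\<dots> = (\<integral>y. g (y + z) * \<rho> (y + z + - z) \<partial>lborel)"
    by (rule integral_lborel_translation[symmetric]) measurable
  finally show "mollify \<rho> g z = (\<integral>x. \<rho> x * g (z + x) \<partial>lborel)" by (simp add: ac_simps)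
  show "integrable lborel (\<lambda>x. \<rho> x * g (z + x))"
    using integrable_lborel_translation[OF i, of z] by (simp add: ac_simps)
qed

text \<open>The error is a \<rho>-weighted average of the differences \<open>g (z + x) - g z\<close>
  over \<open>norm x < d\<close>, so exchanging integrals bounds its L1 norm by the largest
  translation error. Nonnegative integrals come first because integrability is part of the
  conclusion.\<close>

lemma mollify_L1_approx:
  assumes \<rho>: "mollifier d \<rho>" and g: "integrable lborel g" and e: "e \<ge> 0"
    and d: "\<And>x. norm x < d \<Longrightarrow> (\<integral>z. \<bar>g (z + x) - g z\<bar> \<partial>lborel) \<le> e"
  shows "integrable lborel (\<lambda>z. mollify \<rho> g z - g z)" "(\<integral>z. \<bar>mollify \<rho> g z - g z\<bar> \<partial>lborel) \<le> e"
proof -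
  obtain w' where w: "C1_deriv (mollify \<rho> g) w'" using mollify_C1[OF \<rho> g] by blast
  have [measurable]: "g \<in> borel_measurable borel" "\<rho> \<in> borel_measurable borel" "mollify \<rho> g \<in> borel_measurable borel"
    using g borel_measurable_integrable mollifierD(8)[OF \<rho>] C1_deriv_D(5)[OF w] borel_measurable_continuous_onI by fastforce+
  have "(\<integral>\<^sup>+z. ennreal \<bar>mollify \<rho> g z - g z\<bar> \<partial>lborel) \<le> (\<integral>\<^sup>+z. \<integral>\<^sup>+x. ennreal (\<rho> x * \<bar>g (z + x) - g z\<bar>) \<partial>lborel \<partial>lborel)"
  proof (rule nn_integral_mono)
    fix z
    have ii: "integrable lborel (\<lambda>x. \<rho> x * (g (z + x) - g z))"
      using mollify_translated(2)[OF \<rho> g] mollifierD(6)[OF \<rho>] by (simp add: right_diff_distrib)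
    have "mollify \<rho> g z - g z = (\<integral>x. \<rho> x * g (z + x) \<partial>lborel) - g z * (\<integral>x. \<rho> x \<partial>lborel)"
      by (simp add: mollify_translated[OF \<rho> g] mollifierD(4)[OF \<rho>])
    also have "\<dots> = (\<integral>x. \<rho> x * (g (z + x) - g z) \<partial>lborel)"
      using mollify_translated(2)[OF \<rho> g] mollifierD(6)[OF \<rho>] by (simp add: right_diff_distrib mult.commute)
    finally have "\<bar>mollify \<rho> g z - g z\<bar> \<le> (\<integral>x. \<bar>\<rho> x * (g (z + x) - g z)\<bar> \<partial>lborel)"
      using integral_abs_bound by metis
    then have "ennreal \<bar>mollify \<rho> g z - g z\<bar> \<le> ennreal (\<integral>x. \<bar>\<rho> x * (g (z + x) - g z)\<bar> \<partial>lborel)"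
      by (rule ennreal_leI)
    also have "\<dots> = (\<integral>\<^sup>+x. ennreal \<bar>\<rho> x * (g (z + x) - g z)\<bar> \<partial>lborel)"
      using ii by (intro nn_integral_eq_integral[symmetric]) auto
    also have "\<dots> = (\<integral>\<^sup>+x. ennreal (\<rho> x * \<bar>g (z + x) - g z\<bar>) \<partial>lborel)"
      using mollifierD(1)[OF \<rho>] by (simp add: abs_mult)
    finally show "ennreal \<bar>mollify \<rho> g z - g z\<bar> \<le> (\<integral>\<^sup>+x. ennreal (\<rho> x * \<bar>g (z + x) - g z\<bar>) \<partial>lborel)" .
  qed
  also have "\<dots> = (\<integral>\<^sup>+x. \<integral>\<^sup>+z. ennreal (\<rho> x * \<bar>g (z + x) - g z\<bar>) \<partial>lborel \<partial>lborel)"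
    by (rule lborel_pair.Fubini'[symmetric]) measurable
  also have "\<dots> \<le> (\<integral>\<^sup>+x. ennreal (\<rho> x * e) \<partial>lborel)"
  proof (rule nn_integral_mono)
    fix x
    have it: "integrable lborel (\<lambda>z. \<bar>g (z + x) - g z\<bar>)"
      using g integrable_lborel_translation[OF g] by auto
    have "(\<integral>\<^sup>+z. ennreal (\<rho> x * \<bar>g (z + x) - g z\<bar>) \<partial>lborel) = ennreal (\<integral>z. \<rho> x * \<bar>g (z + x) - g z\<bar> \<partial>lborel)"
      using it mollifierD(1)[OF \<rho>] by (intro nn_integral_eq_integral) auto
    also have "\<dots> \<le> ennreal (\<rho> x * e)"
    proof (cases "norm x < d")
      case True
      then show ?thesis using d[OF True] mollifierD(1)[OF \<rho>, of x] by (auto intro!: ennreal_leI mult_left_mono)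
    next
      case False
      then show ?thesis using mollifierD(3)[OF \<rho>, of x] by simp
    qed
    finally show "(\<integral>\<^sup>+z. ennreal (\<rho> x * \<bar>g (z + x) - g z\<bar>) \<partial>lborel) \<le> ennreal (\<rho> x * e)" .
  qed
  also have "\<dots> = ennreal (\<integral>x. \<rho> x * e \<partial>lborel)"
    using mollifierD(1,6)[OF \<rho>] e by (intro nn_integral_eq_integral) auto
  also have "\<dots> = ennreal e" using mollifierD(4)[OF \<rho>] by simp
  finally have nn: "(\<integral>\<^sup>+z. ennreal \<bar>mollify \<rho> g z - g z\<bar> \<partial>lborel) \<le> ennreal e" .
  then show i: "integrable lborel (\<lambda>z. mollify \<rho> g z - g z)"
    unfolding integrable_iff_bounded using ennreal_less_top[of e] by (auto intro: le_less_trans)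
  have "ennreal (\<integral>z. \<bar>mollify \<rho> g z - g z\<bar> \<partial>lborel) \<le> ennreal e"
    using nn i by (subst nn_integral_eq_integral[symmetric]) auto
  then show "(\<integral>z. \<bar>mollify \<rho> g z - g z\<bar> \<partial>lborel) \<le> e" using e by simp
qed

text \<open>Testing the mollified function against k equals testing g itself against the averaged k;
  this later moves the smoothing from a graph to a field. Fubini applies because \<rho> is bounded
  and \<open>k z * g y\<close> is integrable on the product.\<close>

lemma mollify_adjoint:
  assumes \<rho>: "mollifier d \<rho>" and g: "integrable lborel g"
    and k: "continuous_on UNIV k" "bounded S" "\<And>x. x \<notin> S \<Longrightarrow> k x = 0"
  shows "(\<integral>z. mollify \<rho> g z * k z \<partial>lborel) = (\<integral>y. g y * (\<integral>x. \<rho> x * k (y + x) \<partial>lborel) \<partial>lborel)"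
proof -
  have [measurable]: "g \<in> borel_measurable borel" "\<rho> \<in> borel_measurable borel" "k \<in> borel_measurable borel"
    using g borel_measurable_integrable mollifierD(8)[OF \<rho>] k(1) borel_measurable_continuous_onI by fastforce+
  have ik: "integrable lborel k" by (rule integrable_compact_support(2)[OF k])
  obtain C where C: "C \<ge> 0" "\<And>x. norm (\<rho> x) \<le> C"
    using bounded_range_compact_support[OF mollifierD(5)[OF \<rho>] mollifierD(7)[OF \<rho>]] by auto
  have i0: "integrable (lborel \<Otimes>\<^sub>M lborel) (\<lambda>(z, y). k z * g y)"
  proof (rule lborel_pair.Fubini_integrable)
    show "AE x in lborel. integrable lborel (\<lambda>y. case (x, y) of (z, y) \<Rightarrow> k z * g y)" using g by auto
    show "integrable lborel (\<lambda>x. \<integral>y. norm (case (x, y) of (z, y) \<Rightarrow> k z * g y) \<partial>lborel)"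
      using ik by (simp add: abs_mult)
  qed measurable
  have i: "integrable (lborel \<Otimes>\<^sub>M lborel) (\<lambda>(z, y). g y * \<rho> (z + - y) * k z)"
  proof (rule Bochner_Integration.integrable_bound[OF integrable_mult_right[OF i0, of C]])
    show "AE p in lborel \<Otimes>\<^sub>M lborel. norm (case p of (z, y) \<Rightarrow> g y * \<rho> (z + - y) * k z) \<le> norm (C * (case p of (z, y) \<Rightarrow> k z * g y))"
    proof (rule AE_I2, clarify)
      fix z y
      have "\<bar>\<rho> (z + - y)\<bar> * (\<bar>k z\<bar> * \<bar>g y\<bar>) \<le> \<bar>C\<bar> * (\<bar>k z\<bar> * \<bar>g y\<bar>)"
        using C(1) C(2)[of "z + - y"] by (intro mult_right_mono) auto
      then show "norm (g y * \<rho> (z + - y) * k z) \<le> norm (C * (k z * g y))"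
        by (simp add: abs_mult ac_simps)
    qed
  qed measurable
  have "(\<integral>z. mollify \<rho> g z * k z \<partial>lborel) = (\<integral>z. \<integral>y. g y * \<rho> (z + - y) * k z \<partial>lborel \<partial>lborel)"
    by (simp add: mollify_def)
  also have "\<dots> = (\<integral>y. \<integral>z. g y * \<rho> (z + - y) * k z \<partial>lborel \<partial>lborel)"
    by (rule lborel_pair.Fubini_integral[OF i, symmetric])
  also have "\<dots> = (\<integral>y. g y * (\<integral>z. \<rho> (z + - y) * k z \<partial>lborel) \<partial>lborel)"
    by (simp add: mult.assoc)
  also have "\<dots> = (\<integral>y. g y * (\<integral>x. \<rho> x * k (y + x) \<partial>lborel) \<partial>lborel)"
  proof (intro Bochner_Integration.integral_cong refl)
    fix y
    have "(\<integral>z. \<rho> (z + - y) * k z \<partial>lborel) = (\<integral>z. \<rho> (z + y + - y) * k (z + y) \<partial>lborel)"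
      by (rule integral_lborel_translation[symmetric]) measurable
    then show "g y * (\<integral>z. \<rho> (z + - y) * k z \<partial>lborel) = g y * (\<integral>x. \<rho> x * k (y + x) \<partial>lborel)"
      by (simp add: add.commute)
  qed
  finally show ?thesis .
qed

section \<open>The divergence on subgraphs of smooth functions\<close>

lemma ediv_prod:
  fixes U :: "'a::euclidean_space \<times> real \<Rightarrow> 'a \<times> real"
  assumes "C1_deriv U U'"
  shows "ediv U p = (\<Sum>b\<in>Basis. fst (U' p (b, 0)) \<bullet> b) + snd (U' p (0, 1))"
proof -
  have "((\<lambda>u. (u, 0)) ` Basis \<inter> (\<lambda>u. (0, u)) ` Basis :: ('a \<times> real) set) = {}" by auto
  then show ?thesis
    unfolding ediv_C1_deriv[OF assms] Basis_prod_def
    by (subst sum.union_disjoint) (auto simp: inner_prod_def sum.reindex inj_on_def)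
qed

lemma FTC_below:
  fixes f f' :: "real \<Rightarrow> real"
  assumes f: "\<And>t. (f has_real_derivative f' t) (at t)" and c: "continuous_on UNIV f'"
    and z: "\<And>t. t < - T \<Longrightarrow> f t = 0" "\<And>t. t < - T \<Longrightarrow> f' t = 0"
  shows "(\<integral>t. below a t * f' t \<partial>lborel) = f a"
proof -
  define L where "L = min a (- T) - 1"
  have L: "L < a" "L < - T" by (auto simp: L_def)
  have [measurable]: "f' \<in> borel_measurable borel" using c by (rule borel_measurable_continuous_onI)
  \<comment> \<open>The strict inequality in \<open>below\<close> omits the endpoint a, which is a
    null set.\<close>
  have "AE t in lborel. t \<noteq> a" by (rule AE_lborel_singleton)
  then have "AE t in lborel. below a t * f' t = f' t * indicator {L..a} t"
    by eventually_elim (use L z(2) in \<open>auto simp: below_def indicator_def\<close>)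
  then have "(\<integral>t. below a t * f' t \<partial>lborel) = (\<integral>t. f' t * indicator {L..a} t \<partial>lborel)"
    by (intro integral_cong_AE) auto
  also have "\<dots> = f a - f L"
    using L c by (intro integral_FTC_Icc_real f) (auto simp: continuous_on_eq_continuous_at)
  finally show ?thesis using z(1) L by simp
qed

text \<open>The flux of U through the graph of w is \<open>snd U - w' (fst U)\<close> at
  \<open>(z, w z)\<close>. The vertical part is the fundamental theorem on each line. For the
  horizontal part the graph is shifted vertically: for each s the divergence in z of
  \<open>fst (U (z, w z + s))\<close> integrates to 0, and integrating over s < 0 sweeps out the
  subgraph. A last integration by parts moves the derivative off w.\<close>

lemma integral_below_ediv:
  fixes w :: "'a::euclidean_space \<Rightarrow> real" and U :: "'a \<times> real \<Rightarrow> 'a \<times> real"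
  assumes w: "C1_deriv w w'" and U: "C1_deriv U U'" and S: "bounded {p. U p \<noteq> 0}"
  shows "(\<integral>p. below (w (fst p)) (snd p) * ediv U p \<partial>lebesgue) =
    (\<integral>z. w z * ediv (\<lambda>z. fst (U (z, w z))) z + snd (U (z, w z)) \<partial>lebesgue)"
proof -
  obtain T where T: "{p. U p \<noteq> 0} \<subseteq> cball 0 T"
    using bounded_subset_ballD[OF S, of 0] ball_subset_cball subset_trans by metis
  have U0: "U (z, t) = 0" "U' (z, t) h = 0" if "norm z > T \<or> \<bar>t\<bar> > T" for z t h
  proof -
    have "norm z \<le> norm (z, t)" "\<bar>t\<bar> \<le> norm (z, t)" using norm_fst_le[of z t] norm_snd_le[of t z] by auto
    then have "(z, t) \<notin> cball 0 T" using that by auto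
    then show "U (z, t) = 0" "U' (z, t) h = 0" by (rule C1_deriv_outside[OF U closed_cball T])+
  qed
  note wc = C1_deriv_D(5)[OF w] and Uc = C1_deriv_D(5)[OF U]
  have U'c: "continuous_on UNIV (\<lambda>p. U' p h)" for h by (rule C1_deriv_D(2)[OF U])
  have w'c: "continuous_on UNIV (\<lambda>p. w' (fst p) h)" for h
    by (rule continuous_on_compose2[OF C1_deriv_D(2)[OF w] continuous_on_fst]) (auto intro: continuous_intros)
  define DH where "DH p = (\<Sum>b\<in>Basis. fst (U' p (b, 0)) \<bullet> b)" for p
  \<comment> \<open>By the chain rule this is, at \<open>(z, w z + s)\<close>, the divergence in z
    of \<open>fst (U (z, w z + s))\<close>: the horizontal part \<open>DH\<close> of the divergence
    of U plus the contribution of the slope of w.\<close>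
  define \<kappa> where "\<kappa> p = DH p + (\<Sum>b\<in>Basis. w' (fst p) b * (fst (U' p (0, 1)) \<bullet> b))" for p
  have DHc: "continuous_on UNIV DH" unfolding DH_def by (intro continuous_intros U'c)
  have \<kappa>c: "continuous_on UNIV \<kappa>" unfolding \<kappa>_def by (intro continuous_intros DHc U'c w'c)
  have w'exp: "w' z v = (\<Sum>b\<in>Basis. w' z b * (v \<bullet> b))" for z v
  proof -
    have "w' z v = w' z (\<Sum>b\<in>Basis. (v \<bullet> b) *\<^sub>R b)" by (simp add: euclidean_representation)
    also have "\<dots> = (\<Sum>b\<in>Basis. (v \<bullet> b) *\<^sub>R w' z b)"
      using C1_deriv_D(4)[OF w] by (simp add: linear_sum linear_cmul)
    finally show ?thesis by (simp add: mult.commute)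
  qed
  \<comment> \<open>The shear carries the half-space s < 0 onto the subgraph of w, so the domain of
    integration no longer depends on z.\<close>
  define sh where "sh p = (fst p, snd p + w (fst p))" for p :: "'a \<times> real"
  have shc: "continuous_on UNIV sh" unfolding sh_def
    by (intro continuous_intros continuous_on_compose2[OF wc]) auto
  have \<kappa>sc: "continuous_on UNIV (\<lambda>p. \<kappa> (sh p))"
    by (rule continuous_on_compose2[OF \<kappa>c shc]) auto
  have "bounded (w ` cball 0 T)"
    by (intro compact_imp_bounded compact_continuous_image continuous_on_subset[OF wc]) auto
  then obtain B where B: "\<And>z. norm z \<le> T \<Longrightarrow> \<bar>w z\<bar> \<le> B" by (force simp: bounded_iff)
  \<comment> \<open>If \<open>norm z \<le> T\<close> and \<open>\<bar>s + w z\<bar> \<le> T\<close>,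
    then \<open>\<bar>s\<bar> \<le> T + B\<close>; hence this box contains the support of \<kappa>
    after the shear.\<close>
  define R where "R = cball (0::'a) T \<times> cball (0::real) (T + B)"
  have R: "bounded R" unfolding R_def by (intro bounded_Times) auto
  have \<kappa>s0: "\<kappa> (sh p) = 0" if "p \<notin> R" for p
  proof -
    obtain z s where p: "p = (z, s)" by fastforce
    have "norm z > T \<or> \<bar>s + w z\<bar> > T" using that B[of z] unfolding p R_def
      by (cases "norm z \<le> T") auto
    then show ?thesis using U0[of z "s + w z"] by (simp add: \<kappa>_def DH_def sh_def p)
  qed
  have lborel_int: "integrable lborel f"
    if f: "f \<in> borel_measurable borel" "bounded Q" "\<And>x. x \<notin> Q \<Longrightarrow> f x = 0" "\<And>x. norm (f x) \<le> C"
    for f :: "'a \<times> real \<Rightarrow> real" and Q C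
  proof -
    have m: "f \<in> borel_measurable lborel" using f(1) by simp
    show ?thesis
      using integrable_bounded_support[OF measurable_completion[OF m] f(2-4)] integrable_completion[OF m] by blast
  qed
  define K where "K z s = below 0 s * \<kappa> (sh (z, s))" for z s
  have Km: "(\<lambda>p. below 0 (snd p) * \<kappa> (sh p)) \<in> borel_measurable borel"
    by (intro borel_measurable_times measurable_compose[OF _ below_borel] borel_measurable_continuous_onI \<kappa>sc)
       (intro continuous_intros)
  have "integrable lborel (\<lambda>p. below 0 (snd p) * \<kappa> (sh p))"
  proof -
    obtain C where C: "\<And>x. norm (\<kappa> (sh x)) \<le> C"
      using bounded_range_compact_support[OF \<kappa>sc R \<kappa>s0] by blast
    have "norm (below 0 (snd p) * \<kappa> (sh p)) \<le> C" for p
      using C[of p] norm_ge_zero[of "\<kappa> (sh p)"] by (auto simp: below_def simp del: norm_ge_zero)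
    then show ?thesis using \<kappa>s0 by (intro lborel_int[OF Km R]) auto
  qed
  then have Ki: "integrable (lborel \<Otimes>\<^sub>M lborel) (\<lambda>(z, s). K z s)"
    unfolding lborel_prod K_def by (simp add: case_prod_beta')
  have slice0: "(\<integral>z. \<kappa> (sh (z, s)) \<partial>lborel) = 0" for s
  proof -
    have "C1_deriv (\<lambda>z. (z, w z + s)) (\<lambda>z h. (h, w' z h + 0))"
      by (intro C1_deriv_Pair C1_deriv_add w C1_deriv_const C1_deriv_linear bounded_linear_ident)
    from C1_deriv_compose[OF C1_deriv_linear[OF bounded_linear_fst] C1_deriv_compose[OF U this]]
    have X: "C1_deriv (\<lambda>z. fst (U (z, w z + s))) (\<lambda>z h. fst (U' (z, w z + s) (h, w' z h)))" by simp
    have "{z. fst (U (z, w z + s)) \<noteq> 0} \<subseteq> cball 0 T" 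
    proof
      fix z assume "z \<in> {z. fst (U (z, w z + s)) \<noteq> 0}"
      then have "\<not> norm z > T" using U0(1)[of z "w z + s"] by auto
      then show "z \<in> cball 0 T" by simp
    qed
    then have bX: "bounded {z. fst (U (z, w z + s)) \<noteq> 0}" using bounded_subset bounded_cball by blast
    have e: "ediv (\<lambda>z. fst (U (z, w z + s))) z = \<kappa> (sh (z, s))" for z
    proof -
      have split: "U' (z, w z + s) (b, w' z b) = U' (z, w z + s) (b, 0) + w' z b *\<^sub>R U' (z, w z + s) (0, 1)" for b
        using linear_add[OF C1_deriv_D(4)[OF U, of "(z, w z + s)"], of "(b, 0)" "w' z b *\<^sub>R (0, 1)"]
          linear_cmul[OF C1_deriv_D(4)[OF U, of "(z, w z + s)"], of "w' z b" "(0, 1)"] by simp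
      show ?thesis
        unfolding ediv_C1_deriv[OF X] \<kappa>_def DH_def sh_def split
        by (simp add: inner_add_left sum.distrib add.commute)
    qed
    have "continuous_on UNIV (\<lambda>z. \<kappa> (sh (z, s)))"
      by (rule continuous_on_compose2[OF \<kappa>sc]) (auto intro: continuous_intros)
    then have "(\<lambda>z. \<kappa> (sh (z, s))) \<in> borel_measurable borel" by (rule borel_measurable_continuous_onI)
    then show ?thesis using integral_ediv_zero[OF X bX] unfolding e by (simp add: integral_lebesgue_lborel)
  qed
  have "(\<integral>z. \<integral>s. K z s \<partial>lborel \<partial>lborel) = (\<integral>s. \<integral>z. K z s \<partial>lborel \<partial>lborel)"
    using lborel_pair.Fubini_integral[OF Ki] by simp
  also have "\<dots> = 0" by (simp add: K_def slice0)
  finally have zero: "(\<integral>z. \<integral>s. K z s \<partial>lborel \<partial>lborel) = 0" .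
  have dt: "((\<lambda>t. U (z, t)) has_derivative (\<lambda>h. U' (z, t) (0, h))) (at t)" for z t
    by (rule has_derivative_compose[OF _ C1_deriv_D(1)[OF U], of "\<lambda>t. (z, t)" "\<lambda>h. (0, h)", simplified])
       (auto intro!: derivative_eq_intros)
  have U'h: "U' q (0, h) = h *\<^sub>R U' q (0, 1)" for q h
    using linear_cmul[OF C1_deriv_D(4)[OF U, of q], of h "(0, 1)"] by simp
  have U'sc: "continuous_on UNIV (\<lambda>t. U' (z, t) h)" for z h
    by (rule continuous_on_compose2[OF U'c]) (auto intro: continuous_intros)
  have ftc: "(\<integral>t. below (w z) t * l (U' (z, t) (0, 1)) \<partial>lborel) = l (U (z, w z))"
    if l: "bounded_linear l" for l :: "'a \<times> real \<Rightarrow> real" and z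
  proof (rule FTC_below[where T=T])
    have "((\<lambda>t. l (U (z, t))) has_derivative (\<lambda>h. l (U' (z, t) (0, h)))) (at t)" for t
      by (rule bounded_linear.has_derivative[OF l dt])
    moreover have "(\<lambda>h. l (U' (z, t) (0, h))) = (*) (l (U' (z, t) (0, 1)))" for t
    proof
      show "l (U' (z, t) (0, h)) = l (U' (z, t) (0, 1)) * h" for h
        unfolding U'h[of _ h] linear_cmul[OF bounded_linear.linear[OF l]] by simp
    qed
    ultimately show "((\<lambda>t. l (U (z, t))) has_real_derivative l (U' (z, t) (0, 1))) (at t)" for t
      by (simp add: has_field_derivative_def)
    show "continuous_on UNIV (\<lambda>t. l (U' (z, t) (0, 1)))"
      by (rule continuous_on_compose2[OF linear_continuous_on[OF l] U'sc]) auto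
    show "l (U (z, t)) = 0" "l (U' (z, t) (0, 1)) = 0" if "t < - T" for t
    proof -
      have "norm z > T \<or> \<bar>t\<bar> > T" using that by auto
      from U0[OF this] show "l (U (z, t)) = 0" "l (U' (z, t) (0, 1)) = 0"
        using linear_0[OF bounded_linear.linear[OF l]] by simp_all
    qed
  qed
  have bint: "integrable lborel (\<lambda>t. below (w z) t * k (z, t))"
    if k: "continuous_on UNIV k" "\<And>p. p \<notin> cball 0 T \<times> cball 0 T \<Longrightarrow> k p = 0" for k :: "'a \<times> real \<Rightarrow> real" and z
  proof -
    have kc: "continuous_on UNIV (\<lambda>t. k (z, t))"
      by (rule continuous_on_compose2[OF k(1)]) (auto intro: continuous_intros)
    have "integrable lborel (\<lambda>t. k (z, t))"
      by (rule integrable_compact_support(2)[OF kc bounded_cball[of 0 T]]) (use k(2) in auto)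
    then show ?thesis
    proof (rule Bochner_Integration.integrable_bound)
      have [measurable]: "(\<lambda>t. k (z, t)) \<in> borel_measurable borel" by (rule borel_measurable_continuous_onI[OF kc])
      show "(\<lambda>t. below (w z) t * k (z, t)) \<in> borel_measurable lborel" by measurable
      show "AE t in lborel. norm (below (w z) t * k (z, t)) \<le> norm (k (z, t))"
        by (rule AE_I2) (simp add: below_def)
    qed
  qed
  have DH0: "DH p = 0" if "p \<notin> cball 0 T \<times> cball 0 T" for p
    using U0(2)[of "fst p" "snd p"] that by (cases p) (auto simp: DH_def not_le)
  have bl: "bounded_linear (\<lambda>q. w' z (fst q))" "bounded_linear snd" for z
    using bounded_linear_compose[OF has_derivative_bounded_linear[OF C1_deriv_D(1)[OF w]] bounded_linear_fst]
    by (auto intro: bounded_linear_snd)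
  have U1c: "continuous_on UNIV (\<lambda>p. w' z (fst (U' p (0, 1))))" for z
    by (rule continuous_on_compose2[OF linear_continuous_on[OF bl(1)] U'c subset_UNIV])
  have U2c: "continuous_on UNIV (\<lambda>p. snd (U' p (0, 1)))" by (rule continuous_on_snd[OF U'c])
  have U'0: "U' p h = 0" if "p \<notin> cball 0 T \<times> cball 0 T" for p h
    using U0(2)[of "fst p" "snd p"] that by (cases p) (auto simp: not_le)
  have U10: "w' z (fst (U' p (0, 1))) = 0" if "p \<notin> cball 0 T \<times> cball 0 T" for p z
    using linear_0[OF C1_deriv_D(4)[OF w]] by (simp add: U'0[OF that])
  have U20: "snd (U' p (0, 1)) = 0" if "p \<notin> cball 0 T \<times> cball 0 T" for p
    by (simp add: U'0[OF that])
  define D where "D z = (\<integral>t. below (w z) t * DH (z, t) \<partial>lborel)" for z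
  \<comment> \<open>Substituting t = s + w z undoes the shear. The slope term is a t-derivative, so
    it integrates to its value on the graph.\<close>
  have Kz: "(\<integral>s. K z s \<partial>lborel) = D z + w' z (fst (U (z, w z)))" for z
  proof -
    have "(\<integral>s. K z s \<partial>lborel) = (\<integral>s. below (w z) (s + w z) * \<kappa> (z, s + w z) \<partial>lborel)"
      by (intro Bochner_Integration.integral_cong) (auto simp: K_def sh_def below_def)
    also have "\<dots> = (\<integral>t. below (w z) t * \<kappa> (z, t) \<partial>lborel)"
    proof (rule integral_lborel_translation[of "\<lambda>t. below (w z) t * \<kappa> (z, t)"])
      have "continuous_on UNIV (\<lambda>t. \<kappa> (z, t))"
        by (rule continuous_on_compose2[OF \<kappa>c]) (auto intro: continuous_intros)
      then show "(\<lambda>t. below (w z) t * \<kappa> (z, t)) \<in> borel_measurable borel"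
        by (intro borel_measurable_times below_borel borel_measurable_continuous_onI)
    qed
    also have "\<dots> = (\<integral>t. below (w z) t * DH (z, t) + below (w z) t * w' z (fst (U' (z, t) (0, 1))) \<partial>lborel)"
      by (simp add: \<kappa>_def w'exp[of z "fst _"] distrib_left)
    also have "\<dots> = D z + w' z (fst (U (z, w z)))"
      unfolding D_def ftc[OF bl(1), symmetric]
      by (rule Bochner_Integration.integral_add[OF bint[OF DHc DH0] bint[OF U1c U10]])
    finally show ?thesis .
  qed
  have Wd: "C1_deriv (\<lambda>z. fst (U (z, w z))) (\<lambda>z h. fst (U' (z, w z) (h, w' z h)))"
    using C1_deriv_compose[OF C1_deriv_linear[OF bounded_linear_fst] C1_deriv_compose[OF U
          C1_deriv_Pair[OF C1_deriv_linear[OF bounded_linear_ident] w]]] by simp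
  have sW: "fst (U (z, w z)) = 0" "snd (U (z, w z)) = 0" if "z \<notin> cball 0 T" for z
    using U0(1)[of z "w z"] that by auto
  have Wc: "continuous_on UNIV (\<lambda>z. U (z, w z))"
    by (rule continuous_on_compose2[OF Uc]) (auto intro!: continuous_intros wc)
  have isn: "integrable lborel (\<lambda>z. snd (U (z, w z)))"
    by (rule integrable_compact_support(2)[OF continuous_on_snd[OF Wc] bounded_cball sW(2)])
  have ext: "ediv (\<lambda>z. w z *\<^sub>R fst (U (z, w z))) z = w z * ediv (\<lambda>z. fst (U (z, w z))) z + w' z (fst (U (z, w z)))" for z
    by (rule ediv_scaleR_fun[OF w Wd])
  have sub: "{z. fst (U (z, w z)) \<noteq> 0} \<subseteq> cball 0 T" using sW(1) by blast
  have ediv0: "ediv (\<lambda>z. fst (U (z, w z))) z = 0" if "z \<notin> cball 0 T" for z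
    unfolding ediv_C1_deriv[OF Wd] using C1_deriv_outside(2)[OF Wd closed_cball sub that] by simp
  have iwe: "integrable lborel (\<lambda>z. w z * ediv (\<lambda>z. fst (U (z, w z))) z)"
    by (rule integrable_compact_support(2)[OF _ bounded_cball[of 0 T]])
       (auto intro!: continuous_intros wc continuous_on_ediv[OF Wd] simp: ediv0)
  have w'W: "continuous_on UNIV (\<lambda>z. w' z (fst (U (z, w z))))"
    unfolding w'exp[of _ "fst _"] by (intro continuous_intros C1_deriv_D(2)[OF w] Wc)
  have iw': "integrable lborel (\<lambda>z. w' z (fst (U (z, w z))))"
    by (rule integrable_compact_support(2)[OF w'W bounded_cball[of 0 T]])
       (auto simp: sW(1) linear_0[OF C1_deriv_D(4)[OF w]])
  \<comment> \<open>Integration by parts: the field \<open>w z *\<^sub>R fst (U (z, w z))\<close>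
    has bounded support even where w does not.\<close>
  have wWd: "C1_deriv (\<lambda>z. w z *\<^sub>R fst (U (z, w z))) (\<lambda>z h. w z *\<^sub>R fst (U' (z, w z) (h, w' z h)) + w' z h *\<^sub>R fst (U (z, w z)))"
    by (rule C1_deriv_scaleR[OF w Wd])
  have "bounded {z. w z *\<^sub>R fst (U (z, w z)) \<noteq> 0}"
    by (rule bounded_subset[OF bounded_cball[of 0 T]]) (use sub in auto)
  from integral_ediv_zero[OF wWd this]
  have "0 = (\<integral>z. ediv (\<lambda>z. w z *\<^sub>R fst (U (z, w z))) z \<partial>lborel)"
    by (simp add: integral_lebesgue_lborel[OF borel_measurable_continuous_onI[OF continuous_on_ediv[OF wWd]]])
  also have "\<dots> = (\<integral>z. w z * ediv (\<lambda>z. fst (U (z, w z))) z \<partial>lborel) + (\<integral>z. w' z (fst (U (z, w z))) \<partial>lborel)"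
    unfolding ext by (rule Bochner_Integration.integral_add[OF iwe iw'])
  finally have parts: "(\<integral>z. w' z (fst (U (z, w z))) \<partial>lborel) = - (\<integral>z. w z * ediv (\<lambda>z. fst (U (z, w z))) z \<partial>lborel)"
    by simp
  have iD: "integrable lborel D"
  proof -
    have "integrable lborel (\<lambda>z. (\<integral>s. K z s \<partial>lborel) - w' z (fst (U (z, w z))))"
      using lborel_pair.integrable_fst[OF Ki] iw' by (intro Bochner_Integration.integrable_diff) auto
    then show ?thesis by (simp add: Kz)
  qed
  have Dint: "(\<integral>z. D z \<partial>lborel) = (\<integral>z. w z * ediv (\<lambda>z. fst (U (z, w z))) z \<partial>lborel)"
    using zero parts unfolding Kz by (subst (asm) Bochner_Integration.integral_add[OF iD iw']) simp
  have ebelow: "integrable lebesgue (\<lambda>p. below (w (fst p)) (snd p) * ediv U p)"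
  proof -
    have em: "(\<lambda>p. below (w (fst p)) (snd p) * ediv U p) \<in> borel_measurable lebesgue"
      by (intro borel_measurable_times measurable_below continuous_imp_lebesgue_measurable wc continuous_on_ediv[OF U])
    have ez: "ediv U p = 0" if "p \<notin> cball 0 T" for p
      unfolding ediv_C1_deriv[OF U] using C1_deriv_outside(2)[OF U closed_cball T that] by simp
    obtain C where C: "\<And>x. norm (ediv U x) \<le> C"
      using bounded_range_compact_support[OF continuous_on_ediv[OF U] bounded_cball ez] by blast
    have "norm (below (w (fst p)) (snd p) * ediv U p) \<le> C" for p
      using C[of p] norm_ge_zero[of "ediv U p"] by (auto simp: below_def simp del: norm_ge_zero)
    then show ?thesis using ez by (intro integrable_bounded_support[OF em bounded_cball[of 0 T]]) auto
  qed
  have inner: "(\<integral>t. below (w z) t * ediv U (z, t) \<partial>lebesgue) = D z + snd (U (z, w z))" for z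
  proof -
    have ec: "continuous_on UNIV (\<lambda>t. ediv U (z, t))"
      by (rule continuous_on_compose2[OF continuous_on_ediv[OF U]]) (auto intro: continuous_intros)
    have "(\<integral>t. below (w z) t * ediv U (z, t) \<partial>lebesgue) = (\<integral>t. below (w z) t * ediv U (z, t) \<partial>lborel)"
      by (intro integral_lebesgue_lborel borel_measurable_times below_borel borel_measurable_continuous_onI ec)
    also have "\<dots> = (\<integral>t. below (w z) t * DH (z, t) + below (w z) t * snd (U' (z, t) (0, 1)) \<partial>lborel)"
      by (simp add: ediv_prod[OF U] DH_def distrib_left)
    also have "\<dots> = D z + snd (U (z, w z))"
      unfolding D_def ftc[OF bl(2), symmetric]
      by (rule Bochner_Integration.integral_add[OF bint[OF DHc DH0] bint[OF U2c U20]])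
    finally show ?thesis .
  qed
  have "(\<integral>p. below (w (fst p)) (snd p) * ediv U p \<partial>lebesgue) = (\<integral>z. D z + snd (U (z, w z)) \<partial>lebesgue)"
    using lebesgue_Fubini(3)[OF ebelow] by (simp add: inner)
  also have "\<dots> = (\<integral>z. D z + snd (U (z, w z)) \<partial>lborel)"
    using borel_measurable_integrable[OF iD] borel_measurable_integrable[OF isn]
    by (intro integral_lebesgue_lborel) auto
  also have "\<dots> = (\<integral>z. w z * ediv (\<lambda>z. fst (U (z, w z))) z + snd (U (z, w z)) \<partial>lborel)"
    using iD isn iwe Dint by simp
  also have "\<dots> = (\<integral>z. w z * ediv (\<lambda>z. fst (U (z, w z))) z + snd (U (z, w z)) \<partial>lebesgue)"
    using borel_measurable_integrable[OF iwe] borel_measurable_integrable[OF isn]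
    by (intro integral_lebesgue_lborel[symmetric]) auto
  finally show ?thesis .
qed

section \<open>The Heisenberg norm\<close>

text \<open>The coefficients of w in the frame X, Y, eps T at p: \<open>fst w\<close> holds those of
  X and Y, and subtracting the vertical parts that X and Y carry leaves \<open>eps\<close> times the
  last one. The Heisenberg norm becomes a Euclidean norm after a linear map.\<close>

definition heis_frame :: "real \<Rightarrow> 'n::finite heis \<Rightarrow> 'n heis \<Rightarrow> 'n heis" where
  "heis_frame eps p w =
    (fst w, (snd w - (fst (fst w) \<bullet> snd (fst p) - snd (fst w) \<bullet> fst (fst p))) / eps)"

lemma heis_norm_frame: "heis_norm eps p w = norm (heis_frame eps p w)"
proof -
  obtain wx wy wt where w: "w = ((wx, wy), wt)" by (metis prod.collapse)
  show ?thesis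
    by (simp add: heis_norm_def heis_frame_def w norm_Pair Let_def inner_vec_def sum_subtractf power_divide)
qed

lemma bounded_linear_heis_frame: "bounded_linear (heis_frame eps p)"
  unfolding heis_frame_def
  by (intro bounded_linear_Pair bounded_linear_fst bounded_linear_intros)
     (auto simp: divide_inverse intro!: bounded_linear_intros)

text \<open>Vertical invariance of the metric allows the trace of a field on a graph to be read as a
  field on the base, and a base field to be lifted to all heights.\<close>

lemma heis_norm_fst: "fst p = fst q \<Longrightarrow> heis_norm eps p w = heis_norm eps q w"
  by (simp add: heis_norm_frame heis_frame_def)

lemma heis_norm_nonneg: "heis_norm eps p w \<ge> 0"
  by (simp add: heis_norm_frame)

lemma heis_norm_0: "heis_norm eps p 0 = 0"
  using linear_0[OF bounded_linear.linear[OF bounded_linear_heis_frame]] by (simp add: heis_norm_frame)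

lemma heis_norm_add: "heis_norm eps p (v + w) \<le> heis_norm eps p v + heis_norm eps p w"
  unfolding heis_norm_frame linear_add[OF bounded_linear.linear[OF bounded_linear_heis_frame]]
  by (rule norm_triangle_ineq)

lemma heis_norm_scaleR: "heis_norm eps p (c *\<^sub>R w) = \<bar>c\<bar> * heis_norm eps p w"
  unfolding heis_norm_frame linear_cmul[OF bounded_linear.linear[OF bounded_linear_heis_frame]] by simp

lemma heis_norm_convex:
  assumes "0 \<le> c" "c \<le> 1" "heis_norm eps p v \<le> 1" "heis_norm eps p w \<le> 1"
  shows "heis_norm eps p (c *\<^sub>R v + (1 - c) *\<^sub>R w) \<le> 1"
proof -
  have "heis_norm eps p (c *\<^sub>R v + (1 - c) *\<^sub>R w) \<le> c * heis_norm eps p v + (1 - c) * heis_norm eps p w"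
    using heis_norm_add[of eps p "c *\<^sub>R v" "(1 - c) *\<^sub>R w"] assms by (simp add: heis_norm_scaleR)
  also have "\<dots> \<le> c * 1 + (1 - c) * 1" using assms by (intro add_mono mult_left_mono) auto
  finally show ?thesis by simp
qed

lemma heis_norm_scale_le:
  assumes "0 \<le> c" "c \<le> 1" "heis_norm eps p v \<le> 1"
  shows "heis_norm eps p (c *\<^sub>R v) \<le> 1"
  using heis_norm_convex[OF assms, of 0] by (simp add: heis_norm_0)

lemma norm_fst_le_heis_norm: "norm (fst w) \<le> heis_norm eps p w"
  unfolding heis_norm_frame heis_frame_def by (rule norm_fst_le)

text \<open>Cauchy-Schwarz after rotating b by the isometry (x, y) \<mapsto> (y, -x).\<close>

lemma symplectic_le:
  fixes a b :: "'a::real_inner \<times> 'a"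
  shows "\<bar>fst a \<bullet> snd b - snd a \<bullet> fst b\<bar> \<le> norm a * norm b"
proof -
  have "fst a \<bullet> snd b - snd a \<bullet> fst b = a \<bullet> (snd b, - fst b)" by (simp add: inner_prod_def)
  moreover have "norm (snd b, - fst b) = norm b" by (cases b) (simp add: norm_Pair add.commute)
  ultimately show ?thesis using Cauchy_Schwarz_ineq2[of a "(snd b, - fst b)"] by simp
qed

text \<open>The vertical component is \<open>eps\<close> times the last frame coefficient plus the
  symplectic product of \<open>fst w\<close> with the base point. Over a bounded base this bounds
  admissible fields vertically.\<close>

lemma abs_snd_le_heis_norm:
  assumes "eps \<noteq> 0"
  shows "\<bar>snd w\<bar> \<le> heis_norm eps p w * (\<bar>eps\<bar> + norm (fst p))"
proof -
  define c where "c = fst (fst w) \<bullet> snd (fst p) - snd (fst w) \<bullet> fst (fst p)"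
  have "\<bar>(snd w - c) / eps\<bar> \<le> heis_norm eps p w"
    using norm_snd_le[of "(snd w - c) / eps" "fst w"] by (simp add: heis_norm_frame heis_frame_def c_def)
  then have 1: "\<bar>snd w - c\<bar> \<le> heis_norm eps p w * \<bar>eps\<bar>" using assms by (simp add: field_simps)
  have "\<bar>c\<bar> \<le> norm (fst w) * norm (fst p)" unfolding c_def by (rule symplectic_le)
  also have "\<dots> \<le> heis_norm eps p w * norm (fst p)" by (intro mult_right_mono norm_fst_le_heis_norm) simp
  finally show ?thesis using 1 unfolding distrib_left by linarith
qed

text \<open>Moving the base point changes only the last frame coefficient, by the symplectic product
  of \<open>fst w\<close> with the displacement, divided by \<open>eps\<close>; the horizontal part
  of the norm controls it.\<close>

lemma heis_norm_change_base:
  assumes "eps \<noteq> 0"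
  shows "heis_norm eps p w \<le> (1 + norm (fst p - fst q) / \<bar>eps\<bar>) * heis_norm eps q w"
proof -
  define c where "c = fst (fst w) \<bullet> snd (fst p - fst q) - snd (fst w) \<bullet> fst (fst p - fst q)"
  have "heis_frame eps p w = heis_frame eps q w + (0, - c / eps)"
    by (simp add: heis_frame_def c_def inner_diff_right diff_divide_distrib add_divide_distrib)
  then have "heis_norm eps p w \<le> heis_norm eps q w + norm ((0, - c / eps) :: 'a heis)"
    unfolding heis_norm_frame using norm_triangle_ineq by metis
  also have "norm ((0, - c / eps) :: 'a heis) = \<bar>c\<bar> / \<bar>eps\<bar>" by (simp add: norm_Pair)
  also have "\<bar>c\<bar> \<le> norm (fst w) * norm (fst p - fst q)" unfolding c_def by (rule symplectic_le)
  also have "\<dots> \<le> heis_norm eps q w * norm (fst p - fst q)"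
    by (intro mult_right_mono norm_fst_le_heis_norm) simp
  finally show ?thesis using assms by (simp add: algebra_simps divide_right_mono)
qed

section \<open>Compact containment and compactly supported fields\<close>

lemma cc_subset:
  fixes S S' T :: "'a::euclidean_space set"
  shows "cc S' T \<Longrightarrow> S \<subseteq> S' \<Longrightarrow> cc S T"
  unfolding cc_def compact_closure using bounded_subset[of S' S] closure_mono[of S S'] by auto

lemma cc_Un: "cc S T \<Longrightarrow> cc S' T \<Longrightarrow> cc (S \<union> S') T"
  by (auto simp: cc_def closure_Un compact_Un)

lemma cc_mono: "cc S T \<Longrightarrow> T \<subseteq> T' \<Longrightarrow> cc S T'"
  by (auto simp: cc_def)

lemma cc_compactI:
  fixes S K T :: "'a::euclidean_space set"
  shows "compact K \<Longrightarrow> S \<subseteq> K \<Longrightarrow> K \<subseteq> T \<Longrightarrow> cc S T"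
  by (rule cc_subset[of K]) (auto simp: cc_def compact_imp_closed closure_closed)

lemma C1cE:
  assumes "C1c A U"
  obtains U' where "C1_deriv U U'" "cc {p. U p \<noteq> 0} A" "compact (closure {p. U p \<noteq> 0})"
    "bounded {p. U p \<noteq> 0}"
  using assms unfolding C1c_iff cc_def by (auto simp: compact_closure)

lemma C1cI: "C1_deriv U U' \<Longrightarrow> cc {p. U p \<noteq> 0} A \<Longrightarrow> C1c A U"
  by (auto simp: C1c_iff)

lemma C1c_0: "C1c A (\<lambda>p. 0)"
  by (rule C1cI[OF C1_deriv_const]) (simp add: cc_def)

lemma C1c_ediv_bounded:
  assumes "C1c A U"
  obtains C where "C \<ge> 0" "\<And>p. \<bar>ediv U p\<bar> \<le> C"
proof -
  obtain U' where U: "C1_deriv U U'" "bounded {p. U p \<noteq> 0}" using assms by (rule C1cE)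
  have "\<exists>C\<ge>0. \<forall>p. norm (ediv U p) \<le> C"
    using bounded_range_compact_support[OF continuous_on_ediv[OF U(1)] bounded_closure[OF U(2)] ediv_support[OF U(1)]]
    by blast
  then show ?thesis using that by auto
qed

lemma C1c_ediv_zero:
  assumes "C1c A U" "p \<notin> A" shows "ediv U p = 0"
proof -
  obtain U' where U: "C1_deriv U U'" "cc {p. U p \<noteq> 0} A" using assms(1) by (rule C1cE)
  then have "p \<notin> closure {p. U p \<noteq> 0}" using assms(2) unfolding cc_def by blast
  then show ?thesis by (rule ediv_support[OF U(1)])
qed

lemma C1c_ediv_continuous: "C1c A U \<Longrightarrow> continuous_on UNIV (ediv U)"
  using C1cE continuous_on_ediv by blast

lemma C1c_ediv_integrable:
  assumes "C1c A U" and h: "h \<in> borel_measurable lebesgue" "\<And>p. \<bar>h p\<bar> \<le> B"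
  shows "integrable lebesgue (\<lambda>p. h p * ediv U p)"
proof -
  obtain U' where U: "C1_deriv U U'" "bounded {p. U p \<noteq> 0}" using assms(1) by (rule C1cE)
  obtain C where C: "C \<ge> 0" "\<And>p. \<bar>ediv U p\<bar> \<le> C" using C1c_ediv_bounded[OF assms(1)] by blast
  show ?thesis
  proof (rule integrable_bounded_support[OF _ bounded_closure[OF U(2)]])
    show "(\<lambda>p. h p * ediv U p) \<in> borel_measurable lebesgue"
      by (intro borel_measurable_times h continuous_imp_lebesgue_measurable continuous_on_ediv[OF U(1)])
    show "h p * ediv U p = 0" if "p \<notin> closure {p. U p \<noteq> 0}" for p
      using ediv_support[OF U(1) that] by simp
    have "0 \<le> B" using h(2)[of undefined] by linarith
    then show "norm (h p * ediv U p) \<le> B * C" for p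
      unfolding real_norm_def abs_mult using h(2)[of p] C(2)[of p] by (intro mult_mono) auto
  qed
qed

lemma C1c_ediv_set_integrable:
  assumes "C1c A U" "E \<in> sets lebesgue"
  shows "integrable lebesgue (\<lambda>p. indicator E p * ediv U p)"
  using assms by (intro C1c_ediv_integrable[where B=1]) (auto simp: indicator_def)

lemma C1c_ediv_integrable_mult:
  assumes \<phi>: "C1c A \<phi>" and v: "integrable lebesgue (\<lambda>z. indicator V z * v z)"
  shows "integrable lebesgue (\<lambda>z. indicator V z * (v z * ediv \<phi> z))"
proof -
  obtain C where C: "C \<ge> 0" "\<And>z. \<bar>ediv \<phi> z\<bar> \<le> C" using C1c_ediv_bounded[OF \<phi>] by blast
  have em: "ediv \<phi> \<in> borel_measurable lebesgue"
    by (rule continuous_imp_lebesgue_measurable[OF C1c_ediv_continuous[OF \<phi>]])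
  show ?thesis
  proof (rule Bochner_Integration.integrable_bound[OF integrable_mult_left[OF v, of C]])
    show "(\<lambda>z. indicator V z * (v z * ediv \<phi> z)) \<in> borel_measurable lebesgue"
      using borel_measurable_times[OF borel_measurable_integrable[OF v] em] by (simp add: mult.assoc)
    show "AE z in lebesgue. norm (indicator V z * (v z * ediv \<phi> z)) \<le> norm (indicator V z * v z * C)"
    proof (rule AE_I2)
      fix z
      have "\<bar>indicator V z * v z\<bar> * \<bar>ediv \<phi> z\<bar> \<le> \<bar>indicator V z * v z\<bar> * C"
        using C(2) by (intro mult_left_mono) auto
      then show "norm (indicator V z * (v z * ediv \<phi> z)) \<le> norm (indicator V z * v z * C)"
        using C(1) by (simp add: abs_mult mult.assoc)
    qed
  qed
qed

lemma LINT_indicator: "(LINT p:E|M. f p) = (\<integral>p. indicator E p * f p \<partial>M)" for f :: "'a \<Rightarrow> real"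
  by (simp add: set_lebesgue_integral_def)

section \<open>Perimeter\<close>

definition admissible :: "real \<Rightarrow> 'n::finite heis set \<Rightarrow> ('n heis \<Rightarrow> 'n heis) \<Rightarrow> bool" where
  "admissible eps A U \<longleftrightarrow> C1c A U \<and> (\<forall>p. heis_norm eps p (U p) \<le> 1)"

lemma Peps_eq: "Peps eps E A = (SUP U\<in>{U. admissible eps A U}. ereal (\<integral>p. indicator E p * ediv U p \<partial>lebesgue))"
  by (simp add: Peps_def admissible_def LINT_indicator)

lemma Peps_upper: "admissible eps A U \<Longrightarrow> ereal (\<integral>p. indicator E p * ediv U p \<partial>lebesgue) \<le> Peps eps E A"
  unfolding Peps_eq by (rule SUP_upper) simp

lemma Peps_least:
  "(\<And>U. admissible eps A U \<Longrightarrow> ereal (\<integral>p. indicator E p * ediv U p \<partial>lebesgue) \<le> c) \<Longrightarrow> Peps eps E A \<le> c"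
  unfolding Peps_eq by (rule SUP_least) simp

lemma admissible_0: "admissible eps A (\<lambda>p. 0)"
  by (simp add: admissible_def C1c_0 heis_norm_0)

lemma ediv_const: "ediv (\<lambda>p. c) p = 0"
  by (simp add: ediv_C1_deriv[OF C1_deriv_const])

lemma Peps_nonneg: "0 \<le> Peps eps E A"
  using Peps_upper[OF admissible_0, where E=E and eps=eps and A=A] by (simp add: ediv_const zero_ereal_def)

lemma admissible_mono: "admissible eps A U \<Longrightarrow> A \<subseteq> B \<Longrightarrow> admissible eps B U"
  by (auto simp: admissible_def C1c_iff intro: cc_mono)

lemma Peps_mono: "A \<subseteq> B \<Longrightarrow> Peps eps E A \<le> Peps eps E B"
  by (rule Peps_least, rule Peps_upper, rule admissible_mono)

text \<open>Exchanging sum and supremum in \<open>ereal\<close> could meet a sum of opposite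
  infinities; the last two assumptions exclude this.\<close>

lemma SUP_add_le_ereal:
  fixes f :: "'a \<Rightarrow> ereal" and g :: "'b \<Rightarrow> ereal"
  assumes "I \<noteq> {}" "J \<noteq> {}" "\<And>i j. i \<in> I \<Longrightarrow> j \<in> J \<Longrightarrow> f i + g j \<le> c"
    "\<And>i. i \<in> I \<Longrightarrow> f i \<noteq> - \<infinity>" "\<And>j. j \<in> J \<Longrightarrow> g j \<noteq> - \<infinity>"
  shows "(SUP i\<in>I. f i) + (SUP j\<in>J. g j) \<le> c"
proof -
  have g: "(SUP j\<in>J. g j) \<noteq> - \<infinity>"
  proof -
    obtain j where "j \<in> J" using assms(2) by blast
    then have "g j \<le> (SUP j\<in>J. g j)" by (rule SUP_upper)
    then show ?thesis using assms(5)[OF \<open>j \<in> J\<close>] by auto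
  qed
  have "(SUP i\<in>I. f i) + (SUP j\<in>J. g j) = (SUP i\<in>I. f i + (SUP j\<in>J. g j))"
    by (rule SUP_ereal_add_left[OF assms(1) g, symmetric])
  also have "\<dots> \<le> c"
  proof (rule SUP_least)
    fix i assume i: "i \<in> I"
    have "f i + (SUP j\<in>J. g j) = (SUP j\<in>J. f i + g j)"
      by (rule SUP_ereal_add_right[OF assms(2) assms(4)[OF i], symmetric])
    also have "\<dots> \<le> c" by (intro SUP_least assms(3) i)
    finally show "f i + (SUP j\<in>J. g j) \<le> c" .
  qed
  finally show ?thesis .
qed

text \<open>Additivity of the perimeter measure enters only through this exchange inequality: gluing
  two competing fields with a cutoff that equals 1 where the sets differ preserves the sum of
  the two divergence integrals.\<close>

lemma Peps_exchange:
  fixes E F A B :: "'n::finite heis set"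
  assumes E: "E \<in> sets lebesgue" and F: "F \<in> sets lebesgue" and A: "open A" "A \<subseteq> B"
    and EF: "cc ((E - F) \<union> (F - E)) A"
  shows "Peps eps F B + Peps eps E A \<le> Peps eps E B + Peps eps F A"
proof -
  define K where "K = closure ((E - F) \<union> (F - E))"
  have K: "compact K" "K \<subseteq> A" using EF by (auto simp: K_def cc_def)
  obtain \<theta> :: "'n heis \<Rightarrow> real" where \<theta>: "C1c A \<theta>" "\<And>p. 0 \<le> \<theta> p" "\<And>p. \<theta> p \<le> 1" "\<And>p. p \<in> K \<Longrightarrow> \<theta> p = 1"
    using cutoff_exists[OF K(1) A(1) K(2)] by blast
  obtain \<theta>' where t: "C1_deriv \<theta> \<theta>'" "cc {p. \<theta> p \<noteq> 0} A" using \<theta>(1) by (rule C1cE)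
  \<comment> \<open>\<theta> is known to be 1 on K, not near it. But 1 is its maximum, so its
    derivative vanishes on K, which is enough for the divergence of
    \<open>(1 - \<theta> p) *\<^sub>R X p\<close> to vanish there.\<close>
  have \<theta>'0: "\<theta>' p = (\<lambda>h. 0)" if "p \<in> K" for p
    by (rule differential_zero_maxmin[of p UNIV \<theta>]) (use \<theta>(3,4) that C1_deriv_D(1)[OF t(1)] in auto)
  have t1: "C1_deriv (\<lambda>p. 1 - \<theta> p) (\<lambda>p h. 0 - \<theta>' p h)" by (rule C1_deriv_diff[OF C1_deriv_const t(1)])
  have "ereal (\<integral>p. indicator F p * ediv U p \<partial>lebesgue) + ereal (\<integral>p. indicator E p * ediv V p \<partial>lebesgue)
      \<le> Peps eps E B + Peps eps F A" if U: "admissible eps B U" and V: "admissible eps A V" for U V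
  proof -
    obtain U' where u: "C1_deriv U U'" "cc {p. U p \<noteq> 0} B" using U unfolding admissible_def by (blast elim: C1cE)
    obtain V' where v: "C1_deriv V V'" "cc {p. V p \<noteq> 0} A" using V unfolding admissible_def by (blast elim: C1cE)
    note d = C1_deriv_scaleR[OF t(1) u(1)] C1_deriv_scaleR[OF t1 u(1)] C1_deriv_scaleR[OF t(1) v(1)] C1_deriv_scaleR[OF t1 v(1)]
    have c: "C1c B (\<lambda>p. \<theta> p *\<^sub>R U p)" "C1c B (\<lambda>p. (1 - \<theta> p) *\<^sub>R U p)"
      "C1c A (\<lambda>p. \<theta> p *\<^sub>R V p)" "C1c A (\<lambda>p. (1 - \<theta> p) *\<^sub>R V p)"
      by (rule C1cI[OF d(1)] C1cI[OF d(2)] C1cI[OF d(3)] C1cI[OF d(4)],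
          (rule cc_subset[OF u(2)] cc_subset[OF v(2)]), force)+
    \<comment> \<open>On K each field is exchanged for the other: W1 will be tested against E on B,
      W2 against F on A. Convexity of the norm keeps both admissible, and W2 is supported in A
      because \<theta> and V are.\<close>
    define W1 where "W1 p = \<theta> p *\<^sub>R V p + (1 - \<theta> p) *\<^sub>R U p" for p
    define W2 where "W2 p = \<theta> p *\<^sub>R U p + (1 - \<theta> p) *\<^sub>R V p" for p
    have "C1c B W1" unfolding W1_def
      by (rule C1cI[OF C1_deriv_add[OF d(3) d(2)]], rule cc_subset[OF cc_Un[OF cc_mono[OF v(2) A(2)] u(2)]]) auto
    then have W1: "admissible eps B W1"
      using heis_norm_convex \<theta>(2,3) U V unfolding admissible_def W1_def by blast
    have "C1c A W2" unfolding W2_def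
      by (rule C1cI[OF C1_deriv_add[OF d(1) d(4)]], rule cc_subset[OF cc_Un[OF t(2) v(2)]]) auto
    then have W2: "admissible eps A W2"
      using heis_norm_convex \<theta>(2,3) U V unfolding admissible_def W2_def by blast
    \<comment> \<open>On K the divergence vanishes, off K the two sets coincide; so this part of a
      field does not see which set it is tested against.\<close>
    have same: "(\<integral>p. indicator E p * ediv (\<lambda>p. (1 - \<theta> p) *\<^sub>R X p) p \<partial>lebesgue) =
        (\<integral>p. indicator F p * ediv (\<lambda>p. (1 - \<theta> p) *\<^sub>R X p) p \<partial>lebesgue)" if X: "C1_deriv X X'" for X X'
    proof (rule Bochner_Integration.integral_cong[OF refl])
      fix p
      show "indicator E p * ediv (\<lambda>p. (1 - \<theta> p) *\<^sub>R X p) p = indicator F p * ediv (\<lambda>p. (1 - \<theta> p) *\<^sub>R X p) p"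
      proof (cases "p \<in> K")
        case True
        then show ?thesis by (simp add: ediv_scaleR_fun[OF t1 X] \<theta>(4) \<theta>'0)
      next
        case False
        then have "p \<notin> (E - F) \<union> (F - E)" 
          unfolding K_def using closure_subset[of "(E - F) \<union> (F - E)"] by blast
        then show ?thesis by (auto simp: indicator_def)
      qed
    qed
    have split: "(\<integral>p. indicator G p * ediv (\<lambda>p. X p + Y p) p \<partial>lebesgue) =
        (\<integral>p. indicator G p * ediv X p \<partial>lebesgue) + (\<integral>p. indicator G p * ediv Y p \<partial>lebesgue)"
      if "C1c B' X" "C1c B' Y" "G \<in> sets lebesgue" for G X Y and B' :: "'n heis set"
    proof -
      obtain X' Y' where XY: "C1_deriv X X'" "C1_deriv Y Y'" 
        using \<open>C1c B' X\<close> \<open>C1c B' Y\<close> unfolding C1c_iff by blast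
      show ?thesis unfolding ediv_add[OF XY] distrib_left
        by (intro Bochner_Integration.integral_add C1c_ediv_set_integrable[OF that(1) that(3)] C1c_ediv_set_integrable[OF that(2) that(3)])
    qed
    have eU: "U = (\<lambda>p. \<theta> p *\<^sub>R U p + (1 - \<theta> p) *\<^sub>R U p)" and eV: "V = (\<lambda>p. \<theta> p *\<^sub>R V p + (1 - \<theta> p) *\<^sub>R V p)"
      by (auto simp: scaleR_left_distrib[symmetric])
    have cB: "C1c B (\<lambda>p. \<theta> p *\<^sub>R V p)" "C1c B (\<lambda>p. (1 - \<theta> p) *\<^sub>R V p)"
      using c(3,4) A(2) cc_mono unfolding C1c_iff by blast+
    have "(\<integral>p. indicator F p * ediv U p \<partial>lebesgue) + (\<integral>p. indicator E p * ediv V p \<partial>lebesgue) =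
       (\<integral>p. indicator E p * ediv W1 p \<partial>lebesgue) + (\<integral>p. indicator F p * ediv W2 p \<partial>lebesgue)"
      using split[OF c(1,2) F] split[OF c(3,4) E] split[OF cB(1) c(2) E] split[OF c(1) cB(2) F]
        same[OF u(1)] same[OF v(1)]
      unfolding W1_def[abs_def] W2_def[abs_def] eU[symmetric] eV[symmetric] by simp
    then have "ereal (\<integral>p. indicator F p * ediv U p \<partial>lebesgue) + ereal (\<integral>p. indicator E p * ediv V p \<partial>lebesgue) =
      ereal (\<integral>p. indicator E p * ediv W1 p \<partial>lebesgue) + ereal (\<integral>p. indicator F p * ediv W2 p \<partial>lebesgue)" by simp
    also have "\<dots> \<le> Peps eps E B + Peps eps F A" by (intro add_mono Peps_upper W1 W2)
    finally show ?thesis .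
  qed
  moreover have "{U. admissible eps X U} \<noteq> {}" for X :: "'n heis set" using admissible_0 by blast
  ultimately show ?thesis
    unfolding Peps_eq[of eps F B] Peps_eq[of eps E A] by (intro SUP_add_le_ereal) auto
qed

section \<open>The perimeter of a subgraph\<close>

definition admissible_base :: "real \<Rightarrow> 'n::finite plane set \<Rightarrow> ('n plane \<Rightarrow> 'n heis) \<Rightarrow> bool" where
  "admissible_base eps V W \<longleftrightarrow> C1c V W \<and> (\<forall>z. heis_norm eps (z, 0) (W z) \<le> 1)"

text \<open>For smooth v, integrating by parts and maximizing over the frame coefficients of W gives
  the integral of \<open>sqrt (eps^2 + norm (Dv + X)^2)\<close> with X(x,y) = (-y,x). The dual form
  makes sense without a derivative of v.\<close>

definition graph_area :: "real \<Rightarrow> ('n::finite plane \<Rightarrow> real) \<Rightarrow> 'n plane set \<Rightarrow> ereal" where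
  "graph_area eps v V = (SUP W\<in>{W. admissible_base eps V W}.
     ereal (\<integral>z. indicator V z * (v z * ediv (\<lambda>z. fst (W z)) z + snd (W z)) \<partial>lebesgue))"

lemma graph_area_upper:
  "admissible_base eps V W \<Longrightarrow>
    ereal (\<integral>z. indicator V z * (v z * ediv (\<lambda>z. fst (W z)) z + snd (W z)) \<partial>lebesgue) \<le> graph_area eps v V"
  unfolding graph_area_def by (rule SUP_upper) simp

lemma graph_area_least:
  "(\<And>W. admissible_base eps V W \<Longrightarrow>
    ereal (\<integral>z. indicator V z * (v z * ediv (\<lambda>z. fst (W z)) z + snd (W z)) \<partial>lebesgue) \<le> c) \<Longrightarrow>
    graph_area eps v V \<le> c"
  unfolding graph_area_def by (rule SUP_least) simp

lemma graph_area_nonneg: "0 \<le> graph_area eps v V"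
proof -
  have "admissible_base eps V (\<lambda>z. 0)" by (simp add: admissible_base_def C1c_0 heis_norm_0)
  from graph_area_upper[OF this, of v] show ?thesis by (simp add: ediv_const zero_ereal_def)
qed

text \<open>This is the adjoint formula against the constant 1, which has no compact support; the
  cutoff \<theta>, equal to 1 wherever the mollified \<psi> lives, replaces it.\<close>

lemma integral_mollify:
  fixes \<psi> :: "'a::euclidean_space \<Rightarrow> real"
  assumes \<rho>: "mollifier d \<rho>" and \<psi>: "continuous_on UNIV \<psi>" "bounded S" "\<And>x. x \<notin> S \<Longrightarrow> \<psi> x = 0"
  shows "(\<integral>y. (\<integral>x. \<rho> x * \<psi> (y + x) \<partial>lborel) \<partial>lborel) = (\<integral>y. \<psi> y \<partial>lborel)"
proof -
  have i\<psi>: "integrable lborel \<psi>" by (rule integrable_compact_support(2)[OF \<psi>])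
  obtain R where R: "S \<subseteq> cball 0 R"
    using bounded_subset_ballD[OF \<psi>(2), of 0] ball_subset_cball subset_trans by metis
  obtain \<theta> :: "'a \<Rightarrow> real" where \<theta>: "C1c (ball 0 (R + \<bar>d\<bar> + 1)) \<theta>" "\<And>p. p \<in> cball 0 (R + \<bar>d\<bar>) \<Longrightarrow> \<theta> p = 1"
    by (rule cutoff_exists[of "cball (0::'a) (R + \<bar>d\<bar>)" "ball 0 (R + \<bar>d\<bar> + 1)"]) (auto simp: subset_iff)
  obtain \<theta>' where t: "C1_deriv \<theta> \<theta>'" "bounded {p. \<theta> p \<noteq> 0}" using \<theta>(1) by (rule C1cE)
  have m0: "\<rho> x * \<psi> (z + x) = 0" if "z \<notin> cball 0 (R + \<bar>d\<bar>)" for z x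
  proof (cases "norm x < d")
    case True
    have "norm z \<le> norm (z + x) + norm x" by (metis add_diff_cancel_right' norm_triangle_ineq4)
    then have "z + x \<notin> S" using that True R by auto
    then show ?thesis using \<psi>(3) by simp
  qed (simp add: mollifierD(3)[OF \<rho>])
  have m1: "\<rho> x * \<theta> (y + x) = \<rho> x" if "y \<in> S" for y x
  proof (cases "norm x < d")
    case True
    have "y \<in> cball 0 R" using that R by blast
    then have "norm (y + x) \<le> R + \<bar>d\<bar>" using norm_triangle_ineq[of y x] True by auto
    then show ?thesis using \<theta>(2) by simp
  qed (simp add: mollifierD(3)[OF \<rho>])
  have "(\<integral>y. (\<integral>x. \<rho> x * \<psi> (y + x) \<partial>lborel) \<partial>lborel) = (\<integral>z. mollify \<rho> \<psi> z * \<theta> z \<partial>lborel)"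
  proof (rule Bochner_Integration.integral_cong[OF refl])
    fix z
    show "(\<integral>x. \<rho> x * \<psi> (z + x) \<partial>lborel) = mollify \<rho> \<psi> z * \<theta> z"
      unfolding mollify_translated(1)[OF \<rho> i\<psi>]
      by (cases "z \<in> cball 0 (R + \<bar>d\<bar>)") (simp_all only: m0 \<theta>(2) integral_zero mult_1_right mult_zero_left not_False_eq_True)
  qed
  also have "\<dots> = (\<integral>y. \<psi> y * (\<integral>x. \<rho> x * \<theta> (y + x) \<partial>lborel) \<partial>lborel)"
    by (rule mollify_adjoint[OF \<rho> i\<psi> C1_deriv_D(5)[OF t(1)] t(2)]) simp
  also have "\<dots> = (\<integral>y. \<psi> y \<partial>lborel)"
  proof (rule Bochner_Integration.integral_cong[OF refl])
    fix y
    show "\<psi> y * (\<integral>x. \<rho> x * \<theta> (y + x) \<partial>lborel) = \<psi> y"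
      by (cases "y \<in> S") (simp_all only: m1 \<psi>(3) mollifierD(4)[OF \<rho>] mult_1_right mult_zero_left not_False_eq_True)
  qed
  finally show ?thesis .
qed

text \<open>Averaging a field over a small ball increases the Heisenberg norm only by a factor close
  to 1, because the frame depends on the base point in a Lipschitz way.\<close>

lemma heis_norm_average:
  fixes W :: "'n::finite plane \<Rightarrow> 'n heis"
  assumes eps: "eps \<noteq> 0" and \<rho>: "mollifier d \<rho>" and de: "d \<le> e"
    and W: "\<And>z. heis_norm eps (z, 0) (W z) \<le> 1"
    and i: "integrable lborel (\<lambda>x. \<rho> x *\<^sub>R W (z + x))"
  shows "heis_norm eps (z, 0) (\<integral>x. \<rho> x *\<^sub>R W (z + x) \<partial>lborel) \<le> 1 + e / \<bar>eps\<bar>"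
proof -
  let ?L = "heis_frame eps (z, 0)"
  have "?L (\<integral>x. \<rho> x *\<^sub>R W (z + x) \<partial>lborel) = (\<integral>x. ?L (\<rho> x *\<^sub>R W (z + x)) \<partial>lborel)"
    by (rule integral_bounded_linear[OF bounded_linear_heis_frame i, symmetric])
  then have "heis_norm eps (z, 0) (\<integral>x. \<rho> x *\<^sub>R W (z + x) \<partial>lborel) \<le> (\<integral>x. norm (?L (\<rho> x *\<^sub>R W (z + x))) \<partial>lborel)"
    unfolding heis_norm_frame by simp
  also have "\<dots> \<le> (\<integral>x. \<rho> x * (1 + e / \<bar>eps\<bar>) \<partial>lborel)"
  proof (rule integral_mono)
    show "integrable lborel (\<lambda>x. norm (?L (\<rho> x *\<^sub>R W (z + x))))"
      by (intro integrable_norm integrable_bounded_linear[OF bounded_linear_heis_frame i])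
    show "integrable lborel (\<lambda>x. \<rho> x * (1 + e / \<bar>eps\<bar>))" using mollifierD(6)[OF \<rho>] by simp
    fix x
    show "norm (?L (\<rho> x *\<^sub>R W (z + x))) \<le> \<rho> x * (1 + e / \<bar>eps\<bar>)"
    proof (cases "norm x < d")
      case True
      have "heis_norm eps (z, 0) (W (z + x)) \<le> (1 + norm x / \<bar>eps\<bar>) * heis_norm eps (z + x, 0) (W (z + x))"
        using heis_norm_change_base[OF eps, of "(z, 0)" "W (z + x)" "(z + x, 0)"] by simp
      also have "\<dots> \<le> (1 + e / \<bar>eps\<bar>) * 1"
      proof (rule mult_mono)
        show "1 + norm x / \<bar>eps\<bar> \<le> 1 + e / \<bar>eps\<bar>" using True de by (simp add: divide_right_mono)
        have "e \<ge> 0" using True de norm_ge_zero[of x] by linarith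
        then show "0 \<le> 1 + e / \<bar>eps\<bar>" by simp
      qed (rule W heis_norm_nonneg)+
      finally have "\<rho> x * heis_norm eps (z, 0) (W (z + x)) \<le> \<rho> x * (1 + e / \<bar>eps\<bar>)"
        using mollifierD(1)[OF \<rho>] by (intro mult_left_mono) auto
      then show ?thesis
        using heis_norm_scaleR[of eps "(z, 0)" "\<rho> x" "W (z + x)"] mollifierD(1)[OF \<rho>, of x]
        by (simp add: heis_norm_frame)
    next
      case False
      then show ?thesis using mollifierD(3)[OF \<rho>, of x] heis_norm_0[of eps "(z, 0)"] by (simp add: heis_norm_frame)
    qed
  qed
  also have "\<dots> = 1 + e / \<bar>eps\<bar>" using mollifierD(4)[OF \<rho>] by simp
  finally show ?thesis .
qed

text \<open>The divergence theorem wants a C1 graph, but the supremum on the right tests v itself.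
  With w the mollification of v, the trace of U on the graph of w is tested against w; by
  adjointness this equals testing v against the averaged trace, admissible after division by
  \<open>1 + e / \<bar>eps\<bar>\<close>. Replacing v by w in the subgraph costs at most the bound
  of \<open>ediv U\<close> times the L1 distance.\<close>

lemma Peps_le_graph_area:
  fixes E :: "'n::finite heis set"
  assumes eps: "eps \<noteq> 0" and V: "open V" and vi: "integrable lebesgue (\<lambda>z. indicator V z * v z)"
    and E: "\<And>z t. z \<in> V \<Longrightarrow> (z, t) \<in> E \<longleftrightarrow> t < v z"
  shows "Peps eps E (V \<times> UNIV) \<le> graph_area eps v V"
proof (cases "graph_area eps v V")
  case MInf
  then show ?thesis using graph_area_nonneg[of eps v V] by simp
next
  case PInf
  then show ?thesis by simp
next
  case (real j)
  have j0: "j \<ge> 0" using graph_area_nonneg[of eps v V] real by simp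
  show ?thesis
  proof (rule Peps_least)
    fix U assume U: "admissible eps (V \<times> UNIV) U"
    then have UC: "C1c (V \<times> UNIV) U" by (simp add: admissible_def)
    obtain U' where u: "C1_deriv U U'" "cc {p. U p \<noteq> 0} (V \<times> UNIV)" "bounded {p. U p \<noteq> 0}"
      using UC by (rule C1cE)
    define K where "K = fst ` closure {p. U p \<noteq> 0}"
    have K: "compact K" "K \<subseteq> V" using u(2) unfolding K_def cc_def
      by (auto intro!: compact_continuous_image continuous_intros)
    have UK: "z \<in> K" if "U (z, t) \<noteq> 0 \<or> ediv U (z, t) \<noteq> 0" for z t
    proof -
      have "(z, t) \<in> closure {p. U p \<noteq> 0}"
        using that ediv_support[OF u(1), of "(z, t)"] C1_deriv_support(1)[OF u(1), of "(z, t)"] by blast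
      then show ?thesis unfolding K_def by force
    qed
    \<comment> \<open>Room for averaging: a field supported in K and averaged over a radius of at
      most r stays supported in the compact set V' inside V.\<close>
    obtain r where r: "r > 0" "(\<Union>x\<in>K. cball x r) \<subseteq> V"
      using compact_subset_open_imp_cball_epsilon_subset[OF K(1) V K(2)] by blast
    define V' where "V' = (\<Union>x\<in>K. cball x r)"
    have V': "compact V'" unfolding V'_def by (rule compact_minkowski_sum_cball[OF K(1)])
    have KV': "K \<subseteq> V'" unfolding V'_def using r(1) by force
    \<comment> \<open>Restricting v to V' makes it integrable on the whole space. The divergence of
      U vanishes off \<open>K \<times> UNIV\<close> and the averaged field vanishes off V', so both
      integrals keep their value.\<close>
    define g0 where "g0 z = indicator V' z * v z" for z
    have ig0: "integrable lebesgue g0"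
    proof -
      have "V' \<in> sets lebesgue" using V' lmeasurable_compact by blast
      from integrable_mult_indicator[OF this vi]
      moreover have "indicator V' x *\<^sub>R (indicator V x * v x) = g0 x" for x
        using r(2) unfolding V'_def[symmetric] g0_def by (auto simp: indicator_def)
      ultimately show ?thesis by simp
    qed
    obtain g where g: "g \<in> borel_measurable lborel" and g0g: "AE z in lborel. g0 z = g z"
      using completion_ex_borel_measurable_real[OF borel_measurable_integrable[OF ig0]] by auto
    have g0gL: "AE z in lebesgue. g0 z = g z" using g0g by (rule AE_completion)
    have g0m: "g0 \<in> borel_measurable lebesgue" by (rule borel_measurable_integrable[OF ig0])
    have gL: "g \<in> borel_measurable lebesgue" by (rule measurable_completion[OF g])
    have ig: "integrable lborel g"
      using integrable_cong_AE[OF g0m gL g0gL] ig0 integrable_completion[OF g] by simp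
    obtain C where C: "C \<ge> 0" "\<And>p. \<bar>ediv U p\<bar> \<le> C" using C1c_ediv_bounded[OF UC] by blast
    define I where "I = (\<integral>p. indicator E p * ediv U p \<partial>lebesgue)"
    have I: "I = (\<integral>p. below (g0 (fst p)) (snd p) * ediv U p \<partial>lebesgue)"
      unfolding I_def
    proof (rule Bochner_Integration.integral_cong[OF refl])
      fix p :: "'n heis" obtain z t where p: "p = (z, t)" by fastforce
      show "indicator E p * ediv U p = below (g0 (fst p)) (snd p) * ediv U p"
      proof (cases "ediv U p = 0")
        case False
        then have "z \<in> K" using UK[of z t] p by blast
        then have "z \<in> V'" "z \<in> V" using K KV' by auto
        then show ?thesis using E[of z t] by (simp add: p below_def g0_def indicator_def)
      qed simp
    qed
    have key: "I \<le> (1 + e / \<bar>eps\<bar>) * j + C * e" if e: "e > 0" for e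
    proof -
      define c where "c = 1 + e / \<bar>eps\<bar>"
      have c: "c > 0" unfolding c_def using e by (simp add: add_pos_nonneg)
      obtain d0 where d0: "d0 > 0" "\<And>x. norm x < d0 \<Longrightarrow> (\<integral>z. \<bar>g (z + x) - g z\<bar> \<partial>lborel) \<le> e"
        using L1_translation_continuous[OF ig e] by blast
      \<comment> \<open>Three demands on the radius: at most d0 for the L1 error, r for the support,
        e for the distortion of the norm.\<close>
      define d where "d = min d0 (min r e)"
      have d: "d > 0" "d \<le> e" "d \<le> r" "d \<le> d0" using d0 r e by (auto simp: d_def)
      obtain \<rho> :: "'n plane \<Rightarrow> real" where \<rho>: "mollifier d \<rho>" using mollifier_exists[OF d(1)] by blast
      define w where "w = mollify \<rho> g"
      obtain w' where w: "C1_deriv w w'" using mollify_C1[OF \<rho> ig] unfolding w_def by blast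
      have wL: "w \<in> borel_measurable lebesgue" by (rule continuous_imp_lebesgue_measurable[OF C1_deriv_D(5)[OF w]])
      have wg: "integrable lborel (\<lambda>z. w z - g z)" "(\<integral>z. \<bar>w z - g z\<bar> \<partial>lborel) \<le> e"
        unfolding w_def using d0(2) d e by (intro mollify_L1_approx[OF \<rho> ig]; force)+
      have wgm: "(\<lambda>z. w z - g z) \<in> borel_measurable lborel" by (rule borel_measurable_integrable[OF wg(1)])
      have aegw: "AE z in lebesgue. - (w z - g z) = g0 z - w z" using g0gL by eventually_elim simp
      have igw: "integrable lebesgue (\<lambda>z. g0 z - w z)"
      proof -
        have "integrable lebesgue (\<lambda>z. - (w z - g z))"
          using wg(1) integrable_completion[OF wgm] by (intro integrable_minus) simp
        moreover have "(\<lambda>z. - (w z - g z)) \<in> borel_measurable lebesgue" "(\<lambda>z. g0 z - w z) \<in> borel_measurable lebesgue"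
          using g0m gL wL by simp_all
        ultimately show ?thesis using integrable_cong_AE[OF _ _ aegw] by blast
      qed
      have "(\<integral>z. \<bar>g0 z - w z\<bar> \<partial>lebesgue) = (\<integral>z. \<bar>w z - g z\<bar> \<partial>lebesgue)"
        by (rule integral_cong_AE) (use g0m wL gL g0gL in \<open>auto elim!: eventually_mono\<close>)
      also have "\<dots> = (\<integral>z. \<bar>w z - g z\<bar> \<partial>lborel)" using wgm by (intro integral_completion) auto
      finally have gw: "(\<integral>z. \<bar>g0 z - w z\<bar> \<partial>lebesgue) \<le> e" using wg(2) by simp
      note bt = between_graphs[OF g0m wL, of "\<lambda>z. 1", simplified, OF igw]
      have bint: "integrable lebesgue (\<lambda>p. below (a (fst p)) (snd p) * ediv U p)" if "a \<in> borel_measurable lebesgue" for a :: "'n plane \<Rightarrow> real"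
        by (rule C1c_ediv_integrable[OF UC measurable_below[OF that], of 1]) (simp add: below_def)
      have "I - (\<integral>p. below (w (fst p)) (snd p) * ediv U p \<partial>lebesgue) =
          (\<integral>p. (below (g0 (fst p)) (snd p) - below (w (fst p)) (snd p)) * ediv U p \<partial>lebesgue)"
        unfolding I left_diff_distrib by (rule Bochner_Integration.integral_diff[OF bint[OF g0m] bint[OF wL], symmetric])
      also have "\<dots> \<le> (\<integral>p. C * \<bar>below (g0 (fst p)) (snd p) - below (w (fst p)) (snd p)\<bar> \<partial>lebesgue)"
      proof (rule integral_mono)
        show "integrable lebesgue (\<lambda>p. (below (g0 (fst p)) (snd p) - below (w (fst p)) (snd p)) * ediv U p)"
          unfolding left_diff_distrib by (rule Bochner_Integration.integrable_diff[OF bint[OF g0m] bint[OF wL]])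
        show "integrable lebesgue (\<lambda>p. C * \<bar>below (g0 (fst p)) (snd p) - below (w (fst p)) (snd p)\<bar>)"
          using bt(1) by simp
        fix p
        have "(below (g0 (fst p)) (snd p) - below (w (fst p)) (snd p)) * ediv U p \<le>
            \<bar>below (g0 (fst p)) (snd p) - below (w (fst p)) (snd p)\<bar> * \<bar>ediv U p\<bar>" by (simp add: abs_mult[symmetric])
        also have "\<dots> \<le> \<bar>below (g0 (fst p)) (snd p) - below (w (fst p)) (snd p)\<bar> * C"
          using C(2) by (intro mult_left_mono) auto
        finally show "(below (g0 (fst p)) (snd p) - below (w (fst p)) (snd p)) * ediv U p \<le> C * \<bar>below (g0 (fst p)) (snd p) - below (w (fst p)) (snd p)\<bar>"
          by (simp add: mult.commute)
      qed
      also have "\<dots> = C * (\<integral>z. \<bar>g0 z - w z\<bar> \<partial>lebesgue)" using bt(3) by simp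
      also have "\<dots> \<le> C * e" using gw C(1) by (intro mult_left_mono)
      finally have step1: "I \<le> (\<integral>p. below (w (fst p)) (snd p) * ediv U p \<partial>lebesgue) + C * e" by simp
      \<comment> \<open>The trace of U on the graph of w. It is C1 because w is, and vertical
        invariance of the norm gives its bound.\<close>
      define W where "W z = U (z, w z)" for z
      define W' where "W' z h = U' (z, w z) (h, w' z h)" for z h
      have Wd: "C1_deriv W W'" unfolding W_def[abs_def] W'_def[abs_def]
        using C1_deriv_compose[OF u(1) C1_deriv_Pair[OF C1_deriv_linear[OF bounded_linear_ident] w]] by simp
      have WK: "{z. W z \<noteq> 0} \<subseteq> K" using UK by (auto simp: W_def)
      have Wb: "bounded {z. W z \<noteq> 0}" using WK K(1) bounded_subset compact_imp_bounded by blast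
      have Wn: "heis_norm eps (z, 0) (W z) \<le> 1" for z
      proof -
        have "heis_norm eps (z, 0) (W z) = heis_norm eps (z, w z) (U (z, w z))"
          unfolding W_def by (rule heis_norm_fst) simp
        then show ?thesis using U unfolding admissible_def by metis
      qed
      have W0: "W z = 0" "W' z h = 0" if "z \<notin> K" for z h
        by (rule C1_deriv_outside[OF Wd compact_imp_closed[OF K(1)] WK that])+
      have fWd: "C1_deriv (\<lambda>z. fst (W z)) (\<lambda>z h. fst (W' z h))"
        using C1_deriv_compose[OF C1_deriv_linear[OF bounded_linear_fst] Wd] by simp
      define k where "k = ediv (\<lambda>z. fst (W z))"
      have kc: "continuous_on UNIV k" unfolding k_def by (rule continuous_on_ediv[OF fWd])
      have kexp: "k z = (\<Sum>b\<in>Basis. fst (W' z b) \<bullet> b)" for z unfolding k_def by (rule ediv_C1_deriv[OF fWd])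
      have k0: "k z = 0" if "z \<notin> K" for z unfolding kexp using W0(2)[OF that] by simp
      have Kb: "bounded K" using K(1) by (rule compact_imp_bounded)
      have sc: "continuous_on UNIV (\<lambda>z. snd (W z))" by (intro continuous_intros C1_deriv_D(5)[OF Wd])
      have s0: "snd (W z) = 0" if "z \<notin> K" for z using W0(1)[OF that] by simp
      have iwk: "integrable lborel (\<lambda>z. w z * k z)"
        by (rule integrable_compact_support(2)[OF _ Kb]) (auto intro!: continuous_intros C1_deriv_D(5)[OF w] kc simp: k0)
      have isn: "integrable lborel (\<lambda>z. snd (W z))" by (rule integrable_compact_support(2)[OF sc Kb s0])
      have "(\<integral>p. below (w (fst p)) (snd p) * ediv U p \<partial>lebesgue) = (\<integral>z. w z * k z + snd (W z) \<partial>lebesgue)"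
        unfolding k_def W_def by (rule integral_below_ediv[OF w u(1,3)])
      also have "\<dots> = (\<integral>z. w z * k z + snd (W z) \<partial>lborel)"
        using borel_measurable_integrable[OF iwk] borel_measurable_integrable[OF isn]
        by (intro integral_lebesgue_lborel) auto
      also have "\<dots> = (\<integral>z. w z * k z \<partial>lborel) + (\<integral>z. snd (W z) \<partial>lborel)"
        by (rule Bochner_Integration.integral_add[OF iwk isn])
      also have "(\<integral>z. w z * k z \<partial>lborel) = (\<integral>y. g y * (\<integral>x. \<rho> x * k (y + x) \<partial>lborel) \<partial>lborel)"
        unfolding w_def by (rule mollify_adjoint[OF \<rho> ig kc Kb k0])
      also have "(\<integral>z. snd (W z) \<partial>lborel) = (\<integral>y. (\<integral>x. \<rho> x * snd (W (y + x)) \<partial>lborel) \<partial>lborel)"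
        by (rule integral_mollify[OF \<rho> sc Kb s0, symmetric])
      finally have step2: "(\<integral>p. below (w (fst p)) (snd p) * ediv U p \<partial>lebesgue) =
        (\<integral>y. g y * (\<integral>x. \<rho> x * k (y + x) \<partial>lborel) \<partial>lborel) + (\<integral>y. (\<integral>x. \<rho> x * snd (W (y + x)) \<partial>lborel) \<partial>lborel)" .
      define A where "A z = (\<integral>x. \<rho> x *\<^sub>R W (z + x) \<partial>lborel)" for z
      define A' where "A' z h = (\<integral>x. \<rho> x *\<^sub>R W' (z + x) h \<partial>lborel)" for z h
      note conv = C1_deriv_convolution[OF mollifierD(6)[OF \<rho>] Wd Wb, of "\<lambda>x. x", simplified]
      have Ad: "C1_deriv A A'" using conv(1) unfolding A_def[abs_def] A'_def[abs_def] .
      have A0: "A z = 0" if "z \<notin> V'" for z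
      proof -
        have "\<rho> x *\<^sub>R W (z + x) = 0" for x
        proof (cases "norm x < d")
          case True
          have "z + x \<notin> K"
          proof
            assume "z + x \<in> K"
            moreover have "z \<in> cball (z + x) r" using True d by (simp add: dist_norm)
            ultimately show False using that unfolding V'_def by blast
          qed
          then show ?thesis using W0(1) by simp
        qed (simp add: mollifierD(3)[OF \<rho>])
        then show ?thesis unfolding A_def by (simp only: integral_zero)
      qed
      have AV': "{z. A z \<noteq> 0} \<subseteq> V'" using A0 by blast
      have fAd: "C1_deriv (\<lambda>z. fst (A z)) (\<lambda>z h. fst (A' z h))"
        using C1_deriv_compose[OF C1_deriv_linear[OF bounded_linear_fst] Ad] by simp
      have eA: "ediv (\<lambda>z. fst (A z)) z = (\<integral>x. \<rho> x * k (z + x) \<partial>lborel)" for z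
      proof -
        have bl: "bounded_linear (\<lambda>q::'n heis. fst q \<bullet> b)" for b
          by (rule bounded_linear_compose[OF bounded_linear_inner_left bounded_linear_fst])
        have ii: "integrable lborel (\<lambda>x. \<rho> x * (fst (W' (z + x) b) \<bullet> b))" for b
          using integrable_bounded_linear[OF bl[of b] conv(3)[of z b]] by simp
        have "fst (A' z b) \<bullet> b = (\<integral>x. \<rho> x * (fst (W' (z + x) b) \<bullet> b) \<partial>lborel)" for b
          unfolding A'_def using integral_bounded_linear[OF bl[of b] conv(3)[of z b]] by simp
        then have "ediv (\<lambda>z. fst (A z)) z = (\<Sum>b\<in>Basis. \<integral>x. \<rho> x * (fst (W' (z + x) b) \<bullet> b) \<partial>lborel)"
          unfolding ediv_C1_deriv[OF fAd] by simp
        also have "\<dots> = (\<integral>x. (\<Sum>b\<in>Basis. \<rho> x * (fst (W' (z + x) b) \<bullet> b)) \<partial>lborel)"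
          by (rule Bochner_Integration.integral_sum[symmetric]) (rule ii)
        finally show ?thesis by (simp add: kexp sum_distrib_left)
      qed
      have sA: "snd (A z) = (\<integral>x. \<rho> x * snd (W (z + x)) \<partial>lborel)" for z
        unfolding A_def using integral_bounded_linear[OF bounded_linear_snd conv(2)[of z]] by simp
      have eA0: "ediv (\<lambda>z. fst (A z)) z = 0" if "z \<notin> V'" for z
      proof -
        have "{z. fst (A z) \<noteq> 0} \<subseteq> V'" by (rule subset_trans[OF _ AV']) auto
        from C1_deriv_outside(2)[OF fAd compact_imp_closed[OF V'] this that] show ?thesis
          unfolding ediv_C1_deriv[OF fAd] by simp
      qed
      have An: "heis_norm eps (z, 0) (A z) \<le> c" for z
        unfolding A_def c_def by (rule heis_norm_average[OF eps \<rho> d(2) Wn conv(2)])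
      define B where "B z = inverse c *\<^sub>R A z" for z
      have "C1c V B" unfolding B_def
        by (rule C1cI[OF C1_deriv_scaleR[OF C1_deriv_const Ad]], rule cc_compactI[OF V'])
           (use AV' r(2) in \<open>auto simp: V'_def[symmetric]\<close>)
      moreover have "heis_norm eps (z, 0) (B z) \<le> 1" for z
        unfolding B_def heis_norm_scaleR using An[of z] c by (simp add: field_simps)
      ultimately have "admissible_base eps V B" by (simp add: admissible_base_def)
      from graph_area_upper[OF this, of v]
      have "(\<integral>z. indicator V z * (v z * ediv (\<lambda>z. fst (B z)) z + snd (B z)) \<partial>lebesgue) \<le> j"
        using real by simp
      also have "(\<integral>z. indicator V z * (v z * ediv (\<lambda>z. fst (B z)) z + snd (B z)) \<partial>lebesgue) =
          (\<integral>z. inverse c * (g0 z * ediv (\<lambda>z. fst (A z)) z + snd (A z)) \<partial>lebesgue)"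
      proof (rule Bochner_Integration.integral_cong[OF refl])
        fix z
        have "ediv (\<lambda>z. fst (B z)) z = inverse c * ediv (\<lambda>z. fst (A z)) z"
          unfolding B_def fst_scaleR by (rule ediv_scaleR[OF fAd])
        then show "indicator V z * (v z * ediv (\<lambda>z. fst (B z)) z + snd (B z)) =
            inverse c * (g0 z * ediv (\<lambda>z. fst (A z)) z + snd (A z))"
          using A0[of z] eA0[of z] r(2) unfolding V'_def[symmetric]
          by (cases "z \<in> V'") (auto simp: B_def g0_def algebra_simps)
      qed
      also have "\<dots> = inverse c * (\<integral>z. g0 z * ediv (\<lambda>z. fst (A z)) z + snd (A z) \<partial>lebesgue)" by simp
      finally have "(\<integral>z. g0 z * ediv (\<lambda>z. fst (A z)) z + snd (A z) \<partial>lebesgue) \<le> c * j"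
        using c by (simp add: field_simps)
      moreover have "(\<integral>z. g0 z * ediv (\<lambda>z. fst (A z)) z + snd (A z) \<partial>lebesgue) =
          (\<integral>y. g y * ediv (\<lambda>z. fst (A z)) y \<partial>lborel) + (\<integral>y. snd (A y) \<partial>lborel)"
      proof -
        have eAc: "continuous_on UNIV (ediv (\<lambda>z. fst (A z)))" by (rule continuous_on_ediv[OF fAd])
        have sAc: "continuous_on UNIV (\<lambda>z. snd (A z))" by (intro continuous_intros C1_deriv_D(5)[OF Ad])
        have V'b: "bounded V'" using V' by (rule compact_imp_bounded)
        have isA: "integrable lborel (\<lambda>z. snd (A z))"
          by (rule integrable_compact_support(2)[OF sAc V'b]) (simp add: A0)
        obtain D where D: "\<And>z. norm (ediv (\<lambda>z. fst (A z)) z) \<le> D"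
          using bounded_range_compact_support[OF eAc V'b eA0] by blast
        have mm: "ediv (\<lambda>z. fst (A z)) \<in> borel_measurable lborel"
          using eAc by (simp add: borel_measurable_continuous_onI)
        have ie: "integrable lborel (\<lambda>z. g z * ediv (\<lambda>z. fst (A z)) z)"
        proof (rule Bochner_Integration.integrable_bound[OF integrable_mult_left[OF ig, of D]])
          show "(\<lambda>z. g z * ediv (\<lambda>z. fst (A z)) z) \<in> borel_measurable lborel" using g mm by simp
          show "AE z in lborel. norm (g z * ediv (\<lambda>z. fst (A z)) z) \<le> norm (g z * D)"
          proof (rule AE_I2)
            fix z
            have "\<bar>ediv (\<lambda>z. fst (A z)) z\<bar> \<le> \<bar>D\<bar>" using D[of z] by simp
            then show "norm (g z * ediv (\<lambda>z. fst (A z)) z) \<le> norm (g z * D)"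
              by (simp add: abs_mult mult_left_mono)
          qed
        qed
        have mL: "ediv (\<lambda>z. fst (A z)) \<in> borel_measurable lebesgue" "(\<lambda>z. snd (A z)) \<in> borel_measurable lebesgue"
          by (rule continuous_imp_lebesgue_measurable[OF eAc] continuous_imp_lebesgue_measurable[OF sAc])+
        have "(\<integral>z. g0 z * ediv (\<lambda>z. fst (A z)) z + snd (A z) \<partial>lebesgue) = (\<integral>z. g z * ediv (\<lambda>z. fst (A z)) z + snd (A z) \<partial>lebesgue)"
          by (rule integral_cong_AE) (use g0m gL mL g0gL in \<open>auto elim!: eventually_mono\<close>)
        also have "\<dots> = (\<integral>z. g z * ediv (\<lambda>z. fst (A z)) z + snd (A z) \<partial>lborel)"
          using borel_measurable_integrable[OF ie] borel_measurable_integrable[OF isA]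
          by (intro integral_lebesgue_lborel) auto
        also have "\<dots> = (\<integral>y. g y * ediv (\<lambda>z. fst (A z)) y \<partial>lborel) + (\<integral>y. snd (A y) \<partial>lborel)"
          by (rule Bochner_Integration.integral_add[OF ie isA])
        finally show ?thesis .
      qed
      ultimately have "(\<integral>p. below (w (fst p)) (snd p) * ediv U p \<partial>lebesgue) \<le> c * j"
        unfolding step2 eA sA by simp
      then show ?thesis using step1 unfolding c_def by simp
    qed
    have "I \<le> j"
    proof (rule field_le_epsilon)
      fix \<delta> :: real assume \<delta>: "\<delta> > 0"
      \<comment> \<open>The two errors in \<open>key\<close>, from the distortion of the norm and
        from the L1 distance, add up to \<open>e * q\<close>.\<close>
      define q where "q = j / \<bar>eps\<bar> + C"
      have q: "q \<ge> 0" using j0 C by (simp add: q_def)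
      define e where "e = \<delta> / (q + 1)"
      have e: "e > 0" using \<delta> q by (simp add: e_def)
      have "I \<le> j + e * q" using key[OF e] by (simp add: q_def algebra_simps)
      also have "e * q \<le> e * (q + 1)" using e by simp
      also have "e * (q + 1) = \<delta>" using q by (simp add: e_def)
      finally show "I \<le> j + \<delta>" by simp
    qed
    then show "ereal (\<integral>p. indicator E p * ediv U p \<partial>lebesgue) \<le> graph_area eps v V"
      using real by (simp add: I_def)
  qed
qed

section \<open>Cutoffs in the vertical direction\<close>

text \<open>Used in two regimes: with j = 1 and s growing it truncates fields that are constant in
  t; with s fixed and j growing it approximates the indicator of \<open>\<bar>t\<bar> < s\<close>,
  with transition layers of width \<open>1 / j\<close> on the inside.\<close>

definition tcut :: "real \<Rightarrow> real \<Rightarrow> real \<Rightarrow> real" where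
  "tcut j s t = smoothstep (j * (s - t)) * smoothstep (j * (s + t))"

definition tcut' :: "real \<Rightarrow> real \<Rightarrow> real \<Rightarrow> real" where
  "tcut' j s t = j * (smoothstep (j * (s - t)) * smoothstep' (j * (s + t))
     - smoothstep' (j * (s - t)) * smoothstep (j * (s + t)))"

lemma tcut_C1: "C1_deriv (tcut j s) (\<lambda>t h. tcut' j s t * h)"
proof (rule C1_deriv_real)
  fix t
  have d1: "((\<lambda>t. j * (s - t)) has_real_derivative - j) (at t)" "((\<lambda>t. j * (s + t)) has_real_derivative j) (at t)"
    by (auto intro!: derivative_eq_intros)
  have "((\<lambda>t. smoothstep (j * (s - t)) * smoothstep (j * (s + t))) has_real_derivative
      smoothstep' (j * (s - t)) * - j * smoothstep (j * (s + t)) + smoothstep' (j * (s + t)) * j * smoothstep (j * (s - t))) (at t)"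
    by (intro DERIV_mult DERIV_chain2[OF smoothstep_deriv] d1)
  then show "(tcut j s has_real_derivative tcut' j s t) (at t)"
    unfolding tcut_def[abs_def] tcut'_def by (simp add: algebra_simps)
next
  have c: "continuous_on UNIV smoothstep'"
    unfolding smoothstep'_def by (intro continuous_intros continuous_possq)
  have c2: "continuous_on UNIV smoothstep" by (rule C1_deriv_D(5)[OF smoothstep_C1])
  show "continuous_on UNIV (tcut' j s)" unfolding tcut'_def
    by (intro continuous_intros continuous_on_compose2[OF c] continuous_on_compose2[OF c2]) auto
qed

lemma tcut_bounds: "0 \<le> tcut j s t" "tcut j s t \<le> 1"
  unfolding tcut_def using smoothstep_bounds by (auto intro: mult_le_one)

lemma tcut_1:
  assumes "j > 0" "\<bar>t\<bar> \<le> s - 1 / j" shows "tcut j s t = 1" "tcut' j s t = 0"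
proof -
  have "1 / j \<le> s - t" "1 / j \<le> s + t" using assms by auto
  then have "j * (s - t) \<ge> 1" "j * (s + t) \<ge> 1" using assms(1) by (simp_all add: field_simps)
  then show "tcut j s t = 1" "tcut' j s t = 0" by (simp_all add: tcut_def tcut'_def smoothstep_1)
qed

lemma tcut_0:
  assumes "j > 0" "\<bar>t\<bar> \<ge> s" shows "tcut j s t = 0" "tcut' j s t = 0"
proof -
  have "s - t \<le> 0 \<or> s + t \<le> 0" using assms by auto
  then have "j * (s - t) \<le> 0 \<or> j * (s + t) \<le> 0" using assms(1) by (auto simp: mult_le_0_iff)
  then show "tcut j s t = 0" "tcut' j s t = 0" by (auto simp: tcut_def tcut'_def smoothstep_0 smoothstep'_0)
qed

lemma tcut'_bound: assumes "j > 0" shows "\<bar>tcut' j s t\<bar> \<le> 8 * j"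
proof -
  have "\<bar>smoothstep a * smoothstep' b\<bar> \<le> 4" for a b
  proof -
    have "\<bar>smoothstep a\<bar> * \<bar>smoothstep' b\<bar> \<le> 1 * 4"
      using smoothstep_bounds[of a] smoothstep'_bound[of b] by (intro mult_mono) auto
    then show ?thesis by (simp add: abs_mult)
  qed
  from this[of "j * (s - t)" "j * (s + t)"] this[of "j * (s + t)" "j * (s - t)"]
  have "\<bar>smoothstep (j * (s - t)) * smoothstep' (j * (s + t)) - smoothstep' (j * (s - t)) * smoothstep (j * (s + t))\<bar> \<le> 8"
    unfolding mult.commute[of "smoothstep' (j * (s - t))"] by linarith
  then have "\<bar>j\<bar> * \<bar>smoothstep (j * (s - t)) * smoothstep' (j * (s + t)) - smoothstep' (j * (s - t)) * smoothstep (j * (s + t))\<bar> \<le> j * 8"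
    using assms by (intro mult_mono) auto
  then show ?thesis unfolding tcut'_def abs_mult by simp
qed

lemma C1_deriv_tcut_snd:
  "C1_deriv (\<lambda>p::'a::euclidean_space \<times> real. tcut j s (snd p)) (\<lambda>p h. tcut' j s (snd p) * snd h)"
  by (rule C1_deriv_compose[OF tcut_C1 C1_deriv_linear[OF bounded_linear_snd]])

lemma ediv_tcut:
  assumes "C1_deriv X X'"
  shows "ediv (\<lambda>p. tcut j s (snd p) *\<^sub>R X p) p = tcut j s (snd p) * ediv X p + tcut' j s (snd p) * snd (X p)"
  by (rule ediv_scaleR_fun[OF C1_deriv_tcut_snd assms])

section \<open>Fields that do not depend on the height\<close>

lemma ediv_lift:
  fixes W :: "'a::euclidean_space \<Rightarrow> 'a \<times> real"
  assumes W: "C1_deriv W W'"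
  shows "C1_deriv (\<lambda>p::'a \<times> real. W (fst p)) (\<lambda>p h. W' (fst p) (fst h))"
    "ediv (\<lambda>p::'a \<times> real. W (fst p)) p = ediv (\<lambda>z. fst (W z)) (fst p)"
proof -
  show d: "C1_deriv (\<lambda>p::'a \<times> real. W (fst p)) (\<lambda>p h. W' (fst p) (fst h))"
    by (rule C1_deriv_compose[OF W C1_deriv_linear[OF bounded_linear_fst]])
  have f: "C1_deriv (\<lambda>z. fst (W z)) (\<lambda>z h. fst (W' z h))"
    using C1_deriv_compose[OF C1_deriv_linear[OF bounded_linear_fst] W] by simp
  show "ediv (\<lambda>p::'a \<times> real. W (fst p)) p = ediv (\<lambda>z. fst (W z)) (fst p)"
    unfolding ediv_prod[OF d] ediv_C1_deriv[OF f] using linear_0[OF C1_deriv_D(4)[OF W]] by simp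
qed

text \<open>The signed length of a slice relative to the lower half-line is all that a t-independent
  field sees of F. The error of its vertical cutoff disappears because F differs from the lower
  half-space by finite volume over V.\<close>

lemma graph_area_le_Peps:
  fixes F :: "'n::finite heis set"
  assumes F: "F \<in> sets lebesgue" and V: "V \<in> sets lebesgue"
    and \<sigma>i: "integrable lebesgue (\<lambda>p. indicator V (fst p) * (indicator F p - below 0 (snd p)))"
    and v: "AE z in lebesgue. z \<in> V \<longrightarrow> v z = (\<integral>t. indicator F (z, t) - below 0 t \<partial>lebesgue)"
  shows "graph_area eps v V \<le> Peps eps F (V \<times> UNIV)"
proof (rule graph_area_least)
  fix W assume W: "admissible_base eps V W"
  then have WC: "C1c V W" and Wn: "\<And>z. heis_norm eps (z, 0) (W z) \<le> 1" by (auto simp: admissible_base_def)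
  obtain W' where Wd: "C1_deriv W W'" "cc {z. W z \<noteq> 0} V" "compact (closure {z. W z \<noteq> 0})" "bounded {z. W z \<noteq> 0}"
    using WC by (rule C1cE)
  define K where "K = closure {z. W z \<noteq> 0}"
  have K: "compact K" "K \<subseteq> V" using Wd(2,3) by (auto simp: K_def cc_def)
  have fWd: "C1_deriv (\<lambda>z. fst (W z)) (\<lambda>z h. fst (W' z h))"
    using C1_deriv_compose[OF C1_deriv_linear[OF bounded_linear_fst] Wd(1)] by simp
  define k where "k = ediv (\<lambda>z. fst (W z))"
  have kc: "continuous_on UNIV k" unfolding k_def by (rule continuous_on_ediv[OF fWd])
  have W0: "W z = 0" "W' z h = 0" if "z \<notin> K" for z h
    using C1_deriv_support[OF Wd(1)] that unfolding K_def by blast+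
  have k0: "k z = 0" if "z \<notin> K" for z
    unfolding k_def ediv_C1_deriv[OF fWd] using W0(2)[OF that] by simp
  have Wc: "continuous_on UNIV W" by (rule C1_deriv_D(5)[OF Wd(1)])
  have Kb: "bounded K" using K(1) by (rule compact_imp_bounded)
  obtain Ck where Ck: "Ck \<ge> 0" "\<And>z. norm (k z) \<le> Ck" using bounded_range_compact_support[OF kc Kb k0] by blast
  obtain Cs where Cs: "Cs \<ge> 0" "\<And>z. norm (W z) \<le> Cs" using bounded_range_compact_support[OF Wc Kb W0(1)] by blast
  \<comment> \<open>The cutoff is 1 for \<open>\<bar>t\<bar> \<le> n\<close>, in particular at t = 0
    for every n, where the half-space term is evaluated.\<close>
  define U where "U n p = tcut 1 (real n + 1) (snd p) *\<^sub>R W (fst p)" for n :: nat and p :: "'n heis"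
  note Ld = ediv_lift(1)[OF Wd(1)]
  have Ud: "\<exists>U'. C1_deriv (U n) U'" for n
    unfolding U_def[abs_def] using C1_deriv_scaleR[OF C1_deriv_tcut_snd Ld] by blast
  have Ue: "ediv (U n) p = tcut 1 (real n + 1) (snd p) * k (fst p) + tcut' 1 (real n + 1) (snd p) * snd (W (fst p))" for n p
    unfolding U_def[abs_def] k_def ediv_lift(2)[OF Wd(1), symmetric] by (rule ediv_tcut[OF Ld])
  have UC: "C1c (V \<times> UNIV) (U n)" for n
  proof -
    have "{p. U n p \<noteq> 0} \<subseteq> K \<times> cball 0 (real n + 1)"
    proof
      fix p assume "p \<in> {p. U n p \<noteq> 0}"
      then have ne: "tcut 1 (real n + 1) (snd p) \<noteq> 0" "W (fst p) \<noteq> 0" by (auto simp: U_def)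
      then have "fst p \<in> K" using W0(1) by blast
      moreover have "\<bar>snd p\<bar> \<le> real n + 1" using ne(1) tcut_0(1)[of 1 "real n + 1" "snd p"] by (cases "\<bar>snd p\<bar> \<le> real n + 1") auto
      ultimately show "p \<in> K \<times> cball 0 (real n + 1)" by (cases p) auto
    qed
    then have "cc {p. U n p \<noteq> 0} (V \<times> UNIV)"
      by (rule cc_compactI[rotated]) (use K in \<open>auto intro: compact_Times\<close>)
    then show ?thesis using Ud C1cI by blast
  qed
  have Ua: "admissible eps (V \<times> UNIV) (U n)" for n
  proof -
    have "heis_norm eps p (U n p) \<le> 1" for p
      unfolding U_def
    proof (rule heis_norm_scale_le[OF tcut_bounds])
      have "heis_norm eps p (W (fst p)) = heis_norm eps (fst p, 0) (W (fst p))" by (rule heis_norm_fst) simp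
      then show "heis_norm eps p (W (fst p)) \<le> 1" using Wn[of "fst p"] by simp
    qed
    then show ?thesis using UC by (simp add: admissible_def)
  qed
  define \<sigma> where "\<sigma> p = indicator F p - below 0 (snd p)" for p :: "'n heis"
  have bm: "(\<lambda>p::'n heis. below 0 (snd p)) \<in> borel_measurable lebesgue"
    by (rule measurable_below[of "\<lambda>z. 0"]) simp
  have \<sigma>m: "\<sigma> \<in> borel_measurable lebesgue" unfolding \<sigma>_def[abs_def] using F bm by simp
  \<comment> \<open>The half-space part is computed exactly by the divergence theorem with w = 0 and
    contributes the integral of \<open>snd (W z)\<close>; only the \<sigma> part needs a
    limit.\<close>
  have Im: "(\<integral>p. indicator F p * ediv (U n) p \<partial>lebesgue) = (\<integral>p. \<sigma> p * ediv (U n) p \<partial>lebesgue) + (\<integral>z. snd (W z) \<partial>lebesgue)" for n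
  proof -
    obtain U' where U': "C1_deriv (U n) U'" "bounded {p. U n p \<noteq> 0}" using UC[of n] by (rule C1cE)
    have "U n (z, 0) = W z" for z by (simp add: U_def tcut_1)
    then have half: "(\<integral>p. below 0 (snd p) * ediv (U n) p \<partial>lebesgue) = (\<integral>z. snd (W z) \<partial>lebesgue)"
      using integral_below_ediv[OF C1_deriv_const[of 0] U'] by simp
    have "(\<integral>p. indicator F p * ediv (U n) p \<partial>lebesgue) = (\<integral>p. \<sigma> p * ediv (U n) p + below 0 (snd p) * ediv (U n) p \<partial>lebesgue)"
      by (rule Bochner_Integration.integral_cong) (auto simp: \<sigma>_def algebra_simps)
    also have "\<dots> = (\<integral>p. \<sigma> p * ediv (U n) p \<partial>lebesgue) + (\<integral>p. below 0 (snd p) * ediv (U n) p \<partial>lebesgue)"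
      by (intro Bochner_Integration.integral_add C1c_ediv_integrable[OF UC \<sigma>m, of 1] C1c_ediv_integrable[OF UC bm, of 1])
         (auto simp: \<sigma>_def below_def indicator_def)
    finally show ?thesis using half by simp
  qed
  define L where "L = (\<integral>p. \<sigma> p * k (fst p) \<partial>lebesgue)"
  have kfm: "(\<lambda>p::'n heis. k (fst p)) \<in> borel_measurable lebesgue"
    by (rule lebesgue_measurable_fst[OF continuous_imp_lebesgue_measurable[OF kc]])
  \<comment> \<open>The slope of the cutoff is at most 8, so the divergences are bounded by
    \<open>Ck + 8 * Cs\<close> for all n, and integrability of \<sigma> over V supplies the
    majorant.\<close>
  have Lim: "(\<lambda>n. \<integral>p. \<sigma> p * ediv (U n) p \<partial>lebesgue) \<longlonglongrightarrow> L"
    unfolding L_def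
  proof (rule integral_dominated_convergence[where w="\<lambda>p. (Ck + 8 * Cs) * \<bar>indicator V (fst p) * \<sigma> p\<bar>"])
    show "(\<lambda>p. \<sigma> p * k (fst p)) \<in> borel_measurable lebesgue" using \<sigma>m kfm by simp
    show "(\<lambda>p. \<sigma> p * ediv (U n) p) \<in> borel_measurable lebesgue" for n
      using \<sigma>m continuous_imp_lebesgue_measurable[OF C1c_ediv_continuous[OF UC]] by simp
    show "integrable lebesgue (\<lambda>p. (Ck + 8 * Cs) * \<bar>indicator V (fst p) * \<sigma> p\<bar>)"
      unfolding \<sigma>_def by (intro integrable_mult_right integrable_abs \<sigma>i)
    show "AE p in lebesgue. (\<lambda>n. \<sigma> p * ediv (U n) p) \<longlonglongrightarrow> \<sigma> p * k (fst p)"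
    proof (rule AE_I2)
      fix p :: "'n heis"
      obtain N where N: "\<bar>snd p\<bar> \<le> real N" using real_arch_simple by blast
      have "eventually (\<lambda>n. \<sigma> p * ediv (U n) p = \<sigma> p * k (fst p)) sequentially"
        using eventually_ge_at_top[of N]
        by eventually_elim (use N in \<open>simp add: Ue tcut_1\<close>)
      then show "(\<lambda>n. \<sigma> p * ediv (U n) p) \<longlonglongrightarrow> \<sigma> p * k (fst p)" by (rule tendsto_eventually)
    qed
    show "AE p in lebesgue. norm (\<sigma> p * ediv (U n) p) \<le> (Ck + 8 * Cs) * \<bar>indicator V (fst p) * \<sigma> p\<bar>" for n
    proof (rule AE_I2)
      fix p :: "'n heis"
      show "norm (\<sigma> p * ediv (U n) p) \<le> (Ck + 8 * Cs) * \<bar>indicator V (fst p) * \<sigma> p\<bar>"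
      proof (cases "fst p \<in> V")
        case True
        have "\<bar>ediv (U n) p\<bar> \<le> \<bar>tcut 1 (real n + 1) (snd p)\<bar> * \<bar>k (fst p)\<bar> + \<bar>tcut' 1 (real n + 1) (snd p)\<bar> * \<bar>snd (W (fst p))\<bar>"
          unfolding Ue abs_mult[symmetric] by (rule abs_triangle_ineq)
        also have "\<dots> \<le> 1 * Ck + 8 * Cs"
          using tcut_bounds[of 1 "real n + 1" "snd p"] tcut'_bound[of 1 "real n + 1" "snd p"] Ck(1) Cs(1) Ck(2)[of "fst p"]
            norm_snd_le[of "snd (W (fst p))" "fst (W (fst p))"] Cs(2)[of "fst p"]
          by (intro add_mono mult_mono) auto
        finally have "\<bar>\<sigma> p\<bar> * \<bar>ediv (U n) p\<bar> \<le> \<bar>\<sigma> p\<bar> * (Ck + 8 * Cs)" by (intro mult_left_mono) auto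
        then show ?thesis using True by (simp add: abs_mult mult.commute)
      next
        case False
        then show ?thesis using C1c_ediv_zero[OF UC, of p n] by (cases p) auto
      qed
    qed
  qed
  have \<sigma>ki: "integrable lebesgue (\<lambda>p. \<sigma> p * k (fst p))"
  proof (rule Bochner_Integration.integrable_bound[where f="\<lambda>p. Ck * \<bar>indicator V (fst p) * \<sigma> p\<bar>"])
    show "integrable lebesgue (\<lambda>p. Ck * \<bar>indicator V (fst p) * \<sigma> p\<bar>)"
      unfolding \<sigma>_def by (intro integrable_mult_right integrable_abs \<sigma>i)
    show "(\<lambda>p. \<sigma> p * k (fst p)) \<in> borel_measurable lebesgue" using \<sigma>m kfm by simp
    show "AE p in lebesgue. norm (\<sigma> p * k (fst p)) \<le> norm (Ck * \<bar>indicator V (fst p) * \<sigma> p\<bar>)"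
    proof (rule AE_I2)
      fix p :: "'n heis"
      show "norm (\<sigma> p * k (fst p)) \<le> norm (Ck * \<bar>indicator V (fst p) * \<sigma> p\<bar>)"
      proof (cases "fst p \<in> V")
        case True
        have "\<bar>\<sigma> p\<bar> * \<bar>k (fst p)\<bar> \<le> \<bar>\<sigma> p\<bar> * Ck" using Ck(2)[of "fst p"] by (intro mult_left_mono) auto
        then show ?thesis using True Ck(1) by (simp add: abs_mult mult.commute)
      next
        case False
        then have "fst p \<notin> K" using K(2) by blast
        then show ?thesis by (simp add: k0)
      qed
    qed
  qed
  have vk: "AE z in lebesgue. (\<integral>t. \<sigma> (z, t) * k (fst (z, t)) \<partial>lebesgue) = indicator V z * (v z * k z)"
    using v
  proof eventually_elim
    case (elim z)
    have "z \<notin> V \<Longrightarrow> k z = 0" using K(2) k0 by blast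
    then show ?case using elim by (auto simp: \<sigma>_def indicator_def)
  qed
  have vkm: "(\<lambda>z. indicator V z * (v z * k z)) \<in> borel_measurable lebesgue"
    by (rule borel_measurable_AE[OF borel_measurable_integrable[OF lebesgue_Fubini(2)[OF \<sigma>ki]] vk])
  have vki: "integrable lebesgue (\<lambda>z. indicator V z * (v z * k z))"
    using integrable_cong_AE[OF borel_measurable_integrable[OF lebesgue_Fubini(2)[OF \<sigma>ki]] vkm vk] lebesgue_Fubini(2)[OF \<sigma>ki] by blast
  have L: "L = (\<integral>z. indicator V z * (v z * k z) \<partial>lebesgue)"
    unfolding L_def lebesgue_Fubini(3)[OF \<sigma>ki]
    by (rule integral_cong_AE[OF borel_measurable_integrable[OF lebesgue_Fubini(2)[OF \<sigma>ki]] vkm vk])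
  have isn: "integrable lebesgue (\<lambda>z. snd (W z))"
    by (rule integrable_compact_support(1)[OF continuous_on_snd[OF Wc] Kb]) (simp add: W0)
  have eq: "indicator V z * (v z * k z + snd (W z)) = indicator V z * (v z * k z) + snd (W z)" for z
  proof (cases "z \<in> V")
    case False
    then have "z \<notin> K" using K(2) by blast
    then show ?thesis using False by (simp add: W0(1))
  qed (simp add: distrib_left)
  have "(\<integral>z. indicator V z * (v z * ediv (\<lambda>z. fst (W z)) z + snd (W z)) \<partial>lebesgue) = L + (\<integral>z. snd (W z) \<partial>lebesgue)"
    unfolding L k_def[symmetric] eq by (rule Bochner_Integration.integral_add[OF vki isn])
  moreover have "(\<lambda>n. ereal (\<integral>p. indicator F p * ediv (U n) p \<partial>lebesgue)) \<longlonglongrightarrow> ereal (L + (\<integral>z. snd (W z) \<partial>lebesgue))"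
    unfolding Im by (intro tendsto_ereal tendsto_intros Lim)
  then have "ereal (L + (\<integral>z. snd (W z) \<partial>lebesgue)) \<le> Peps eps F (V \<times> UNIV)"
    by (rule LIMSEQ_le_const2) (use Peps_upper[OF Ua] in blast)
  ultimately show "ereal (\<integral>z. indicator V z * (v z * ediv (\<lambda>z. fst (W z)) z + snd (W z)) \<partial>lebesgue) \<le> Peps eps F (V \<times> UNIV)"
    by simp
qed

section \<open>Graph area and total variation\<close>

text \<open>The horizontal part of an admissible field competes in the total variation, and over V
  its vertical part is at most \<open>\<bar>eps\<bar> + R\<close>; so the graph area exceeds the
  total variation by at most M.\<close>

lemma graph_area_finite:
  fixes V :: "'n::finite plane set"
  assumes eps: "eps \<noteq> 0" and V: "open V" "bounded V" and v: "integrable lebesgue (\<lambda>z. indicator V z * v z)"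
    and tv: "total_variation v V < \<infinity>"
  shows "graph_area eps v V < \<infinity>"
proof -
  obtain R where R: "V \<subseteq> ball 0 R" "R > 0" using bounded_subset_ballD[OF V(2), of 0] by blast
  define M where "M = (\<bar>eps\<bar> + R) * measure lebesgue V"
  have Vm: "V \<in> sets lebesgue" "emeasure lebesgue V < \<infinity>"
    using V emeasure_bounded_finite[OF V(2)] by auto
  have "graph_area eps v V \<le> total_variation v V + ereal M"
  proof (rule graph_area_least)
    fix W assume W: "admissible_base eps V W"
    then have WC: "C1c V W" and Wn: "\<And>z. heis_norm eps (z, 0) (W z) \<le> 1" by (auto simp: admissible_base_def)
    obtain W' where Wd: "C1_deriv W W'" "cc {z. W z \<noteq> 0} V" "bounded {z. W z \<noteq> 0}" using WC by (rule C1cE)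
    have fWd: "C1_deriv (\<lambda>z. fst (W z)) (\<lambda>z h. fst (W' z h))"
      using C1_deriv_compose[OF C1_deriv_linear[OF bounded_linear_fst] Wd(1)] by simp
    have fC: "C1c V (\<lambda>z. fst (W z))" by (rule C1cI[OF fWd cc_subset[OF Wd(2)]]) auto
    have i1: "integrable lebesgue (\<lambda>z. indicator V z * (v z * ediv (\<lambda>z. fst (W z)) z))"
      by (rule C1c_ediv_integrable_mult[OF fC v])
    have sb: "indicator V z * snd (W z) \<le> (\<bar>eps\<bar> + R) * indicator V z" for z
    proof (cases "z \<in> V")
      case True
      then have "z \<in> ball 0 R" using R(1) by blast
      then have nz: "norm z \<le> R" by simp
      have "\<bar>snd (W z)\<bar> \<le> heis_norm eps (z, 0) (W z) * (\<bar>eps\<bar> + norm z)"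
        using abs_snd_le_heis_norm[OF eps, of "W z" "(z, 0)"] by simp
      also have "\<dots> \<le> 1 * (\<bar>eps\<bar> + R)" using Wn[of z] nz by (intro mult_mono) auto
      finally show ?thesis using True by simp
    qed simp
    have Vi: "integrable lebesgue (indicator V :: 'n plane \<Rightarrow> real)" using Vm by simp
    have i2: "integrable lebesgue (\<lambda>z. indicator V z * snd (W z))"
    proof -
      have "integrable lebesgue (\<lambda>z. snd (W z))"
        by (rule integrable_compact_support(1)[OF continuous_on_snd[OF C1_deriv_D(5)[OF Wd(1)]] Wd(3)]) auto
      from integrable_mult_indicator[OF Vm(1) this] show ?thesis by simp
    qed
    have "(\<integral>z. indicator V z * snd (W z) \<partial>lebesgue) \<le> (\<integral>z. (\<bar>eps\<bar> + R) * indicator V z \<partial>lebesgue)"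
      using sb by (intro integral_mono i2 integrable_mult_right Vi) auto
    also have "\<dots> = M" by (simp add: M_def)
    finally have b2: "(\<integral>z. indicator V z * snd (W z) \<partial>lebesgue) \<le> M" .
    have "norm (fst (W z)) \<le> 1" for z using norm_fst_le_heis_norm[of "W z" eps "(z, 0)"] Wn[of z] by linarith
    then have b1: "ereal (\<integral>z. indicator V z * (v z * ediv (\<lambda>z. fst (W z)) z) \<partial>lebesgue) \<le> total_variation v V"
      unfolding total_variation_def LINT_indicator using fC
      by (intro SUP_upper2[of "\<lambda>z. fst (W z)"]) auto
    have "(\<integral>z. indicator V z * (v z * ediv (\<lambda>z. fst (W z)) z + snd (W z)) \<partial>lebesgue) =
        (\<integral>z. indicator V z * (v z * ediv (\<lambda>z. fst (W z)) z) \<partial>lebesgue) + (\<integral>z. indicator V z * snd (W z) \<partial>lebesgue)"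
      unfolding distrib_left by (rule Bochner_Integration.integral_add[OF i1 i2])
    then have "ereal (\<integral>z. indicator V z * (v z * ediv (\<lambda>z. fst (W z)) z + snd (W z)) \<partial>lebesgue) =
        ereal (\<integral>z. indicator V z * (v z * ediv (\<lambda>z. fst (W z)) z) \<partial>lebesgue) + ereal (\<integral>z. indicator V z * snd (W z) \<partial>lebesgue)"
      by simp
    also have "\<dots> \<le> total_variation v V + ereal M" using b1 b2 by (intro add_mono) auto
    finally show "ereal (\<integral>z. indicator V z * (v z * ediv (\<lambda>z. fst (W z)) z + snd (W z)) \<partial>lebesgue) \<le> total_variation v V + ereal M" .
  qed
  also have "\<dots> < \<infinity>" using tv by auto
  finally show ?thesis .
qed

text \<open>The converse comparison, needed to see that a rearranged competitor lies in
  \<open>BV_loc\<close>. Each competitor for the total variation is completed to a horizontal field,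
  at the price of a vertical term bounded by R.\<close>

lemma total_variation_finite:
  fixes V :: "'n::finite plane set"
  assumes V: "open V" "bounded V" and v: "integrable lebesgue (\<lambda>z. indicator V z * v z)"
    and ga: "graph_area eps v V < \<infinity>"
  shows "total_variation v V < \<infinity>"
proof -
  obtain R where R: "V \<subseteq> ball 0 R" "R > 0" using bounded_subset_ballD[OF V(2), of 0] by blast
  define M where "M = R * measure lebesgue V"
  have Vm: "V \<in> sets lebesgue" "emeasure lebesgue V < \<infinity>"
    using V emeasure_bounded_finite[OF V(2)] by auto
  have "total_variation v V \<le> graph_area eps v V + ereal M"
    unfolding total_variation_def
  proof (rule SUP_least)
    fix \<phi> :: "'n plane \<Rightarrow> 'n plane" assume "\<phi> \<in> {\<phi>. C1c V \<phi> \<and> (\<forall>z. norm (\<phi> z) \<le> 1)}"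
    then have \<phi>: "C1c V \<phi>" "\<And>z. norm (\<phi> z) \<le> 1" by auto
    obtain \<phi>' where d: "C1_deriv \<phi> \<phi>'" "cc {z. \<phi> z \<noteq> 0} V" "bounded {z. \<phi> z \<noteq> 0}" using \<phi>(1) by (rule C1cE)
    \<comment> \<open>With this vertical component the last frame coefficient of
      \<open>(\<phi> z, s z)\<close> is 0, so its Heisenberg norm is
      \<open>norm (\<phi> z)\<close>.\<close>
    define s where "s z = fst (\<phi> z) \<bullet> snd z - snd (\<phi> z) \<bullet> fst z" for z
    have "\<exists>s'. C1_deriv s s'" unfolding s_def
      using C1_deriv_diff[OF C1_deriv_inner[OF C1_deriv_compose[OF C1_deriv_linear[OF bounded_linear_fst] d(1)] C1_deriv_linear[OF bounded_linear_snd]]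
          C1_deriv_inner[OF C1_deriv_compose[OF C1_deriv_linear[OF bounded_linear_snd] d(1)] C1_deriv_linear[OF bounded_linear_fst]]] by blast
    then obtain s' where s': "C1_deriv s s'" by blast
    have "C1c V (\<lambda>z. (\<phi> z, s z))"
      by (rule C1cI[OF C1_deriv_Pair[OF d(1) s'] cc_subset[OF d(2)]]) (auto simp: s_def zero_prod_def)
    moreover have "heis_norm eps (z, 0) (\<phi> z, s z) \<le> 1" for z
      using \<phi>(2)[of z] by (simp add: heis_norm_frame heis_frame_def s_def norm_Pair)
    ultimately have "admissible_base eps V (\<lambda>z. (\<phi> z, s z))" by (simp add: admissible_base_def)
    from graph_area_upper[OF this, of v]
    have up: "ereal (\<integral>z. indicator V z * (v z * ediv \<phi> z + s z) \<partial>lebesgue) \<le> graph_area eps v V" by simp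
    have i1: "integrable lebesgue (\<lambda>z. indicator V z * (v z * ediv \<phi> z))"
      by (rule C1c_ediv_integrable_mult[OF \<phi>(1) v])
    have sb: "- R * indicator V z \<le> indicator V z * s z" for z
    proof (cases "z \<in> V")
      case True
      then have "z \<in> ball 0 R" using R(1) by blast
      then have nz: "norm z \<le> R" by simp
      have "\<bar>s z\<bar> \<le> norm (\<phi> z) * norm z" unfolding s_def by (rule symplectic_le)
      also have "\<dots> \<le> 1 * R" using \<phi>(2)[of z] nz by (intro mult_mono) auto
      finally show ?thesis using True by simp
    qed simp
    have Vi: "integrable lebesgue (indicator V :: 'n plane \<Rightarrow> real)" using Vm by simp
    have i2: "integrable lebesgue (\<lambda>z. indicator V z * s z)"
    proof -
      have "integrable lebesgue s"
        by (rule integrable_compact_support(1)[OF C1_deriv_D(5)[OF s'] d(3)]) (auto simp: s_def)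
      from integrable_mult_indicator[OF Vm(1) this] show ?thesis by simp
    qed
    have "- M = (\<integral>z. - R * indicator V z \<partial>lebesgue)" by (simp add: M_def)
    also have "\<dots> \<le> (\<integral>z. indicator V z * s z \<partial>lebesgue)"
      using sb by (intro integral_mono i2 integrable_mult_right Vi) auto
    finally have b2: "- M \<le> (\<integral>z. indicator V z * s z \<partial>lebesgue)" .
    have "(\<integral>z. indicator V z * (v z * ediv \<phi> z + s z) \<partial>lebesgue) =
        (\<integral>z. indicator V z * (v z * ediv \<phi> z) \<partial>lebesgue) + (\<integral>z. indicator V z * s z \<partial>lebesgue)"
      unfolding distrib_left by (rule Bochner_Integration.integral_add[OF i1 i2])
    then have "ereal (\<integral>z. indicator V z * (v z * ediv \<phi> z) \<partial>lebesgue)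
        \<le> ereal (\<integral>z. indicator V z * (v z * ediv \<phi> z + s z) \<partial>lebesgue) + ereal M" using b2 by simp
    also have "\<dots> \<le> graph_area eps v V + ereal M" by (intro add_mono up) simp
    finally show "ereal (LINT z:V|lebesgue. v z * ediv \<phi> z) \<le> graph_area eps v V + ereal M"
      unfolding LINT_indicator .
  qed
  also have "\<dots> < \<infinity>" using ga by auto
  finally show ?thesis .
qed

section \<open>Splicing two sets at a given height\<close>

text \<open>Two layers of thickness \<open>1 / j\<close>, where a cutoff with slope of order j
  varies; the product of slope and volume stays bounded as j grows.\<close>

lemma integral_slab:
  fixes S :: "'a::euclidean_space set" and s j :: real
  assumes S: "S \<in> sets lebesgue" "bounded S" and j: "j > 0"
  defines "f \<equiv> \<lambda>p. indicator S (fst p) * (indicator {- s..- s + 1 / j} (snd p) + indicator {s - 1 / j..s} (snd p))"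
  shows "integrable lebesgue f" "(\<integral>p. f p \<partial>lebesgue) = measure lebesgue S * (2 / j)"
proof -
  have m: "(\<lambda>p::'a \<times> real. indicator S (fst p) :: real) \<in> borel_measurable lebesgue"
    by (rule lebesgue_measurable_fst) (use S in simp)
  have m2: "(\<lambda>p::'a \<times> real. indicator {a..b} (snd p) :: real) \<in> borel_measurable lebesgue" for a b
    by (rule measurable_compose[OF lebesgue_measurable_snd]) simp
  show i: "integrable lebesgue f"
  proof (rule integrable_bounded_support)
    show "f \<in> borel_measurable lebesgue" unfolding f_def using m m2 by simp
    show "bounded (S \<times> cball 0 (\<bar>s\<bar> + 1 / j))" using S(2) by (intro bounded_Times) auto
    show "norm (f p) \<le> 2" for p by (auto simp: f_def indicator_def)
    show "f p = 0" if "p \<notin> S \<times> cball 0 (\<bar>s\<bar> + 1 / j)" for p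
    proof (rule ccontr)
      assume "f p \<noteq> 0"
      then have "fst p \<in> S" "(- s \<le> snd p \<and> snd p \<le> - s + 1 / j) \<or> (s - 1 / j \<le> snd p \<and> snd p \<le> s)"
        by (auto simp: f_def indicator_def split: if_splits)
      moreover have "1 / j > 0" using j by simp
      ultimately have "fst p \<in> S" "\<bar>snd p\<bar> \<le> \<bar>s\<bar> + 1 / j" by linarith+
      then show False using that by (cases p) auto
    qed
  qed
  have one: "(\<integral>t. indicator S z * (indicator {- s..- s + 1 / j} t + indicator {s - 1 / j..s} t) \<partial>lebesgue) = indicator S z * (2 / j)" for z
  proof -
    have "(\<integral>t. indicator {- s..- s + 1 / j} t + indicator {s - 1 / j..s} t \<partial>lebesgue) =
        (\<integral>t. indicator {- s..- s + 1 / j} t \<partial>lebesgue) + (\<integral>t. indicator {s - 1 / j..s} t \<partial>lebesgue :: real)"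
      by (intro Bochner_Integration.integral_add integrable_real_indicator) (auto simp: emeasure_lborel_Icc_eq)
    also have "\<dots> = 2 / j" using j by simp
    finally show ?thesis by simp
  qed
  show "(\<integral>p. f p \<partial>lebesgue) = measure lebesgue S * (2 / j)"
    unfolding lebesgue_Fubini(3)[OF i] unfolding f_def fst_conv snd_conv one by simp
qed

text \<open>A field is split vertically by a cutoff: the inner part is tested against G, the outer
  part against E, where \<open>tight\<close> applies. The derivative of the cutoff matters only over
  S, where G and E may differ in the layers: slope \<open>8 * j\<close>, vertical bound
  \<open>\<bar>eps\<bar> + R\<close> and layer volume \<open>measure lebesgue S * (2 / j)\<close>
  multiply to the last term for every j.\<close>

lemma Peps_spliced_le:
  fixes G E :: "'n::finite heis set"
  assumes eps: "eps \<noteq> 0" and V: "open V" "V \<subseteq> ball 0 R" and G: "G \<in> sets lebesgue" and E: "E \<in> sets lebesgue"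
    and S: "S \<in> sets lebesgue" "S \<subseteq> V"
    and diff: "\<And>z t. z \<in> V \<Longrightarrow> s - 1 \<le> \<bar>t\<bar> \<Longrightarrow> ((z, t) \<in> G) \<noteq> ((z, t) \<in> E) \<Longrightarrow> z \<in> S"
    and PG: "Peps eps G (V \<times> UNIV) \<le> ereal a"
    and tight: "\<And>U. admissible eps (V \<times> {t. \<bar>t\<bar> > s - 2}) U \<Longrightarrow> (\<integral>p. indicator E p * ediv U p \<partial>lebesgue) \<le> e"
  shows "Peps eps ((G \<inter> {p. \<bar>snd p\<bar> < s}) \<union> (E \<inter> {p. \<bar>snd p\<bar> \<ge> s})) (V \<times> UNIV)
    \<le> ereal (a + e + 16 * (\<bar>eps\<bar> + R) * measure lebesgue S)"
proof (rule Peps_least)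
  define F where "F = (G \<inter> {p. \<bar>snd p\<bar> < s}) \<union> (E \<inter> {p. \<bar>snd p\<bar> \<ge> s})"
  fix U assume U: "admissible eps (V \<times> UNIV) U"
  then have UC: "C1c (V \<times> UNIV) U" and Un: "\<And>p. heis_norm eps p (U p) \<le> 1" by (auto simp: admissible_def)
  obtain U' where u: "C1_deriv U U'" "cc {p. U p \<noteq> 0} (V \<times> UNIV)" "compact (closure {p. U p \<noteq> 0})" "bounded {p. U p \<noteq> 0}"
    using UC by (rule C1cE)
  have em: "ediv U \<in> borel_measurable lebesgue"
    by (rule continuous_imp_lebesgue_measurable[OF continuous_on_ediv[OF u(1)]])
  have tm: "(\<lambda>p::'n heis. tcut j s (snd p)) \<in> borel_measurable lebesgue" for j
    by (rule continuous_imp_lebesgue_measurable[OF C1_deriv_D(5)[OF C1_deriv_tcut_snd]])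
  have Sb: "bounded S" by (rule bounded_subset[OF bounded_ball subset_trans[OF S(2) V(2)]])
  define M where "M = measure lebesgue S"
  define Cu where "Cu = \<bar>eps\<bar> + R"
  \<comment> \<open>This interpolation replaces the indicator of the spliced set, its pointwise
    limit; the bound in \<open>step\<close> does not depend on n.\<close>
  define \<alpha> where "\<alpha> n p = indicator G p * tcut (real n + 1) s (snd p) + indicator E p * (1 - tcut (real n + 1) s (snd p))" for n and p :: "'n heis"
  have \<alpha>m: "\<alpha> n \<in> borel_measurable lebesgue" for n unfolding \<alpha>_def[abs_def] using G E tm by simp
  have \<alpha>b: "\<bar>\<alpha> n p\<bar> \<le> 2" for n p
    using tcut_bounds[of "real n + 1" s "snd p"] by (auto simp: \<alpha>_def indicator_def)
  have step: "(\<integral>p. \<alpha> n p * ediv U p \<partial>lebesgue) \<le> a + e + 16 * Cu * M" for n :: nat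
  proof -
    define j where "j = real n + 1"
    have j: "j > 0" "1 / j \<le> 1" by (auto simp: j_def)
    define X where "X p = tcut j s (snd p) *\<^sub>R U p" for p
    define Y where "Y p = U p - X p" for p
    have Xd: "C1_deriv X (\<lambda>p h. tcut j s (snd p) *\<^sub>R U' p h + (tcut' j s (snd p) * snd h) *\<^sub>R U p)"
      unfolding X_def[abs_def] by (rule C1_deriv_scaleR[OF C1_deriv_tcut_snd u(1)])
    note Yd = C1_deriv_diff[OF u(1) Xd]
    have eX: "ediv X p = tcut j s (snd p) * ediv U p + tcut' j s (snd p) * snd (U p)" for p
      unfolding X_def[abs_def] by (rule ediv_tcut[OF u(1)])
    have eY: "ediv Y p = ediv U p - ediv X p" for p unfolding Y_def[abs_def] by (rule ediv_diff[OF u(1) Xd])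
    have XC: "C1c (V \<times> UNIV) X" by (rule C1cI[OF Xd cc_subset[OF u(2)]]) (auto simp: X_def)
    have Xa: "admissible eps (V \<times> UNIV) X"
      unfolding admissible_def using XC heis_norm_scale_le[OF tcut_bounds Un] by (simp add: X_def)
    have Yeq: "Y p = (1 - tcut j s (snd p)) *\<^sub>R U p" for p by (simp add: Y_def X_def scaleR_diff_left)
    have YC: "C1c (V \<times> {t. \<bar>t\<bar> > s - 2}) Y"
    proof -
      \<comment> \<open>Y lives where the cutoff is not 1, hence at
        \<open>\<bar>t\<bar> \<ge> s - 1\<close> since \<open>1 / j \<le> 1\<close>. The unit gap to
        the level \<open>s - 2\<close> of \<open>tight\<close> makes the containment
        compact.\<close>
      define Q where "Q = closure {p. U p \<noteq> 0} \<inter> {p. \<bar>snd p\<bar> \<ge> s - 1}"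
      have "closed {p::'n heis. \<bar>snd p\<bar> \<ge> s - 1}" by (intro closed_Collect_le continuous_intros)
      then have Q: "compact Q" unfolding Q_def using u(3) by (rule compact_Int_closed[rotated])
      have "{p. Y p \<noteq> 0} \<subseteq> Q"
      proof
        fix p assume "p \<in> {p. Y p \<noteq> 0}"
        then have ne: "tcut j s (snd p) \<noteq> 1" "U p \<noteq> 0" by (auto simp: Yeq)
        then have "\<not> \<bar>snd p\<bar> \<le> s - 1 / j" using tcut_1(1)[OF j(1)] by blast
        then have "\<bar>snd p\<bar> \<ge> s - 1" using j(2) by linarith
        then show "p \<in> Q" unfolding Q_def using ne(2) closure_subset[of "{p. U p \<noteq> 0}"] by blast
      qed
      moreover have "Q \<subseteq> V \<times> {t. \<bar>t\<bar> > s - 2}"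
        using u(2) unfolding Q_def cc_def by fastforce
      ultimately have "cc {p. Y p \<noteq> 0} (V \<times> {t. \<bar>t\<bar> > s - 2})" using Q by (intro cc_compactI)
      then show ?thesis unfolding Y_def by (rule C1cI[OF Yd])
    qed
    have Ya: "admissible eps (V \<times> {t. \<bar>t\<bar> > s - 2}) Y"
    proof -
      have "heis_norm eps p (Y p) \<le> 1" for p
        unfolding Yeq using tcut_bounds[of j s "snd p"] by (intro heis_norm_scale_le Un) auto
      then show ?thesis using YC by (simp add: admissible_def)
    qed
    have "ereal (\<integral>p. indicator G p * ediv X p \<partial>lebesgue) \<le> ereal a" using Peps_upper[OF Xa] PG order_trans by blast
    then have b1: "(\<integral>p. indicator G p * ediv X p \<partial>lebesgue) \<le> a" by simp
    have b2: "(\<integral>p. indicator E p * ediv Y p \<partial>lebesgue) \<le> e" by (rule tight[OF Ya])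
    define f where "f p = indicator S (fst p) * (indicator {- s..- s + 1 / j} (snd p) + indicator {s - 1 / j..s} (snd p) :: real)" for p :: "'n heis"
    have f: "integrable lebesgue f" "(\<integral>p. f p \<partial>lebesgue) = M * (2 / j)"
      using integral_slab[OF S(1) Sb j(1), of s] unfolding f_def[abs_def] M_def by auto
    have pt: "\<alpha> n p * ediv U p \<le> indicator G p * ediv X p + indicator E p * ediv Y p + 8 * j * Cu * f p" for p
    proof -
      obtain z t where p: "p = (z, t)" by fastforce
      \<comment> \<open>The product rule leaves one extra term: the derivative of the cutoff times
        the difference of the two indicators.\<close>
      have id: "\<alpha> n p * ediv U p = indicator G p * ediv X p + indicator E p * ediv Y p
          + (indicator E p - indicator G p) * (tcut' j s t * snd (U p))"
        unfolding eX eY \<alpha>_def j_def[symmetric] by (simp add: p algebra_simps)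
      have "(indicator E p - indicator G p) * (tcut' j s t * snd (U p)) \<le> 8 * j * Cu * f p"
      proof (cases "(indicator E p - indicator G p :: real) \<noteq> 0 \<and> tcut' j s t \<noteq> 0 \<and> U p \<noteq> 0")
        case True
        have zV: "z \<in> V" using True u(2) closure_subset[of "{p. U p \<noteq> 0}"] unfolding cc_def p by blast
        have t1: "\<bar>t\<bar> < s" using True tcut_0(2)[OF j(1), of s t] by fastforce
        have t2: "\<not> \<bar>t\<bar> \<le> s - 1 / j" using True tcut_1(2)[OF j(1)] by blast
        have "s - 1 \<le> \<bar>t\<bar>" using t2 j(2) by linarith
        moreover have "((z, t) \<in> G) \<noteq> ((z, t) \<in> E)" using True by (auto simp: p indicator_def)
        ultimately have "z \<in> S" by (rule diff[OF zV])
        moreover have "(- s \<le> t \<and> t \<le> - s + 1 / j) \<or> (s - 1 / j \<le> t \<and> t \<le> s)" using t1 t2 by linarith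
        ultimately have f1: "f p \<ge> 1" by (auto simp: f_def p indicator_def)
        have "z \<in> ball 0 R" using zV V(2) by blast
        then have zR: "norm z \<le> R" by simp
        have "\<bar>snd (U p)\<bar> \<le> heis_norm eps p (U p) * (\<bar>eps\<bar> + norm z)"
          using abs_snd_le_heis_norm[OF eps, of "U p" p] by (simp add: p)
        also have "\<dots> \<le> 1 * Cu" unfolding Cu_def using Un[of p] zR by (intro mult_mono) auto
        finally have sn: "\<bar>snd (U p)\<bar> \<le> Cu" by simp
        have Cu0: "Cu \<ge> 0" using sn by linarith
        have "\<bar>indicator E p - indicator G p :: real\<bar> \<le> 1" by (auto simp: indicator_def)
        then have "\<bar>indicator E p - indicator G p :: real\<bar> * (\<bar>tcut' j s t\<bar> * \<bar>snd (U p)\<bar>) \<le> 1 * (8 * j * Cu)"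
          using tcut'_bound[OF j(1), of s t] sn j(1) by (intro mult_mono) auto
        also have "\<dots> \<le> 8 * j * Cu * f p" using mult_left_mono[OF f1, of "8 * j * Cu"] j(1) Cu0 by simp
        finally show ?thesis by (simp add: abs_mult[symmetric])
      next
        case False
        then have "(indicator E p - indicator G p) * (tcut' j s t * snd (U p)) = 0" by auto
        moreover have "0 \<le> 8 * j * Cu * f p"
        proof (cases "z \<in> S")
          case True
          then have "norm z < R" using S(2) V(2) by auto
          then have "R \<ge> 0" using norm_ge_zero[of z] by linarith
          then show ?thesis using j(1) by (auto simp: Cu_def f_def)
        qed (simp add: f_def p)
        ultimately show ?thesis by linarith
      qed
      then show ?thesis unfolding id by simp
    qed
    have iX: "integrable lebesgue (\<lambda>p. indicator G p * ediv X p)" by (rule C1c_ediv_set_integrable[OF XC G])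
    have iY: "integrable lebesgue (\<lambda>p. indicator E p * ediv Y p)" by (rule C1c_ediv_set_integrable[OF YC E])
    have "(\<integral>p. \<alpha> n p * ediv U p \<partial>lebesgue) \<le> (\<integral>p. indicator G p * ediv X p + indicator E p * ediv Y p + 8 * j * Cu * f p \<partial>lebesgue)"
      by (intro integral_mono pt C1c_ediv_integrable[OF UC \<alpha>m \<alpha>b] Bochner_Integration.integrable_add iX iY integrable_mult_right f)
    also have "\<dots> = (\<integral>p. indicator G p * ediv X p \<partial>lebesgue) + (\<integral>p. indicator E p * ediv Y p \<partial>lebesgue) + 8 * j * Cu * (M * (2 / j))"
      using iX iY f by simp
    also have "8 * j * Cu * (M * (2 / j)) = 16 * Cu * M" using j(1) by simp
    finally show ?thesis using b1 b2 by linarith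
  qed
  have lim: "(\<lambda>n. \<integral>p. \<alpha> n p * ediv U p \<partial>lebesgue) \<longlonglongrightarrow> (\<integral>p. indicator F p * ediv U p \<partial>lebesgue)"
  proof (rule integral_dominated_convergence[where w="\<lambda>p. 2 * \<bar>1 * ediv U p\<bar>"])
    have Fm: "F \<in> sets lebesgue"
    proof -
      have "open {p::'n heis. \<bar>snd p\<bar> < s}" "closed {p::'n heis. \<bar>snd p\<bar> \<ge> s}"
        by (intro open_Collect_less closed_Collect_le continuous_intros)+
      then have "{p::'n heis. \<bar>snd p\<bar> < s} \<in> sets lebesgue" "{p::'n heis. \<bar>snd p\<bar> \<ge> s} \<in> sets lebesgue"
        by (auto intro: borel_open borel_closed)
      then show ?thesis unfolding F_def using G E by auto
    qed
    then show "(\<lambda>p. indicator F p * ediv U p) \<in> borel_measurable lebesgue" using em by simp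
    show "(\<lambda>p. \<alpha> n p * ediv U p) \<in> borel_measurable lebesgue" for n using \<alpha>m em by simp
    show "integrable lebesgue (\<lambda>p. 2 * \<bar>1 * ediv U p\<bar>)"
      by (intro integrable_mult_right integrable_abs C1c_ediv_integrable[OF UC, of _ 1]) auto
    show "AE p in lebesgue. norm (\<alpha> n p * ediv U p) \<le> 2 * \<bar>1 * ediv U p\<bar>" for n
      using \<alpha>b by (intro AE_I2) (simp add: abs_mult mult_right_mono)
    show "AE p in lebesgue. (\<lambda>n. \<alpha> n p * ediv U p) \<longlonglongrightarrow> indicator F p * ediv U p"
    proof (rule AE_I2)
      fix p :: "'n heis"
      have "eventually (\<lambda>n. \<alpha> n p = indicator F p) sequentially"
      proof (cases "\<bar>snd p\<bar> < s")
        case True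
        then obtain N where N: "inverse (real (Suc N)) < s - \<bar>snd p\<bar>" using reals_Archimedean[of "s - \<bar>snd p\<bar>"] by auto
        show ?thesis
          using eventually_ge_at_top[of N]
        proof eventually_elim
          case (elim n)
          have "1 / (real n + 1) \<le> inverse (real (Suc N))" using elim by (simp add: field_simps)
          then have "tcut (real n + 1) s (snd p) = 1" using N by (intro tcut_1(1)) auto
          then show ?case using True by (simp add: \<alpha>_def F_def indicator_def)
        qed
      next
        case False
        then have "tcut (real n + 1) s (snd p) = 0" for n by (intro tcut_0(1)) auto
        then show ?thesis using False by (simp add: \<alpha>_def F_def indicator_def)
      qed
      then have "eventually (\<lambda>n. \<alpha> n p * ediv U p = indicator F p * ediv U p) sequentially"
        by eventually_elim simp
      then show "(\<lambda>n. \<alpha> n p * ediv U p) \<longlonglongrightarrow> indicator F p * ediv U p" by (rule tendsto_eventually)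
    qed
  qed
  have "(\<integral>p. indicator F p * ediv U p \<partial>lebesgue) \<le> a + e + 16 * Cu * M"
    by (rule LIMSEQ_le_const2[OF lim]) (use step in blast)
  then show "ereal (\<integral>p. indicator ((G \<inter> {p. \<bar>snd p\<bar> < s}) \<union> (E \<inter> {p. \<bar>snd p\<bar> \<ge> s})) p * ediv U p \<partial>lebesgue)
      \<le> ereal (a + e + 16 * (\<bar>eps\<bar> + R) * measure lebesgue S)"
    by (simp add: F_def Cu_def M_def)
qed

text \<open>A nearly optimal U0 has compact support, hence lies below some height T. A field above T
  has disjoint support, so its sum with U0 is still admissible; since the sum yields at most a,
  little is left for the field above.\<close>

lemma Peps_tight:
  fixes E :: "'n::finite heis set"
  assumes E: "E \<in> sets lebesgue" and fin: "Peps eps E (V \<times> UNIV) = ereal a" and e: "e > 0"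
  obtains U0 T where "admissible eps (V \<times> {t. \<bar>t\<bar> < T}) U0" "a - e < (\<integral>p. indicator E p * ediv U0 p \<partial>lebesgue)"
    "\<And>U. admissible eps (V \<times> {t. \<bar>t\<bar> > T}) U \<Longrightarrow> (\<integral>p. indicator E p * ediv U p \<partial>lebesgue) \<le> e"
proof -
  have "ereal (a - e) < Peps eps E (V \<times> UNIV)" using fin e by simp
  then obtain U0 where U0: "admissible eps (V \<times> UNIV) U0" "a - e < (\<integral>p. indicator E p * ediv U0 p \<partial>lebesgue)"
    unfolding Peps_eq less_SUP_iff by auto
  have C0: "C1c (V \<times> UNIV) U0" using U0(1) by (simp add: admissible_def)
  obtain U0' where u: "C1_deriv U0 U0'" "cc {p. U0 p \<noteq> 0} (V \<times> UNIV)" "compact (closure {p. U0 p \<noteq> 0})"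
    using C0 by (rule C1cE)
  obtain T where T: "closure {p. U0 p \<noteq> 0} \<subseteq> ball 0 T" using bounded_subset_ballD[OF compact_imp_bounded[OF u(3)], of 0] by blast
  have tT: "\<bar>snd p\<bar> < T" if "p \<in> closure {p. U0 p \<noteq> 0}" for p
  proof -
    have "norm p < T" using T that by auto
    then show ?thesis using norm_snd_le[of "snd p" "fst p"] by simp
  qed
  have "cc {p. U0 p \<noteq> 0} (V \<times> {t. \<bar>t\<bar> < T})"
    unfolding cc_def
  proof (intro conjI u(3) subsetI)
    fix p assume p: "p \<in> closure {p. U0 p \<noteq> 0}"
    have "p \<in> V \<times> UNIV" using u(2) p unfolding cc_def by blast
    then show "p \<in> V \<times> {t. \<bar>t\<bar> < T}" using tT[OF p] by (cases p) auto
  qed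
  then have "C1c (V \<times> {t. \<bar>t\<bar> < T}) U0" by (rule C1cI[OF u(1)])
  then have 1: "admissible eps (V \<times> {t. \<bar>t\<bar> < T}) U0" using U0(1) by (simp add: admissible_def)
  have "(\<integral>p. indicator E p * ediv U p \<partial>lebesgue) \<le> e" if U: "admissible eps (V \<times> {t. \<bar>t\<bar> > T}) U" for U
  proof -
    have C: "C1c (V \<times> {t. \<bar>t\<bar> > T}) U" using U by (simp add: admissible_def)
    obtain U' where w: "C1_deriv U U'" "cc {p. U p \<noteq> 0} (V \<times> {t. \<bar>t\<bar> > T})" using C by (rule C1cE)
    have disj: "U0 p = 0 \<or> U p = 0" for p
    proof (rule ccontr)
      assume "\<not> (U0 p = 0 \<or> U p = 0)"
      then have "p \<in> closure {p. U0 p \<noteq> 0}" "p \<in> closure {p. U p \<noteq> 0}"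
        using closure_subset[of "{p. U0 p \<noteq> 0}"] closure_subset[of "{p. U p \<noteq> 0}"] by blast+
      then show False using tT[of p] w(2) unfolding cc_def by force
    qed
    have "C1c (V \<times> UNIV) (\<lambda>p. U0 p + U p)"
    proof (rule C1cI[OF C1_deriv_add[OF u(1) w(1)]])
      have "cc {p. U p \<noteq> 0} (V \<times> UNIV)" by (rule cc_mono[OF w(2)]) auto
      from cc_Un[OF u(2) this] show "cc {p. U0 p + U p \<noteq> 0} (V \<times> UNIV)" by (rule cc_subset) auto
    qed
    moreover have "heis_norm eps p (U0 p + U p) \<le> 1" for p
    proof -
      have "heis_norm eps p (U0 p) \<le> 1" "heis_norm eps p (U p) \<le> 1" using U0(1) U unfolding admissible_def by blast+
      then show ?thesis using disj[of p] by auto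
    qed
    ultimately have "admissible eps (V \<times> UNIV) (\<lambda>p. U0 p + U p)" by (simp add: admissible_def)
    from Peps_upper[OF this, of E] fin
    have "(\<integral>p. indicator E p * ediv (\<lambda>p. U0 p + U p) p \<partial>lebesgue) \<le> a" by simp
    moreover have "(\<integral>p. indicator E p * ediv (\<lambda>p. U0 p + U p) p \<partial>lebesgue) =
        (\<integral>p. indicator E p * ediv U0 p \<partial>lebesgue) + (\<integral>p. indicator E p * ediv U p \<partial>lebesgue)"
      unfolding ediv_add[OF u(1) w(1)] distrib_left
      by (rule Bochner_Integration.integral_add[OF C1c_ediv_set_integrable[OF C0 E] C1c_ediv_set_integrable[OF C E]])
    ultimately show ?thesis using U0(2) by linarith
  qed
  then show ?thesis using that[OF 1 U0(2)] by blast
qed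

section \<open>Locally integrable functions and their subgraphs\<close>

text \<open>\<open>L1_loc\<close> speaks of compact subsets; a compact exhaustion of the open set
  turns this into measurability on all of \<Omega>.\<close>

lemma L1_loc_measurable:
  fixes \<Omega> :: "'a::euclidean_space set"
  assumes "open \<Omega>" "L1_loc \<Omega> u"
  shows "(\<lambda>z. indicator \<Omega> z * u z) \<in> borel_measurable lebesgue"
proof -
  obtain C :: "nat \<Rightarrow> 'a set" where C: "\<And>n. compact (C n)" "\<And>n. C n \<subseteq> \<Omega>"
    "\<And>K. compact K \<Longrightarrow> K \<subseteq> \<Omega> \<Longrightarrow> \<exists>N. \<forall>n\<ge>N. K \<subseteq> C n"
    by (rule open_Union_compact_subsets[OF assms(1)]) blast
  have m: "(\<lambda>z. indicator (C n) z * u z) \<in> borel_measurable lebesgue" for n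
    using assms(2) C(1,2)[of n] unfolding L1_loc_def set_integrable_def
    by (auto dest!: spec[of _ "C n"] borel_measurable_integrable)
  show ?thesis
  proof (rule borel_measurable_LIMSEQ_real[OF _ m])
    fix z
    have "eventually (\<lambda>n. indicator (C n) z * u z = indicator \<Omega> z * u z) sequentially"
    proof (cases "z \<in> \<Omega>")
      case True
      then obtain N where "\<forall>n\<ge>N. {z} \<subseteq> C n" using C(3)[of "{z}"] by auto
      then have "\<forall>n\<ge>N. indicator (C n) z * u z = indicator \<Omega> z * u z" using True by simp
      then show ?thesis unfolding eventually_sequentially by blast
    next
      case False
      then have "z \<notin> C n" for n using C(2) by blast
      then show ?thesis using False by simp
    qed
    then show "(\<lambda>n. indicator (C n) z * u z) \<longlonglongrightarrow> indicator \<Omega> z * u z" by (rule tendsto_eventually)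
  qed
qed

lemma L1_loc_integrable:
  fixes \<Omega> :: "'a::euclidean_space set"
  assumes "L1_loc \<Omega> u" "open V" "cc V \<Omega>"
  shows "integrable lebesgue (\<lambda>z. indicator V z * u z)"
proof -
  have "integrable lebesgue (\<lambda>z. indicator (closure V) z *\<^sub>R u z)"
    using assms unfolding L1_loc_def set_integrable_def cc_def by blast
  then have "integrable lebesgue (\<lambda>z. indicator V z *\<^sub>R (indicator (closure V) z *\<^sub>R u z))"
    by (rule integrable_mult_indicator[rotated]) (use assms(2) in simp)
  moreover have "indicator V z *\<^sub>R (indicator (closure V) z *\<^sub>R u z) = indicator V z * u z" for z
    using closure_subset[of V] by (auto simp: indicator_def)
  ultimately show ?thesis by (simp only:)
qed

lemma subgraph_measurable:
  fixes \<Omega> :: "'n::finite plane set"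
  assumes "open \<Omega>" "L1_loc \<Omega> u"
  shows "subgraph \<Omega> u \<in> sets lebesgue"
proof -
  have "{p \<in> space lebesgue. snd p < indicator \<Omega> (fst p) * u (fst p)} \<in> sets (lebesgue :: 'n heis measure)"
    by (rule borel_measurable_less[OF lebesgue_measurable_snd lebesgue_measurable_fst[OF L1_loc_measurable[OF assms]]])
  moreover have "\<Omega> \<times> (UNIV::real set) \<in> sets lebesgue"
    using assms(1) by (intro sets_completionI_sets) (simp add: open_Times)
  moreover have "subgraph \<Omega> u = (\<Omega> \<times> UNIV) \<inter> {p \<in> space lebesgue. snd p < indicator \<Omega> (fst p) * u (fst p)}"
    by (auto simp: subgraph_def)
  ultimately show ?thesis by auto
qed

lemma indicator_subgraph:
  assumes "z \<in> \<Omega>" shows "indicator (subgraph \<Omega> u) (z, t) = below (indicator \<Omega> z * u z) t"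
  using assms by (simp add: subgraph_def indicator_def below_def)

section \<open>Weighted volume terms\<close>

lemma AE_lebesgue_fst:
  fixes P :: "'a::euclidean_space \<Rightarrow> bool"
  assumes "AE z in lebesgue. P z"
  shows "AE p in (lebesgue :: ('a \<times> 'b::euclidean_space) measure). P (fst p)"
proof -
  obtain N where N: "N \<in> null_sets lborel" "{z. \<not> P z} \<subseteq> N"
    using assms unfolding AE_completion_iff by (auto elim!: AE_E simp: null_sets_def)
  have "N \<times> (UNIV::'b set) \<in> null_sets lborel" by (rule null_sets_Times_UNIV[OF N(1)])
  then have "AE p in (lborel :: ('a \<times> 'b) measure). p \<notin> N \<times> UNIV" by (rule AE_not_in)
  then have "AE p in (lborel :: ('a \<times> 'b) measure). P (fst p)"
    by eventually_elim (use N(2) in \<open>auto simp: mem_Times_iff\<close>)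
  then show ?thesis by (rule AE_completion)
qed

lemma integrable_AE_bounded_mult:
  fixes h f :: "'a \<Rightarrow> real"
  assumes h: "h \<in> borel_measurable M" "AE x in M. \<bar>h x\<bar> \<le> C" and f: "integrable M f"
  shows "integrable M (\<lambda>x. h x * f x)"
proof (rule Bochner_Integration.integrable_bound[OF integrable_mult_right[OF f, of C]])
  show "(\<lambda>x. h x * f x) \<in> borel_measurable M" using h f by simp
  show "AE x in M. norm (h x * f x) \<le> norm (C * f x)"
    using h(2) by eventually_elim (auto simp: abs_mult intro!: mult_right_mono)
qed

lemma Linf_loc_weight:
  fixes \<Omega> :: "'a::euclidean_space set"
  assumes "Linf_loc \<Omega> H" "open V" "cc V \<Omega>"
  obtains C where "(\<lambda>z. indicator V z * H z) \<in> borel_measurable lebesgue"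
    "AE z in lebesgue. \<bar>indicator V z * H z\<bar> \<le> C"
proof -
  obtain C where C: "AE z in lebesgue. z \<in> closure V \<longrightarrow> \<bar>H z\<bar> \<le> C"
    using assms unfolding Linf_loc_def cc_def by blast
  have "(\<lambda>z. indicator \<Omega> z * H z) \<in> borel_measurable lebesgue"
    using assms(1) by (simp add: Linf_loc_def set_borel_measurable_def)
  moreover have "(indicator V :: 'a \<Rightarrow> real) \<in> borel_measurable lebesgue"
    using assms(2) by (intro borel_measurable_indicator) auto
  ultimately have "(\<lambda>z. indicator V z * (indicator \<Omega> z * H z)) \<in> borel_measurable lebesgue"
    by (rule borel_measurable_times[rotated])
  moreover have "V \<subseteq> \<Omega>" using assms(3) closure_subset[of V] unfolding cc_def by blast
  then have "(\<lambda>z. indicator V z * (indicator \<Omega> z * H z)) = (\<lambda>z. indicator V z * H z)"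
    by (intro ext) (auto simp: indicator_def)
  ultimately have m: "(\<lambda>z. indicator V z * H z) \<in> borel_measurable lebesgue" by simp
  \<comment> \<open>The maximum with 0 covers the points outside V, where the weight is 0 while C
    may be negative.\<close>
  have "AE z in lebesgue. \<bar>indicator V z * H z\<bar> \<le> max 0 C"
    using C by eventually_elim (use closure_subset[of V] in \<open>auto simp: indicator_def\<close>)
  then show ?thesis using that m by blast
qed

lemma weighted_integral:
  fixes \<Omega> :: "'a::euclidean_space set"
  assumes "Linf_loc \<Omega> H" and V: "open V" "cc V \<Omega>" and f: "L1_loc \<Omega> f"
  shows "integrable lebesgue (\<lambda>z. indicator V z * H z * f z)"
    "(LINT z:V|lebesgue. H z * f z) = (\<integral>z. indicator V z * H z * f z \<partial>lebesgue)"
proof -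
  obtain C where h: "(\<lambda>z. indicator V z * H z) \<in> borel_measurable lebesgue"
    "AE z in lebesgue. \<bar>indicator V z * H z\<bar> \<le> C"
    using Linf_loc_weight[OF assms(1) V] by blast
  have "indicator V z * H z * (indicator V z * f z) = indicator V z * H z * f z" for z
    by (auto simp: indicator_def)
  then show "integrable lebesgue (\<lambda>z. indicator V z * H z * f z)"
    using integrable_AE_bounded_mult[OF h L1_loc_integrable[OF f V]] by (simp only:)
  show "(LINT z:V|lebesgue. H z * f z) = (\<integral>z. indicator V z * H z * f z \<partial>lebesgue)"
    by (simp add: LINT_indicator mult.assoc)
qed

lemma weighted_set_integral:
  fixes \<Omega> :: "'a::euclidean_space set" and A Q :: "('a \<times> 'b::euclidean_space) set"
  assumes "Linf_loc \<Omega> H" "open V" "cc V \<Omega>" and Q: "Q \<in> sets lebesgue"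
    and A: "open A" "bounded A" "A \<subseteq> V \<times> UNIV"
  shows "integrable lebesgue (\<lambda>p. indicator V (fst p) * H (fst p) * indicator (Q \<inter> A) p)"
    "(LINT p:(Q \<inter> A)|lebesgue. H (fst p)) =
      (\<integral>p. indicator V (fst p) * H (fst p) * indicator (Q \<inter> A) p \<partial>lebesgue)"
proof -
  obtain C where h: "(\<lambda>z. indicator V z * H z) \<in> borel_measurable lebesgue"
    "AE z in lebesgue. \<bar>indicator V z * H z\<bar> \<le> C"
    using Linf_loc_weight[OF assms(1-3)] by blast
  have "A \<in> sets lebesgue" using A(1) by auto
  then have QA: "Q \<inter> A \<in> sets lebesgue" using Q by (rule sets.Int[rotated])
  have "integrable lebesgue (indicator (Q \<inter> A) :: 'a \<times> 'b \<Rightarrow> real)"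
    by (rule integrable_bounded_support[where S=A and C=1]) (use A(2) QA in \<open>auto simp: indicator_def\<close>)
  then show "integrable lebesgue (\<lambda>p. indicator V (fst p) * H (fst p) * indicator (Q \<inter> A) p)"
    by (rule integrable_AE_bounded_mult[OF lebesgue_measurable_fst[OF h(1)] AE_lebesgue_fst[OF h(2)]])
  have "indicator (Q \<inter> A) p * H (fst p) = indicator V (fst p) * H (fst p) * indicator (Q \<inter> A) p" for p
    using A(3) by (auto simp: indicator_def)
  then show "(LINT p:(Q \<inter> A)|lebesgue. H (fst p)) =
      (\<integral>p. indicator V (fst p) * H (fst p) * indicator (Q \<inter> A) p \<partial>lebesgue)"
    unfolding LINT_indicator by (simp only:)
qed

text \<open>Dominated convergence on V, of finite measure: as a and b are real-valued, each point
  leaves the superlevel sets eventually.\<close>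

lemma measure_superlevel_tendsto_0:
  fixes a b :: "'a::euclidean_space \<Rightarrow> real"
  assumes m: "a \<in> borel_measurable lebesgue" "b \<in> borel_measurable lebesgue"
    and V: "V \<in> sets lebesgue" "bounded V"
  shows "(\<lambda>n. measure lebesgue {z \<in> V. real n \<le> \<bar>a z\<bar> \<or> real n \<le> \<bar>b z\<bar>}) \<longlonglongrightarrow> 0"
    "{z \<in> V. c \<le> \<bar>a z\<bar> \<or> c \<le> \<bar>b z\<bar>} \<in> sets lebesgue"
proof -
  define S where "S c = {z \<in> V. c \<le> \<bar>a z\<bar> \<or> c \<le> \<bar>b z\<bar>}" for c
  have S: "S c \<in> sets lebesgue" for c
  proof -
    have "{z \<in> space lebesgue. c \<le> \<bar>a z\<bar> \<or> c \<le> \<bar>b z\<bar>} \<in> sets lebesgue" using m by measurable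
    moreover have "S c = V \<inter> {z \<in> space lebesgue. c \<le> \<bar>a z\<bar> \<or> c \<le> \<bar>b z\<bar>}" by (auto simp: S_def)
    ultimately show ?thesis using V(1) by auto
  qed
  then show "{z \<in> V. c \<le> \<bar>a z\<bar> \<or> c \<le> \<bar>b z\<bar>} \<in> sets lebesgue" by (simp add: S_def)
  have "(\<lambda>n. \<integral>z. indicator (S (real n)) z \<partial>lebesgue) \<longlonglongrightarrow> (\<integral>z. 0 \<partial>(lebesgue::'a measure) :: real)"
  proof (rule integral_dominated_convergence[where w="indicator V"])
    show "integrable lebesgue (indicator V :: 'a \<Rightarrow> real)"
      using V by (intro integrable_bounded_support[where S=V and C=1]) (auto simp: indicator_def)
    show "AE z in lebesgue. (\<lambda>n. indicator (S (real n)) z) \<longlonglongrightarrow> (0::real)"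
    proof (rule AE_I2)
      fix z
      obtain N where N: "max \<bar>a z\<bar> \<bar>b z\<bar> < real N" using reals_Archimedean2 by blast
      have "eventually (\<lambda>n. indicator (S (real n)) z = (0::real)) sequentially"
        using eventually_ge_at_top[of N] by eventually_elim (use N in \<open>auto simp: S_def indicator_def\<close>)
      then show "(\<lambda>n. indicator (S (real n)) z) \<longlonglongrightarrow> (0::real)" by (rule tendsto_eventually)
    qed
    show "(indicator (S (real n)) :: 'a \<Rightarrow> real) \<in> borel_measurable lebesgue" for n using S by simp
    show "AE z in lebesgue. norm (indicator (S (real n)) z :: real) \<le> indicator V z" for n
      by (rule AE_I2) (auto simp: S_def indicator_def)
  qed simp
  then show "(\<lambda>n. measure lebesgue {z \<in> V. real n \<le> \<bar>a z\<bar> \<or> real n \<le> \<bar>b z\<bar>}) \<longlonglongrightarrow> 0"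
    by (simp add: S_def)
qed

lemma Peps_subgraph_finite:
  fixes \<Omega> :: "'n::finite plane set"
  assumes "eps \<noteq> 0" "BV_loc \<Omega> u" "open V" "cc V \<Omega>"
  shows "Peps eps (subgraph \<Omega> u) (V \<times> UNIV) \<le> graph_area eps u V" "graph_area eps u V < \<infinity>"
proof -
  have i: "integrable lebesgue (\<lambda>z. indicator V z * u z)"
    using assms by (intro L1_loc_integrable[of \<Omega>]) (auto simp: BV_loc_def)
  have sub: "V \<subseteq> \<Omega>" using assms(4) closure_subset[of V] unfolding cc_def by blast
  show "Peps eps (subgraph \<Omega> u) (V \<times> UNIV) \<le> graph_area eps u V"
    by (rule Peps_le_graph_area[OF assms(1,3) i]) (use sub in \<open>auto simp: subgraph_def\<close>)
  have "bounded V" using assms(4) unfolding cc_def compact_closure by blast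
  then show "graph_area eps u V < \<infinity>"
    using assms by (intro graph_area_finite i) (auto simp: BV_loc_def)
qed

lemma integrable_below_diff: "integrable lebesgue (\<lambda>t. below a t - below b t)"
  unfolding below_diff_cases by (cases "b \<le> a") simp_all

section \<open>The two implications\<close>

text \<open>Minimality of u over the shadow V of A compares perimeters in
  \<open>V \<times> UNIV\<close>; the exchange inequality brings the comparison down to A.
  Cancelling requires all four perimeters to be finite, which is derived once
  \<open>Peps eps F A\<close> is finite.\<close>

lemma graph_minimizer_imp_set_minimizer:
  fixes \<Omega> :: "'n::finite plane set"
  assumes eps: "eps \<noteq> 0" and \<Omega>: "open \<Omega>" and H: "Linf_loc \<Omega> H" and u: "BV_loc \<Omega> u"
    and min: "\<And>\<Omega>' v. open \<Omega>' \<Longrightarrow> cc \<Omega>' \<Omega> \<Longrightarrow> BV_loc \<Omega> v \<Longrightarrow> cc {z\<in>\<Omega>. u z \<noteq> v z} \<Omega>' \<Longrightarrow>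
            Peps eps (subgraph \<Omega> u) (\<Omega>' \<times> UNIV) + ereal (LINT z:\<Omega>'|lebesgue. H z * u z)
            \<le> Peps eps (subgraph \<Omega> v) (\<Omega>' \<times> UNIV) + ereal (LINT z:\<Omega>'|lebesgue. H z * v z)"
    and A: "open A" "cc A (\<Omega> \<times> UNIV)" and F: "F \<in> sets lebesgue"
    and EF: "cc ((subgraph \<Omega> u - F) \<union> (F - subgraph \<Omega> u)) A"
  shows "Peps eps (subgraph \<Omega> u) A + ereal (LINT p:(subgraph \<Omega> u \<inter> A)|lebesgue. H (fst p))
            \<le> Peps eps F A + ereal (LINT p:(F \<inter> A)|lebesgue. H (fst p))"
proof (cases "Peps eps F A = \<infinity>")
  case False
  define E where "E = subgraph \<Omega> u"
  have uL: "L1_loc \<Omega> u" using u by (simp add: BV_loc_def)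
  have Em: "E \<in> sets lebesgue" unfolding E_def by (rule subgraph_measurable[OF \<Omega> uL])
  define K where "K = closure ((E - F) \<union> (F - E))"
  have K: "compact K" "K \<subseteq> A" using EF by (auto simp: K_def E_def cc_def)
  define V where "V = fst ` A"
  have V: "open V" unfolding V_def by (rule open_image_fst[OF A(1)])
  have AV: "A \<subseteq> V \<times> UNIV" unfolding V_def by force
  have Ac: "compact (closure A)" "closure A \<subseteq> \<Omega> \<times> UNIV" using A(2) by (auto simp: cc_def)
  have VO: "cc V \<Omega>"
  proof (rule cc_compactI)
    show "compact (fst ` closure A)" by (intro compact_continuous_image continuous_intros Ac(1))
    show "V \<subseteq> fst ` closure A" unfolding V_def using closure_subset by blast
    show "fst ` closure A \<subseteq> \<Omega>" using Ac(2) by force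
  qed
  define \<Delta> where "\<Delta> p = indicator F p - (indicator E p :: real)" for p
  have \<Delta>0: "\<Delta> p = 0" if "p \<notin> K" for p
  proof -
    have "p \<notin> (E - F) \<union> (F - E)" using that closure_subset[of "(E - F) \<union> (F - E)"] unfolding K_def by blast
    then show ?thesis by (auto simp: \<Delta>_def indicator_def)
  qed
  have \<Delta>i: "integrable lebesgue \<Delta>"
  proof (rule integrable_bounded_support[OF _ compact_imp_bounded[OF K(1)] \<Delta>0])
    show "\<Delta> \<in> borel_measurable lebesgue" unfolding \<Delta>_def[abs_def] using F Em by simp
    show "norm (\<Delta> p) \<le> 1" for p by (auto simp: \<Delta>_def indicator_def)
  qed
  \<comment> \<open>The signed change of slice length from E to F. It is integrable by Fubini and 0
    over points whose vertical line misses K.\<close>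
  define D where "D z = (\<integral>t. \<Delta> (z, t) \<partial>lebesgue)" for z
  have Di: "integrable lebesgue D" unfolding D_def[abs_def] by (rule lebesgue_Fubini(2)[OF \<Delta>i])
  define v where "v z = u z + D z" for z
  have vL: "L1_loc \<Omega> v"
    unfolding L1_loc_def
  proof (intro allI impI)
    fix C :: "'n plane set" assume C: "compact C \<and> C \<subseteq> \<Omega>"
    then have "set_integrable lebesgue C u" using uL by (simp add: L1_loc_def)
    moreover have "set_integrable lebesgue C D"
      unfolding set_integrable_def by (rule integrable_mult_indicator[OF _ Di]) (use C lmeasurable_compact in blast)
    ultimately show "set_integrable lebesgue C v" unfolding v_def[abs_def] by (rule set_integral_add(1))
  qed
  define u0 where "u0 z = indicator \<Omega> z * u z" for z
  have u0m: "u0 \<in> borel_measurable lebesgue" unfolding u0_def[abs_def] by (rule L1_loc_measurable[OF \<Omega> uL])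
  \<comment> \<open>Stated for every G, since membership of v in \<open>BV_loc\<close> is checked on
    all of them; the comparison itself uses G = V.\<close>
  have ga_le: "graph_area eps v G \<le> Peps eps F (G \<times> UNIV)" if G: "open G" "cc G \<Omega>" for G
  proof (rule graph_area_le_Peps[OF F])
    have GO: "G \<subseteq> \<Omega>" using G(2) closure_subset[of G] unfolding cc_def by blast
    show Gm: "G \<in> sets lebesgue" using G(1) by auto
    have ui: "integrable lebesgue (\<lambda>z. indicator G z * (u0 z - 0))"
    proof -
      have "indicator G z * (u0 z - 0) = indicator G z * u z" for z using GO by (auto simp: u0_def indicator_def)
      then show ?thesis using L1_loc_integrable[OF uL G] by (simp only:)
    qed
    have e1: "indicator G (fst p) * (indicator F p - below 0 (snd p)) = indicator G (fst p) * \<Delta> p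
        + indicator G (fst p) * (below (u0 (fst p)) (snd p) - below 0 (snd p))" for p :: "'n heis"
    proof (cases "fst p \<in> G")
      case True
      then have "indicator E p = below (u0 (fst p)) (snd p)"
        using indicator_subgraph[of "fst p" \<Omega> u "snd p"] GO by (auto simp: E_def u0_def)
      then show ?thesis using True by (simp add: \<Delta>_def)
    qed simp
    have Gfm: "(\<lambda>p::'n heis. indicator G (fst p) :: real) \<in> borel_measurable lebesgue"
      by (rule lebesgue_measurable_fst) (use Gm in simp)
    have iG\<Delta>: "integrable lebesgue (\<lambda>p. indicator G (fst p) * \<Delta> p)"
      by (rule integrable_AE_bounded_mult[OF Gfm _ \<Delta>i, of 1]) (auto simp: indicator_def)
    have iGm: "(indicator G :: 'n plane \<Rightarrow> real) \<in> borel_measurable lebesgue" using Gm by simp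
    have z0m: "(\<lambda>z::'n plane. 0::real) \<in> borel_measurable lebesgue" by simp
    show "integrable lebesgue (\<lambda>p. indicator G (fst p) * (indicator F p - below 0 (snd p)))"
      unfolding e1 by (rule Bochner_Integration.integrable_add[OF iG\<Delta> between_graphs(1)[OF u0m z0m iGm ui]])
    show "AE z in lebesgue. z \<in> G \<longrightarrow> v z = (\<integral>t. indicator F (z, t) - below 0 t \<partial>lebesgue)"
      using lebesgue_Fubini(1)[OF \<Delta>i]
    proof eventually_elim
      case (elim z)
      show ?case
      proof
        assume z: "z \<in> G"
        have "(\<integral>t. indicator F (z, t) - below 0 t \<partial>lebesgue) = (\<integral>t. \<Delta> (z, t) + (below (u z) t - below 0 t) \<partial>lebesgue)"
        proof (rule Bochner_Integration.integral_cong[OF refl])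
          fix t
          have "indicator E (z, t) = below (u z) t" using z GO by (auto simp: E_def subgraph_def below_def indicator_def)
          then show "indicator F (z, t) - below 0 t = \<Delta> (z, t) + (below (u z) t - below 0 t)" by (simp add: \<Delta>_def)
        qed
        also have "\<dots> = D z + (u z - 0)"
          unfolding D_def integral_below_diff[of "u z" 0, symmetric]
          by (rule Bochner_Integration.integral_add[OF elim integrable_below_diff])
        finally show "v z = (\<integral>t. indicator F (z, t) - below 0 t \<partial>lebesgue)" by (simp add: v_def)
      qed
    qed
  qed
  have exch: "Peps eps F (G \<times> UNIV) + Peps eps E A \<le> Peps eps E (G \<times> UNIV) + Peps eps F A" if "V \<subseteq> G" for G
    using that AV EF by (intro Peps_exchange[OF Em F A(1)]) (auto simp: E_def)
  have PE_fin: "Peps eps E (G \<times> UNIV) < \<infinity>" if "open G" "cc G \<Omega>" for G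
    using Peps_subgraph_finite[OF eps u that] unfolding E_def by (rule le_less_trans)
  \<comment> \<open>Finiteness over a cylinder is not assumed of F: it follows from the exchange
    inequality by dropping the nonnegative \<open>Peps eps E A\<close>.\<close>
  have PF_fin: "Peps eps F (G \<times> UNIV) < \<infinity>" if G: "open G" "cc G \<Omega>" "V \<subseteq> G" for G
  proof -
    have "Peps eps F (G \<times> UNIV) + 0 \<le> Peps eps F (G \<times> UNIV) + Peps eps E A"
      by (intro add_left_mono Peps_nonneg)
    also note exch[OF G(3)]
    also have "Peps eps E (G \<times> UNIV) + Peps eps F A < \<infinity>" using PE_fin[OF G(1,2)] False by auto
    finally show ?thesis by simp
  qed
  have vBV: "BV_loc \<Omega> v"
    unfolding BV_loc_def
  proof (intro conjI allI impI vL)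
    fix G assume "open G \<and> cc G \<Omega>"
    then have G: "open G" "cc G \<Omega>" by auto
    \<comment> \<open>The exchange inequality needs a cylinder containing A, so G is enlarged by
      V.\<close>
    have "Peps eps F (G \<times> UNIV) \<le> Peps eps F ((G \<union> V) \<times> UNIV)" by (rule Peps_mono) auto
    also have "\<dots> < \<infinity>" using G V VO by (intro PF_fin cc_Un) auto
    finally have "graph_area eps v G < \<infinity>" using ga_le[OF G] by (rule le_less_trans[rotated])
    moreover have "bounded G" using G(2) unfolding cc_def compact_closure by blast
    ultimately show "total_variation v G < \<infinity>"
      by (intro total_variation_finite[OF G(1)] L1_loc_integrable[OF vL G])
  qed
  have "cc {z\<in>\<Omega>. u z \<noteq> v z} V"
  proof (rule cc_compactI)
    show "compact (fst ` K)" by (intro compact_continuous_image continuous_intros K(1))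
    show "fst ` K \<subseteq> V" unfolding V_def using K(2) by blast
    show "{z\<in>\<Omega>. u z \<noteq> v z} \<subseteq> fst ` K"
    proof (rule ccontr)
      assume "\<not> {z\<in>\<Omega>. u z \<noteq> v z} \<subseteq> fst ` K"
      then obtain z where z: "u z \<noteq> v z" "z \<notin> fst ` K" by blast
      then have "(z, t) \<notin> K" for t by force
      then have "\<Delta> (z, t) = 0" for t by (rule \<Delta>0)
      then show False using z(1) by (simp add: v_def D_def)
    qed
  qed
  from min[OF V VO vBV this]
  have m1: "Peps eps E (V \<times> UNIV) + ereal (LINT z:V|lebesgue. H z * u z)
      \<le> Peps eps (subgraph \<Omega> v) (V \<times> UNIV) + ereal (LINT z:V|lebesgue. H z * v z)" by (simp add: E_def)
  also have "\<dots> \<le> Peps eps F (V \<times> UNIV) + ereal (LINT z:V|lebesgue. H z * v z)"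
    using order_trans[OF Peps_subgraph_finite(1)[OF eps vBV V VO] ga_le[OF V VO]] by (rule add_right_mono)
  finally have m2: "Peps eps E (V \<times> UNIV) + ereal (LINT z:V|lebesgue. H z * u z)
      \<le> Peps eps F (V \<times> UNIV) + ereal (LINT z:V|lebesgue. H z * v z)" .
  define h where "h z = indicator V z * H z" for z
  obtain C where h: "h \<in> borel_measurable lebesgue" "AE z in lebesgue. \<bar>h z\<bar> \<le> C"
    using Linf_loc_weight[OF H V VO] unfolding h_def[abs_def] by blast
  note hi = weighted_integral[OF H V VO, folded h_def]
  note hp = lebesgue_measurable_fst[OF h(1), where 'b=real] AE_lebesgue_fst[OF h(2), where 'b=real]
  have h\<Delta>: "integrable lebesgue (\<lambda>p. h (fst p) * \<Delta> p)" by (rule integrable_AE_bounded_mult[OF hp \<Delta>i])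
  have Ab: "bounded A" using A(2) unfolding cc_def compact_closure by blast
  note hG = weighted_set_integral[OF H V VO _ A(1) Ab AV, folded h_def]
  \<comment> \<open>H does not depend on t, so by Fubini the weighted volume changes by the integral
    of \<open>h z * D z\<close>, exactly as for the graphs.\<close>
  have "(LINT p:(F \<inter> A)|lebesgue. H (fst p)) - (LINT p:(E \<inter> A)|lebesgue. H (fst p)) =
      (\<integral>p. h (fst p) * indicator (F \<inter> A) p - h (fst p) * indicator (E \<inter> A) p \<partial>lebesgue)"
    unfolding hG(2)[OF F] hG(2)[OF Em] by (rule Bochner_Integration.integral_diff[OF hG(1)[OF F] hG(1)[OF Em], symmetric])
  also have "\<dots> = (\<integral>p. h (fst p) * \<Delta> p \<partial>lebesgue)"
  proof (rule Bochner_Integration.integral_cong[OF refl])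
    fix p
    show "h (fst p) * indicator (F \<inter> A) p - h (fst p) * indicator (E \<inter> A) p = h (fst p) * \<Delta> p"
    proof (cases "p \<in> A")
      case True
      then show ?thesis by (simp add: \<Delta>_def indicator_def right_diff_distrib)
    next
      case F': False
      then have "p \<notin> K" using K(2) by blast
      then show ?thesis using F' \<Delta>0 by (simp add: indicator_def)
    qed
  qed
  also have "\<dots> = (\<integral>z. h z * D z \<partial>lebesgue)"
    unfolding lebesgue_Fubini(3)[OF h\<Delta>] by (simp add: D_def)
  also have "\<dots> = (\<integral>z. h z * v z - h z * u z \<partial>lebesgue)" by (simp add: v_def algebra_simps)
  also have "\<dots> = (LINT z:V|lebesgue. H z * v z) - (LINT z:V|lebesgue. H z * u z)"
    unfolding hi(2)[OF vL] hi(2)[OF uL] by (rule Bochner_Integration.integral_diff[OF hi(1)[OF vL] hi(1)[OF uL]])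
  finally have Hdiff: "(LINT p:(F \<inter> A)|lebesgue. H (fst p)) - (LINT p:(E \<inter> A)|lebesgue. H (fst p)) =
      (LINT z:V|lebesgue. H z * v z) - (LINT z:V|lebesgue. H z * u z)" .
  have fin: "Peps eps E (V \<times> UNIV) < \<infinity>" "Peps eps F (V \<times> UNIV) < \<infinity>" "Peps eps E A < \<infinity>"
    using PE_fin[OF V VO] PF_fin[OF V VO] le_less_trans[OF Peps_mono[OF AV] PE_fin[OF V VO]] by auto
  obtain a b c d where abcd: "Peps eps E (V \<times> UNIV) = ereal a" "Peps eps F (V \<times> UNIV) = ereal b" "Peps eps E A = ereal c" "Peps eps F A = ereal d"
  proof -
    have "\<exists>r. x = ereal r" if "0 \<le> x" "x \<noteq> \<infinity>" for x :: ereal using that by (cases x) auto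
    then show ?thesis using that Peps_nonneg fin False by (metis less_irrefl)
  qed
  \<comment> \<open>Adding \<open>m2\<close> and the exchange inequality cancels the cylinder
    perimeters a and b.\<close>
  have "c + (LINT p:(E \<inter> A)|lebesgue. H (fst p)) \<le> d + (LINT p:(F \<inter> A)|lebesgue. H (fst p))"
    using m2 exch[OF order_refl] Hdiff unfolding abcd by simp
  then show ?thesis using abcd by (simp add: E_def)
qed simp

text \<open>Besides the splice, two errors must vanish as s grows: the perimeter of E that a bounded
  A misses, handled by \<open>Peps_tight\<close>, and the weighted volume between the graphs beyond
  height s, handled by dominated convergence.\<close>

lemma set_minimizer_imp_graph_minimizer:
  fixes \<Omega> :: "'n::finite plane set"
  assumes eps: "eps \<noteq> 0" and \<Omega>: "open \<Omega>" and H: "Linf_loc \<Omega> H" and u: "BV_loc \<Omega> u"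
    and min: "\<And>A F. open A \<Longrightarrow> cc A (\<Omega> \<times> UNIV) \<Longrightarrow> F \<in> sets lebesgue \<Longrightarrow>
            cc ((subgraph \<Omega> u - F) \<union> (F - subgraph \<Omega> u)) A \<Longrightarrow>
            Peps eps (subgraph \<Omega> u) A + ereal (LINT p:(subgraph \<Omega> u \<inter> A)|lebesgue. H (fst p))
            \<le> Peps eps F A + ereal (LINT p:(F \<inter> A)|lebesgue. H (fst p))"
    and V: "open V" "cc V \<Omega>" and v: "BV_loc \<Omega> v" and uv: "cc {z\<in>\<Omega>. u z \<noteq> v z} V"
  shows "Peps eps (subgraph \<Omega> u) (V \<times> UNIV) + ereal (LINT z:V|lebesgue. H z * u z)
            \<le> Peps eps (subgraph \<Omega> v) (V \<times> UNIV) + ereal (LINT z:V|lebesgue. H z * v z)"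
proof -
  define E where "E = subgraph \<Omega> u"
  define G where "G = subgraph \<Omega> v"
  have uL: "L1_loc \<Omega> u" and vL: "L1_loc \<Omega> v" using u v by (auto simp: BV_loc_def)
  have Em: "E \<in> sets lebesgue" unfolding E_def by (rule subgraph_measurable[OF \<Omega> uL])
  have Gm: "G \<in> sets lebesgue" unfolding G_def by (rule subgraph_measurable[OF \<Omega> vL])
  have VO: "V \<subseteq> \<Omega>" using V(2) closure_subset[of V] unfolding cc_def by blast
  have Vb: "bounded V" using V(2) unfolding cc_def compact_closure by blast
  have Vm: "V \<in> sets lebesgue" using V(1) by auto
  obtain R where R: "R > 0" "V \<subseteq> ball 0 R" using bounded_subset_ballD[OF Vb, of 0] by blast
  have real_ex: "\<exists>r. x = ereal r" if "0 \<le> x" "x < \<infinity>" for x :: ereal using that by (cases x) auto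
  have "Peps eps E (V \<times> UNIV) < \<infinity>" "Peps eps G (V \<times> UNIV) < \<infinity>"
    using le_less_trans[OF Peps_subgraph_finite[OF eps u V]] le_less_trans[OF Peps_subgraph_finite[OF eps v V]]
    by (auto simp: E_def G_def)
  then obtain pu pv where pu: "Peps eps E (V \<times> UNIV) = ereal pu" and pv: "Peps eps G (V \<times> UNIV) = ereal pv"
    using real_ex[OF Peps_nonneg] by metis
  define u0 where "u0 z = indicator \<Omega> z * u z" for z
  define v0 where "v0 z = indicator \<Omega> z * v z" for z
  have u0m: "u0 \<in> borel_measurable lebesgue" unfolding u0_def[abs_def] by (rule L1_loc_measurable[OF \<Omega> uL])
  have v0m: "v0 \<in> borel_measurable lebesgue" unfolding v0_def[abs_def] by (rule L1_loc_measurable[OF \<Omega> vL])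
  define h where "h z = indicator V z * H z" for z
  obtain C where h: "h \<in> borel_measurable lebesgue" "AE z in lebesgue. \<bar>h z\<bar> \<le> C"
    using Linf_loc_weight[OF H V] unfolding h_def[abs_def] by blast
  note hi = weighted_integral[OF H V, folded h_def]
  define hu where "hu = (LINT z:V|lebesgue. H z * u z)"
  define hv where "hv = (LINT z:V|lebesgue. H z * v z)"
  have h0: "h z * (v0 z - u0 z) = h z * v z - h z * u z" for z
    using VO by (auto simp: h_def u0_def v0_def indicator_def algebra_simps)
  have hd: "integrable lebesgue (\<lambda>z. h z * (v0 z - u0 z))" "(\<integral>z. h z * (v0 z - u0 z) \<partial>lebesgue) = hv - hu"
    unfolding h0 hu_def hv_def hi(2)[OF vL] hi(2)[OF uL]
    using hi(1)[OF vL] hi(1)[OF uL] by simp_all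
  note bt = between_graphs[OF v0m u0m h(1) hd(1)]
  define g where "g p = h (fst p) * (below (v0 (fst p)) (snd p) - below (u0 (fst p)) (snd p))" for p :: "'n heis"
  have gi: "integrable lebesgue g" "(\<integral>p. g p \<partial>lebesgue) = hv - hu"
    using bt(1,2) hd(2) unfolding g_def[abs_def] by auto
  have g_eq: "g p = h (fst p) * (indicator G p - indicator E p)" for p
  proof (cases "fst p \<in> V")
    case True
    then have "fst p \<in> \<Omega>" using VO by blast
    then show ?thesis
      using indicator_subgraph[of "fst p" \<Omega> u "snd p"] indicator_subgraph[of "fst p" \<Omega> v "snd p"]
      by (simp add: g_def E_def G_def u0_def v0_def)
  qed (simp add: g_def h_def)
  \<comment> \<open>Where both \<open>\<bar>u\<bar>\<close> and \<open>\<bar>v\<bar>\<close> are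
    below n, the slices of E and G agree at all heights with
    \<open>n \<le> \<bar>t\<bar>\<close>.\<close>
  define S where "S n = {z \<in> V. real n \<le> \<bar>v0 z\<bar> \<or> real n \<le> \<bar>u0 z\<bar>}" for n :: nat
  have Sm: "S n \<in> sets lebesgue" for n unfolding S_def by (rule measure_superlevel_tendsto_0(2)[OF v0m u0m Vm Vb])
  have Slim: "(\<lambda>n. 16 * (\<bar>eps\<bar> + R) * measure lebesgue (S n)) \<longlonglongrightarrow> 0"
    using tendsto_mult_left[OF measure_superlevel_tendsto_0(1)[OF v0m u0m Vm Vb], of "16 * (\<bar>eps\<bar> + R)"] by (simp add: S_def)
  define slab where "slab n = {p::'n heis. \<bar>snd p\<bar> < real n + 1}" for n :: nat
  have slabm: "slab n \<in> sets lebesgue" for n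
  proof -
    have "open (slab n)" unfolding slab_def by (intro open_Collect_less continuous_intros)
    then show ?thesis by auto
  qed
  have glim: "(\<lambda>n. \<integral>p. indicator (slab n) p * g p \<partial>lebesgue) \<longlonglongrightarrow> hv - hu"
    unfolding gi(2)[symmetric]
  proof (rule integral_dominated_convergence[where w="\<lambda>p. \<bar>g p\<bar>"])
    show "g \<in> borel_measurable lebesgue" by (rule borel_measurable_integrable[OF gi(1)])
    then show "(\<lambda>p. indicator (slab n) p * g p) \<in> borel_measurable lebesgue" for n using slabm by simp
    show "integrable lebesgue (\<lambda>p. \<bar>g p\<bar>)" using gi(1) by simp
    show "AE p in lebesgue. norm (indicator (slab n) p * g p) \<le> \<bar>g p\<bar>" for n
      by (rule AE_I2) (simp add: indicator_def)
    show "AE p in lebesgue. (\<lambda>n. indicator (slab n) p * g p) \<longlonglongrightarrow> g p"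
    proof (rule AE_I2)
      fix p :: "'n heis"
      obtain N where N: "\<bar>snd p\<bar> \<le> real N" using real_arch_simple by blast
      have "eventually (\<lambda>n. indicator (slab n) p * g p = g p) sequentially"
        using eventually_ge_at_top[of N] by eventually_elim (use N in \<open>simp add: slab_def\<close>)
      then show "(\<lambda>n. indicator (slab n) p * g p) \<longlonglongrightarrow> g p" by (rule tendsto_eventually)
    qed
  qed
  have "pu + hu \<le> pv + hv"
  proof (rule field_le_epsilon)
    fix \<delta> :: real assume "\<delta> > 0"
    \<comment> \<open>Four errors of size e: one from the lower bound for E in A, two from the
      spliced perimeter, one from the volume term.\<close>
    define e where "e = \<delta> / 4"
    have e: "e > 0" using \<open>\<delta> > 0\<close> by (simp add: e_def)
    obtain U0 T where U0: "admissible eps (V \<times> {t. \<bar>t\<bar> < T}) U0" "pu - e < (\<integral>p. indicator E p * ediv U0 p \<partial>lebesgue)"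
      "\<And>U. admissible eps (V \<times> {t. \<bar>t\<bar> > T}) U \<Longrightarrow> (\<integral>p. indicator E p * ediv U p \<partial>lebesgue) \<le> e"
      using Peps_tight[OF Em pu e] by blast
    obtain N where N: "T + 1 \<le> real N" using real_arch_simple by blast
    have "eventually (\<lambda>n. 16 * (\<bar>eps\<bar> + R) * measure lebesgue (S n) < e) sequentially"
      using Slim e by (rule order_tendstoD(2))
    moreover have "eventually (\<lambda>n. (\<integral>p. indicator (slab n) p * g p \<partial>lebesgue) < hv - hu + e) sequentially"
      using glim e by (intro order_tendstoD(2)) auto
    ultimately have "eventually (\<lambda>n. 16 * (\<bar>eps\<bar> + R) * measure lebesgue (S n) < e \<and>
        (\<integral>p. indicator (slab n) p * g p \<partial>lebesgue) < hv - hu + e \<and> n \<ge> N) sequentially"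
      using eventually_ge_at_top[of N] by eventually_elim auto
    then obtain n where n: "16 * (\<bar>eps\<bar> + R) * measure lebesgue (S n) < e"
      "(\<integral>p. indicator (slab n) p * g p \<partial>lebesgue) < hv - hu + e" "n \<ge> N"
      by (auto simp: eventually_sequentially)
    \<comment> \<open>As s - 1 = n, the layers of the splice lie at heights where the slices agree
      off \<open>S n\<close>; and s - 2 = n - 1 is at least T by the choice of N.\<close>
    define s where "s = real n + 1"
    have sT: "s - 2 \<ge> T" "s > 0" using n(3) N by (auto simp: s_def)
    define F where "F = (G \<inter> {p. \<bar>snd p\<bar> < s}) \<union> (E \<inter> {p. \<bar>snd p\<bar> \<ge> s})"
    have slab_s: "slab n = {p. \<bar>snd p\<bar> < s}" by (simp add: slab_def s_def)
    have Feq: "F = (G \<inter> slab n) \<union> (E - slab n)" unfolding F_def slab_s by auto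
    have Fm: "F \<in> sets lebesgue" unfolding Feq using Gm Em slabm by auto
    have "Peps eps F (V \<times> UNIV) \<le> ereal (pv + e + 16 * (\<bar>eps\<bar> + R) * measure lebesgue (S n))"
      unfolding F_def
    proof (rule Peps_spliced_le[OF eps V(1) R(2) Gm Em Sm])
      show "S n \<subseteq> V" by (auto simp: S_def)
      show "z \<in> S n" if z: "z \<in> V" and t: "s - 1 \<le> \<bar>t\<bar>" and ne: "((z, t) \<in> G) \<noteq> ((z, t) \<in> E)" for z t
      proof -
        have zO: "z \<in> \<Omega>" using z VO by blast
        then have "(t < v z) \<noteq> (t < u z)" using ne by (auto simp: G_def E_def subgraph_def)
        moreover have "real n \<le> \<bar>t\<bar>" using t by (simp add: s_def)
        ultimately have "real n \<le> \<bar>v z\<bar> \<or> real n \<le> \<bar>u z\<bar>" by linarith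
        then show ?thesis using z zO by (simp add: S_def u0_def v0_def)
      qed
      show "Peps eps G (V \<times> UNIV) \<le> ereal pv" using pv by simp
      show "(\<integral>p. indicator E p * ediv U p \<partial>lebesgue) \<le> e" if "admissible eps (V \<times> {t. \<bar>t\<bar> > s - 2}) U" for U
        by (rule U0(3)[OF admissible_mono[OF that]]) (use sT in auto)
    qed
    then have PF: "Peps eps F (V \<times> UNIV) \<le> ereal (pv + 2 * e)" using n(1) by (elim order_trans) simp
    \<comment> \<open>The margin 1 above s makes the symmetric difference of E and F, confined to
      \<open>\<bar>t\<bar> < s\<close>, compactly contained in A.\<close>
    define A where "A = V \<times> ball (0::real) (s + 1)"
    have A: "open A" unfolding A_def using V(1) by (simp add: open_Times)
    have AO: "cc A (\<Omega> \<times> UNIV)"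
    proof (rule cc_compactI)
      show "compact (closure V \<times> cball (0::real) (s + 1))" using V(2) by (intro compact_Times) (auto simp: cc_def)
      show "A \<subseteq> closure V \<times> cball (0::real) (s + 1)" unfolding A_def by (intro Sigma_mono closure_subset ball_subset_cball)
      show "closure V \<times> cball (0::real) (s + 1) \<subseteq> \<Omega> \<times> UNIV" using V(2) unfolding cc_def by blast
    qed
    have EFA: "cc ((E - F) \<union> (F - E)) A"
    proof (rule cc_compactI)
      show "compact (closure {z\<in>\<Omega>. u z \<noteq> v z} \<times> cball (0::real) s)"
        using uv by (intro compact_Times) (auto simp: cc_def)
      show "closure {z\<in>\<Omega>. u z \<noteq> v z} \<times> cball (0::real) s \<subseteq> A"
        using uv unfolding cc_def A_def by (intro Sigma_mono) auto
      have "p \<in> closure {z\<in>\<Omega>. u z \<noteq> v z} \<times> cball (0::real) s" if p: "p \<in> (E - F) \<union> (F - E)" for p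
      proof -
        obtain z t where zt: "p = (z, t)" by fastforce
        have "\<bar>t\<bar> < s" "((z, t) \<in> G) \<noteq> ((z, t) \<in> E)" using p unfolding zt F_def by auto
        then have "z \<in> {z\<in>\<Omega>. u z \<noteq> v z}" "\<bar>t\<bar> \<le> s" by (auto simp: G_def E_def subgraph_def)
        then show ?thesis using closure_subset[of "{z\<in>\<Omega>. u z \<noteq> v z}"] unfolding zt by auto
      qed
      then show "(E - F) \<union> (F - E) \<subseteq> closure {z\<in>\<Omega>. u z \<noteq> v z} \<times> cball (0::real) s" by blast
    qed
    \<comment> \<open>U0 lives at heights below T, hence in A: the bounded set A already carries all
      but e of the perimeter of E.\<close>
    have "admissible eps A U0" by (rule admissible_mono[OF U0(1)]) (use sT in \<open>auto simp: A_def\<close>)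
    then have "ereal (\<integral>p. indicator E p * ediv U0 p \<partial>lebesgue) \<le> Peps eps E A" by (rule Peps_upper)
    then have PE: "ereal (pu - e) \<le> Peps eps E A" using U0(2) by (elim order_trans[rotated]) simp
    have "Peps eps F A \<le> Peps eps F (V \<times> UNIV)" by (rule Peps_mono) (auto simp: A_def)
    then have PFA: "Peps eps F A \<le> ereal (pv + 2 * e)" using PF by (rule order_trans)
    have "ereal (pu - e) + ereal (LINT p:(E \<inter> A)|lebesgue. H (fst p)) \<le> Peps eps E A + ereal (LINT p:(E \<inter> A)|lebesgue. H (fst p))"
      by (intro add_right_mono PE)
    also have "\<dots> \<le> Peps eps F A + ereal (LINT p:(F \<inter> A)|lebesgue. H (fst p))"
      using min[OF A AO Fm] EFA by (simp add: E_def)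
    also have "\<dots> \<le> ereal (pv + 2 * e) + ereal (LINT p:(F \<inter> A)|lebesgue. H (fst p))"
      by (intro add_right_mono PFA)
    finally have main: "pu - e + (LINT p:(E \<inter> A)|lebesgue. H (fst p)) \<le> pv + 2 * e + (LINT p:(F \<inter> A)|lebesgue. H (fst p))"
      by simp
    have Ab: "bounded A" using AO unfolding cc_def compact_closure by blast
    have AV: "A \<subseteq> V \<times> UNIV" by (auto simp: A_def)
    note hG = weighted_set_integral[OF H V _ A Ab AV, folded h_def]
    have "(LINT p:(F \<inter> A)|lebesgue. H (fst p)) - (LINT p:(E \<inter> A)|lebesgue. H (fst p)) =
        (\<integral>p. h (fst p) * indicator (F \<inter> A) p - h (fst p) * indicator (E \<inter> A) p \<partial>lebesgue)"
      unfolding hG(2)[OF Fm] hG(2)[OF Em] by (rule Bochner_Integration.integral_diff[OF hG(1)[OF Fm] hG(1)[OF Em], symmetric])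
    also have "\<dots> = (\<integral>p. indicator (slab n) p * g p \<partial>lebesgue)"
    proof (rule Bochner_Integration.integral_cong[OF refl])
      fix p
      show "h (fst p) * indicator (F \<inter> A) p - h (fst p) * indicator (E \<inter> A) p = indicator (slab n) p * g p"
      proof (cases "fst p \<in> V")
        case True
        show ?thesis
        proof (cases "p \<in> slab n")
          case sl: True
          then have "p \<in> A" using True by (cases p) (auto simp: A_def slab_s)
          then show ?thesis using sl by (simp add: g_eq Feq indicator_def right_diff_distrib)
        next
          case sl: False
          then show ?thesis by (simp add: Feq indicator_def)
        qed
      qed (simp add: h_def g_eq)
    qed
    finally have "(LINT p:(F \<inter> A)|lebesgue. H (fst p)) - (LINT p:(E \<inter> A)|lebesgue. H (fst p)) < hv - hu + e"
      using n(2) by simp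
    then show "pu + hu \<le> pv + hv + \<delta>" using main by (simp add: e_def)
  qed
  then show ?thesis using pu pv by (simp add: E_def G_def hu_def hv_def)
qed

theorem theorem5p5:
  fixes eps :: real and \<Omega> :: "'n::finite plane set"
    and H :: "'n plane \<Rightarrow> real" and u :: "'n plane \<Rightarrow> real"
  assumes "eps \<noteq> 0"
    and "open \<Omega>" and "connected \<Omega>" and "bounded \<Omega>"
    and "Linf_loc \<Omega> H"
    and "BV_loc \<Omega> u"
  shows "(\<forall>\<Omega>' v. open \<Omega>' \<and> cc \<Omega>' \<Omega> \<and> BV_loc \<Omega> v \<and> cc {z\<in>\<Omega>. u z \<noteq> v z} \<Omega>' \<longrightarrow>
            Peps eps (subgraph \<Omega> u) (\<Omega>' \<times> UNIV) + ereal (LINT z:\<Omega>'|lebesgue. H z * u z)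
            \<le> Peps eps (subgraph \<Omega> v) (\<Omega>' \<times> UNIV) + ereal (LINT z:\<Omega>'|lebesgue. H z * v z))
     \<longleftrightarrow>
         (\<forall>A F. open A \<and> cc A (\<Omega> \<times> UNIV) \<and> F \<in> sets lebesgue
             \<and> cc ((subgraph \<Omega> u - F) \<union> (F - subgraph \<Omega> u)) A \<longrightarrow>
            Peps eps (subgraph \<Omega> u) A + ereal (LINT p:(subgraph \<Omega> u \<inter> A)|lebesgue. H (fst p))
            \<le> Peps eps F A + ereal (LINT p:(F \<inter> A)|lebesgue. H (fst p)))"
proof (rule iffI, goal_cases)
  case 1
  then show ?case
    using graph_minimizer_imp_set_minimizer[OF assms(1,2,5,6)] by blast
next
  case 2
  then show ?case
    using set_minimizer_imp_graph_minimizer[OF assms(1,2,5,6)] by blast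
qed

end
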